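(* Let $N=2$, $\beta<\gamma$, $k>0$ and $V_k(r)=\dfrac{1}{r^2(-\log(r/e))^{2+k}}$. Put $p_s=k+1$, $p_c=2k+1$ and $$p^+_{\mathrm{JL}}=\begin{cases}1+\dfrac{2k}{1-k-\sqrt{k(k+2)}}& \text{if } k<\frac14,\\ \infty& \text{if } k\ge\frac14.\end{cases}$$ Consider the radial solution $v=v(r,\beta)$ of $-\Delta v(r,\beta)=V_k(|x|)f(v(r,\beta))$ in $B_e$ satisfying $v(0,\beta)=\beta$. Then the solution $v\in C^0[0,e)\cap C^2(0,e)$ is unique. Moreover: (i) when $f(v)=e^v$, one has $v(r,\beta)<v(r,\gamma)$ in $B_e$ if $k\le\frac14$, while $v(r,\beta)$ and $v(r,\gamma)$ intersect infinitely many times if $k>\frac14$; (ii) when $f(v)=|v|^p$ with $p_s<p<p_c$, for any $\beta>0$ one has $v(r,\beta)=0$ for some $r<e$; (iii) when $f(v)=|v|^p$ with $p\ge p_c$ and $\beta>0$, one has $v(r,\beta)>0$ in $B_e$; moreover $v(r,\beta)<v(r,\gamma)$ in $B_e$ if $p\ge p^+_{\mathrm{JL}}$, while $v(r,\beta)$ intersects $v(r,\gamma)$ infinitely many times if $p_c<p<p^+_{\mathrm{JL}}$.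
   Context: $B_e\subset\mathbb{R}^2$ is the open ball of radius $e$ (Euler's number) centered at the origin, and $r=|x|$. The nonlinearity $f$ is one of those named in (i)–(iii). The radial equation reads $v''+\frac1r v'+V_k(r)f(v)=0$ for $0<r<e$.
   Formalization: In case (ii), and for β<0 with f=|v|^p, no solution exists on all of [0,e): it tends to -∞ before r=e. There v(r,β) is taken as the maximal solution on [0,R), R≤e; it is proved to exist, uniqueness holds on every [0,R), and the zero in (ii) lies in (0,R). *)

theory Defs
  imports "HOL-Analysis.Analysis"
begin

definition V :: "real \<Rightarrow> real \<Rightarrow> real" where
  "V k r = 1 / (r\<^sup>2 * (- ln (r / exp 1)) powr (2 + k))"

definition p_s :: "real \<Rightarrow> real" where
  "p_s k = k + 1"

definition p_c :: "real \<Rightarrow> real" where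
  "p_c k = 2 * k + 1"

definition p_JL :: "real \<Rightarrow> ereal" where
  "p_JL k = (if k < 1/4 then ereal (1 + 2 * k / (1 - k - sqrt (k * (k + 2)))) else \<infinity>)"

definition f_pow :: "real \<Rightarrow> real \<Rightarrow> real" where
  "f_pow p s = \<bar>s\<bar> powr p"

definition nonlinearities :: "real \<Rightarrow> (real \<Rightarrow> real) set" where
  "nonlinearities k = {exp} \<union> {f_pow p |p. p_s k < p}"

definition C2_on :: "real set \<Rightarrow> (real \<Rightarrow> real) \<Rightarrow> bool" where
  "C2_on S v \<longleftrightarrow>
     (\<forall>r\<in>S. v field_differentiable at r \<and> deriv v field_differentiable at r)
     \<and> continuous_on S (deriv (deriv v))"

text \<open>
  Radial solutions with value \<open>\<beta>\<close> at the centre, as functions of the radius, on a ball of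
  radius \<open>R \<le> e\<close> (the full problem is \<open>R = e\<close>). In dimension two the Laplacian of
  a radial function is \<open>v'' + v' / r\<close>. Smaller radii are needed because for
  \<open>f s = \<bar>s\<bar> powr p\<close> a solution that is negative somewhere can tend to \<open>-\<infinity>\<close>
  at some radius below \<open>e\<close>. Values of \<open>v\<close> outside \<open>{0..<R}\<close> are irrelevant.
\<close>

definition radial_solution ::
    "real \<Rightarrow> (real \<Rightarrow> real) \<Rightarrow> real \<Rightarrow> real \<Rightarrow> (real \<Rightarrow> real) \<Rightarrow> bool" where
  "radial_solution k f \<beta> R v \<longleftrightarrow>
     0 < R \<and> R \<le> exp 1 \<and>
     continuous_on {0..<R} v \<and> C2_on {0<..<R} v \<and> v 0 = \<beta> \<and>
     (\<forall>r\<in>{0<..<R}. - (deriv (deriv v) r + deriv v r / r) = V k r * f (v r))"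

definition maximal_radial_solution ::
    "real \<Rightarrow> (real \<Rightarrow> real) \<Rightarrow> real \<Rightarrow> real \<Rightarrow> (real \<Rightarrow> real) \<Rightarrow> bool" where
  "maximal_radial_solution k f \<beta> R v \<longleftrightarrow>
     radial_solution k f \<beta> R v \<and>
     \<not> (\<exists>S w. R < S \<and> radial_solution k f \<beta> S w \<and> (\<forall>r\<in>{0..<R}. w r = v r))"

definition intersect_infinitely_often :: "(real \<Rightarrow> real) \<Rightarrow> (real \<Rightarrow> real) \<Rightarrow> bool" where
  "intersect_infinitely_often v w \<longleftrightarrow> infinite {r. 0 < r \<and> r < exp 1 \<and> v r = w r}"

end

theory Submission
  imports Defs
begin

text \<open>
  In the coordinate \<open>x = - ln (1 - ln r)\<close>, which maps the centre to \<open>- \<infinity>\<close> and the boundary of the ball to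
  \<open>+ \<infinity>\<close>, the radial equation is \<open>y'' + y' + exp (k x) f y = 0\<close>: a Lane-Emden equation in the fractional
  dimension \<open>2 + 2 / k\<close>. For both nonlinearities a rescaling makes it autonomous with constant damping, so it
  has a monotone energy and an explicit singular solution corresponding to an equilibrium. For powers, the sign of
  the damping changes at \<open>p_c\<close>; below it the energy excludes positive entire solutions, above it positivity and
  convergence to the singular solution follow. The linearisation at the singular solution is non-oscillatory
  exactly if \<open>exp (k x) f'\<close> is at most \<open>1 / 4\<close> there, which is the condition \<open>k \<le> 1 / 4\<close> (exponential) or
  \<open>p \<ge> p_JL\<close> (power). In that case convexity of \<open>f\<close> orders regular solutions below the singular one and among
  each other; otherwise the difference of two solutions oscillates by Sturm comparison.
\<close>

section \<open>Solutions in the logarithmic coordinate\<close>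

text \<open>In dimension N = 2 + 2 / k the constants are the classical ones: \<open>p_s\<close> is N
  / (N - 2), \<open>p_c\<close> is the Sobolev exponent (N + 2) / (N - 2), \<open>p_JL\<close> is
  the Joseph-Lundgren exponent, and k = 1 / 4 means N = 10. The number 1 / 4 in the linearisation is
  the value of c up to which y'' + y' + c y = 0 does not oscillate. Two obstacles shape the proof.
  The data sit at x = - \<infinity>, where only the value of y is prescribed; so every integration
  starts from a limit, and the decay of y' has to be extracted from the equation. And the
  nonlinearities are neither bounded nor globally Lipschitz, so existence is proved for truncated
  ones; as f is nonnegative, solutions decrease, and a truncation is felt only once y has fallen to
  its lower edge. At p = p_c the damping vanishes: the energy still gives positivity, but it no
  longer forces convergence, so the crossing argument starts above \<open>p_c\<close>.\<close>

lemma deriv_nonpos_le_limit_at_bot: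
  fixes P P' :: "real \<Rightarrow> real"
  assumes lim: "(P \<longlongrightarrow> l) at_bot"
    and d: "\<And>z. z \<le> x \<Longrightarrow> (P has_real_derivative P' z) (at z)"
    and le: "\<And>z. z \<le> x \<Longrightarrow> P' z \<le> 0"
  shows "P x \<le> l"
proof (rule tendsto_lowerbound[OF lim])
  show "\<forall>\<^sub>F z in at_bot. P x \<le> P z"
    using eventually_le_at_bot[of x]
  proof eventually_elim
    case (elim z)
    show ?case
      by (rule DERIV_nonpos_imp_nonincreasing[OF elim]) (meson d le)
  qed
qed simp

lemma deriv_nonneg_ge_limit_at_bot:
  fixes P P' :: "real \<Rightarrow> real"
  assumes lim: "(P \<longlongrightarrow> l) at_bot"
    and d: "\<And>z. z \<le> x \<Longrightarrow> (P has_real_derivative P' z) (at z)"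
    and ge: "\<And>z. z \<le> x \<Longrightarrow> P' z \<ge> 0"
  shows "P x \<ge> l"
  using deriv_nonpos_le_limit_at_bot[of "\<lambda>z. - P z" "- l" x "\<lambda>z. - P' z"]
    tendsto_minus[OF lim] DERIV_minus[OF d] ge by auto

lemma deriv_neg_less_limit_at_bot:
  fixes P P' :: "real \<Rightarrow> real"
  assumes lim: "(P \<longlongrightarrow> l) at_bot"
    and d: "\<And>z. z \<le> x \<Longrightarrow> (P has_real_derivative P' z) (at z)"
    and le: "\<And>z. z \<le> x \<Longrightarrow> P' z < 0"
  shows "P x < l"
proof -
  \<comment> \<open>Passing to the limit gives only a weak inequality; the last unit step restores
    strictness.\<close>
  have "P (x - 1) \<le> l"
    by (rule deriv_nonpos_le_limit_at_bot[OF lim, where P' = P']) (use d le in \<open>auto intro: less_imp_le\<close>)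
  moreover have "P x < P (x - 1)"
    by (rule DERIV_neg_imp_decreasing) (use d le in force)+
  ultimately show ?thesis by simp
qed

lemma deriv_pos_greater_limit_at_bot:
  fixes P P' :: "real \<Rightarrow> real"
  assumes lim: "(P \<longlongrightarrow> l) at_bot"
    and d: "\<And>z. z \<le> x \<Longrightarrow> (P has_real_derivative P' z) (at z)"
    and ge: "\<And>z. z \<le> x \<Longrightarrow> P' z > 0"
  shows "P x > l"
  using deriv_neg_less_limit_at_bot[of "\<lambda>z. - P z" "- l" x "\<lambda>z. - P' z"]
    tendsto_minus[OF lim] DERIV_minus[OF d] ge by auto

lemma exp_mult_tendsto_0_at_bot:
  fixes c :: real
  assumes "c > 0"
  shows "((\<lambda>x. exp (c * x)) \<longlongrightarrow> 0) at_bot"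
  by (rule filterlim_compose[OF exp_at_bot])
     (rule filterlim_tendsto_pos_mult_at_bot[OF tendsto_const assms filterlim_ident])

text \<open>Needed because the singular solution for the exponential nonlinearity is affine in
  x.\<close>

lemma exp_mult_linear_tendsto_0_at_bot:
  fixes c :: real
  assumes "c > 0"
  shows "((\<lambda>x. exp (c * x) * x) \<longlongrightarrow> 0) at_bot"
proof -
  have "((\<lambda>x. x * exp (- x)) \<longlongrightarrow> (0::real)) at_top"
    using tendsto_power_div_exp_0[of 1] by (simp add: exp_minus field_simps)
  moreover have "filterlim (\<lambda>x. - (c * x)) at_top at_bot"
    using filterlim_tendsto_pos_mult_at_bot[OF tendsto_const assms filterlim_ident]
    by (simp add: filterlim_uminus_at_top)
  ultimately have "((\<lambda>x. - (c * x) * exp (c * x)) \<longlongrightarrow> 0) at_bot"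
    by (auto dest: filterlim_compose)
  then have "((\<lambda>x. (- 1 / c) * (- (c * x) * exp (c * x))) \<longlongrightarrow> (- 1 / c) * 0) at_bot"
    by (rule tendsto_mult_left)
  then show ?thesis using assms by (simp add: mult.commute)
qed

text \<open>
  The radial equation in the coordinate \<open>x = - ln (1 - ln r)\<close>; the ball of radius \<open>R\<close> corresponds to
  \<open>T = 1 - ln R\<close>, so \<open>T = 0\<close> is the full problem on the whole line.
\<close>

definition log_sol :: "real \<Rightarrow> (real \<Rightarrow> real) \<Rightarrow> real \<Rightarrow> real \<Rightarrow> (real \<Rightarrow> real) \<Rightarrow> (real \<Rightarrow> real) \<Rightarrow> bool" where
  "log_sol k f \<beta> T y y' \<longleftrightarrow> (y \<longlongrightarrow> \<beta>) at_bot \<and>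
     (\<forall>x. T < exp (- x) \<longrightarrow> (y has_real_derivative y' x) (at x) \<and>
        (y' has_real_derivative (- y' x - exp (k * x) * f (y x))) (at x))"

lemma log_sol_tendsto: "log_sol k f \<beta> T y y' \<Longrightarrow> (y \<longlongrightarrow> \<beta>) at_bot"
  and log_sol_deriv: "log_sol k f \<beta> T y y' \<Longrightarrow> T < exp (- x) \<Longrightarrow> (y has_real_derivative y' x) (at x)"
  and log_sol_deriv2: "log_sol k f \<beta> T y y' \<Longrightarrow> T < exp (- x) \<Longrightarrow>
      (y' has_real_derivative (- y' x - exp (k * x) * f (y x))) (at x)"
  unfolding log_sol_def by auto

lemma less_exp_minus_downward: "T < exp (- x) \<Longrightarrow> z \<le> x \<Longrightarrow> T < exp (- z)" for T x z :: real
  by (smt (verit) exp_le_cancel_iff)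

lemma eventually_less_exp_minus: "\<forall>\<^sub>F x in at_bot. T < exp (- x)" for T :: real
proof -
  have "filterlim (\<lambda>x::real. exp (- x)) at_top at_bot"
    by (rule filterlim_compose[OF exp_at_top]) (rule filterlim_uminus_at_top_at_bot)
  then show ?thesis by (simp add: filterlim_at_top_dense)
qed

text \<open>\<open>exp x * y' x\<close> is r v'(r) in the original variables. The integrating factor
  removes the damping, so the sign of f alone decides whether this momentum decreases.\<close>

lemma log_sol_momentum_deriv:
  assumes "log_sol k f \<beta> T y y'" "T < exp (- x)"
  shows "((\<lambda>x. exp x * y' x) has_real_derivative (- exp ((1 + k) * x) * f (y x))) (at x)"
  by (rule derivative_eq_intros log_sol_deriv2[OF assms] refl)+
     (simp add: algebra_simps exp_add)

text \<open>The value at the centre alone controls y' there. To the left of x the momentum varies by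
  at most \<open>G x\<close>, and since y converges, the mean value theorem finds points arbitrarily
  far left where the momentum is small. Hence it is bounded by \<open>G x\<close>, which is the
  claimed rate.\<close>

lemma log_sol_deriv_bound:
  assumes sol: "log_sol k f \<beta> T y y'" and cont: "isCont f \<beta>" and k: "k > 0"
  shows "\<exists>C X. \<forall>x\<le>X. \<bar>y' x\<bar> \<le> C * exp (k * x)"
proof -
  note lim = log_sol_tendsto[OF sol]
  define M where "M = \<bar>f \<beta>\<bar> + 1"
  have "((\<lambda>x. \<bar>f (y x)\<bar>) \<longlongrightarrow> \<bar>f \<beta>\<bar>) at_bot"
    by (intro tendsto_intros isCont_tendsto_compose[OF cont lim])
  then have "\<forall>\<^sub>F x in at_bot. \<bar>f (y x)\<bar> < M"
    by (rule order_tendstoD) (simp add: M_def)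
  with eventually_less_exp_minus[of T] have "\<forall>\<^sub>F x in at_bot. T < exp (- x) \<and> \<bar>f (y x)\<bar> < M"
    by eventually_elim simp
  then obtain X where X: "\<And>x. x \<le> X \<Longrightarrow> T < exp (- x)" "\<And>x. x \<le> X \<Longrightarrow> \<bar>f (y x)\<bar> < M"
    by (auto simp: eventually_at_bot_linorder)
  \<comment> \<open>The divisor makes \<open>G\<close> a primitive of M exp ((1 + k) x), the bound
    for the derivative of \<open>P\<close>.\<close>
  define C where "C = M / (1 + k)"
  define P where "P x = exp x * y' x" for x
  define G where "G x = C * exp ((1 + k) * x)" for x
  have dP: "(P has_real_derivative (- exp ((1 + k) * x) * f (y x))) (at x)" if "x \<le> X" for x
    unfolding P_def by (rule log_sol_momentum_deriv[OF sol X(1)[OF that]])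
  have dG: "(G has_real_derivative (M * exp ((1 + k) * x))) (at x)" for x
  proof -
    have "(G has_real_derivative (C * (exp ((1 + k) * x) * (1 + k)))) (at x)"
      unfolding G_def by (auto intro!: derivative_eq_intros)
    moreover have "C * (1 + k) = M" unfolding C_def using k by simp
    ultimately show ?thesis by (metis mult.assoc mult.commute)
  qed
  have C: "C \<ge> 0" unfolding C_def M_def using k by simp
  have PG: "\<bar>P x - P z\<bar> \<le> G x" if "z \<le> x" "x \<le> X" for x z
  proof -
    have "P x - G x \<le> P z - G z"
    proof (rule DERIV_nonpos_imp_nonincreasing[OF that(1)])
      fix s assume "z \<le> s" "s \<le> x"
      then have s: "s \<le> X" using that by simp
      show "\<exists>d. ((\<lambda>a. P a - G a) has_real_derivative d) (at s) \<and> d \<le> 0"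
        using X(2)[OF s]
        by (intro exI[of _ "- exp ((1 + k) * s) * f (y s) - M * exp ((1 + k) * s)"] conjI
            DERIV_diff dP dG s) (use mult_nonneg_nonneg[of "exp ((1 + k) * s)" "M + f (y s)"] in \<open>auto simp: algebra_simps abs_less_iff\<close>)
    qed
    moreover have "P z + G z \<le> P x + G x"
    proof (rule DERIV_nonneg_imp_nondecreasing[OF that(1)])
      fix s assume "z \<le> s" "s \<le> x"
      then have s: "s \<le> X" using that by simp
      show "\<exists>d. ((\<lambda>a. P a + G a) has_real_derivative d) (at s) \<and> d \<ge> 0"
        using X(2)[OF s]
        by (intro exI[of _ "- exp ((1 + k) * s) * f (y s) + M * exp ((1 + k) * s)"] conjI
            DERIV_add dP dG s) (use mult_nonneg_nonneg[of "exp ((1 + k) * s)" "M - f (y s)"] in \<open>auto simp: algebra_simps abs_less_iff\<close>)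
    qed
    moreover have "G z \<ge> 0" unfolding G_def using C by simp
    ultimately show ?thesis by linarith
  qed
  have "\<bar>P x\<bar> \<le> G x" if "x \<le> X" for x
  proof (rule field_le_epsilon)
    fix e :: real assume e: "e > 0"
    have "((\<lambda>z. y (1 + z)) \<longlongrightarrow> \<beta>) at_bot"
    proof (rule filterlim_compose[OF lim])
      have "\<exists>N. \<forall>n\<le>N. 1 + n \<le> Z" for Z :: real by (rule exI[of _ "Z - 1"]) auto
      then show "filterlim (\<lambda>z::real. 1 + z) at_bot at_bot"
        by (simp add: filterlim_at_bot eventually_at_bot_linorder)
    qed
    then have "((\<lambda>z. y (1 + z) - y z) \<longlongrightarrow> \<beta> - \<beta>) at_bot" by (intro tendsto_intros lim)
    then have "\<forall>\<^sub>F z in at_bot. dist (y (1 + z) - y z) 0 < e" using e by (intro tendstoD) auto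
    moreover have "\<forall>\<^sub>F z in at_bot. z \<le> min (x - 1) (- 1)" by (rule eventually_le_at_bot)
    ultimately have "\<forall>\<^sub>F z in at_bot. \<bar>y (1 + z) - y z\<bar> < e \<and> z \<le> min (x - 1) (- 1)"
      by eventually_elim (simp add: dist_real_def)
    \<comment> \<open>The mean value point s lies in (z, z + 1), so z \<le> - 1 makes
      \<open>exp s\<close> at most 1.\<close>
    then obtain z where z: "\<bar>y (1 + z) - y z\<bar> < e" "z \<le> x - 1" "z \<le> - 1"
      using eventually_happens'[OF trivial_limit_at_bot_linorder] by fastforce
    have "\<exists>s>z. s < z + 1 \<and> y (z + 1) - y z = (z + 1 - z) * y' s"
    proof (rule MVT2)
      show "DERIV y s :> y' s" if "z \<le> s" "s \<le> z + 1" for s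
        by (rule log_sol_deriv[OF sol X(1)]) (use that z \<open>x \<le> X\<close> in auto)
    qed auto
    then obtain s where s: "z < s" "s < z + 1" "y (z + 1) - y z = y' s" by auto
    have "exp s * \<bar>y' s\<bar> \<le> 1 * e"
      using s z by (intro mult_mono) (auto simp: add.commute)
    then have "\<bar>P s\<bar> \<le> e" by (simp add: P_def abs_mult)
    moreover have "\<bar>P x - P s\<bar> \<le> G x" by (rule PG) (use s z that in auto)
    ultimately show "\<bar>P x\<bar> \<le> G x + e" by linarith
  qed
  then have "\<bar>y' x\<bar> \<le> C * exp (k * x)" if "x \<le> X" for x
    using that unfolding P_def G_def by (force simp: abs_mult algebra_simps exp_add)
  then show ?thesis by blast
qed

lemma log_sol_deriv_tendsto_0:
  assumes "log_sol k f \<beta> T y y'" "isCont f \<beta>" "k > 0"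
  shows "(y' \<longlongrightarrow> 0) at_bot"
proof -
  obtain C X where CX: "\<And>x. x \<le> X \<Longrightarrow> \<bar>y' x\<bar> \<le> C * exp (k * x)"
    using log_sol_deriv_bound[OF assms] by blast
  show ?thesis
  proof (rule Lim_null_comparison)
    show "\<forall>\<^sub>F x in at_bot. norm (y' x) \<le> C * exp (k * x)"
      using eventually_le_at_bot[of X] by eventually_elim (simp add: CX)
    show "((\<lambda>x. C * exp (k * x)) \<longlongrightarrow> 0) at_bot"
      using tendsto_mult_left[OF exp_mult_tendsto_0_at_bot[OF assms(3)], of C] by simp
  qed
qed

lemma log_sol_momentum_tendsto_0:
  assumes "log_sol k f \<beta> T y y'" "isCont f \<beta>" "k > 0"
  shows "((\<lambda>x. exp x * y' x) \<longlongrightarrow> 0) at_bot"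
  using tendsto_mult[OF exp_at_bot log_sol_deriv_tendsto_0[OF assms]] by simp

lemma log_sol_bounded:
  assumes sol: "log_sol k f \<beta> T y y'" and x: "T < exp (- x)"
  obtains M where "\<And>z. z \<le> x \<Longrightarrow> \<bar>y z\<bar> \<le> M"
proof -
  have "\<forall>\<^sub>F z in at_bot. dist (y z) \<beta> < 1"
    by (rule tendstoD[OF log_sol_tendsto[OF sol]]) simp
  then obtain X where X: "\<And>z. z \<le> X \<Longrightarrow> \<bar>y z - \<beta>\<bar> < 1"
    by (auto simp: eventually_at_bot_linorder dist_real_def)
  have "continuous_on {X..x} y"
    by (rule DERIV_continuous_on[where D = y'])
       (auto intro!: DERIV_subset[OF log_sol_deriv[OF sol]] less_exp_minus_downward[OF x])
  then have "compact (y ` {X..x})" by (intro compact_continuous_image) auto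
  from compact_imp_bounded[OF this] obtain B where "\<forall>z\<in>{X..x}. \<bar>y z\<bar> \<le> B"
    unfolding bounded_iff by auto
  then have B: "\<And>z. z \<in> {X..x} \<Longrightarrow> \<bar>y z\<bar> \<le> B" by blast
  show ?thesis
  proof (rule that)
    fix z assume "z \<le> x"
    then show "\<bar>y z\<bar> \<le> max B (\<bar>\<beta>\<bar> + 1)"
      using X[of z] B[of z] by (cases "z \<le> X") auto
  qed
qed

section \<open>Uniqueness in the logarithmic coordinate\<close>

definition loc_lip :: "(real \<Rightarrow> real) \<Rightarrow> bool" where
  "loc_lip f \<longleftrightarrow> (\<forall>M. \<exists>L. L-lipschitz_on {- M..M} f)"

lemma loc_lip_isCont:
  assumes "loc_lip f" shows "isCont f x"
proof -
  obtain L where "L-lipschitz_on {- (\<bar>x\<bar> + 1)..\<bar>x\<bar> + 1} f"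
    using assms unfolding loc_lip_def by blast
  then have "continuous_on {- (\<bar>x\<bar> + 1)..\<bar>x\<bar> + 1} f" by (rule lipschitz_on_continuous_on)
  then show ?thesis by (rule continuous_on_interior) auto
qed

text \<open>Completing the square: the damping term absorbs the mixed term. Here e will be the
  weight \<open>exp (k * s)\<close>.\<close>

lemma young_inequality_weighted:
  fixes a b e p q :: real
  assumes "a > 0" "e > 0"
  shows "2 * b * (p * q) - a / e * p\<^sup>2 \<le> b\<^sup>2 / a * e * q\<^sup>2"
proof -
  have "0 \<le> (a * p - b * e * q)\<^sup>2 / (a * e)" using assms by simp
  also have "\<dots> = a / e * p\<^sup>2 + b\<^sup>2 / a * e * q\<^sup>2 - 2 * b * (p * q)"
    using assms by (simp add: field_simps power2_eq_square)
  finally show ?thesis by simp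
qed

text \<open>
  For the difference \<open>z\<close> of two solutions, \<open>z\<^sup>2 + exp (- k x) z'\<^sup>2\<close> satisfies a Gronwall inequality
  with the weight \<open>exp (k x)\<close>, which is integrable at \<open>- \<infinity>\<close>.
\<close>

lemma log_sol_unique:
  assumes s1: "log_sol k f \<beta> T y1 y1'" and s2: "log_sol k f \<beta> T y2 y2'" and f: "loc_lip f"
    and k: "k > 0" and x: "T < exp (- x)"
  shows "y1 x = y2 x"
proof -
  note cf = loc_lip_isCont[OF f]
  obtain M1 where M1: "\<And>z. z \<le> x \<Longrightarrow> \<bar>y1 z\<bar> \<le> M1" using log_sol_bounded[OF s1 x] by blast
  obtain M2 where M2: "\<And>z. z \<le> x \<Longrightarrow> \<bar>y2 z\<bar> \<le> M2" using log_sol_bounded[OF s2 x] by blast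
  obtain L where L: "L-lipschitz_on {- max M1 M2..max M1 M2} f"
    using f unfolding loc_lip_def by blast
  have L0: "L \<ge> 0" using lipschitz_on_nonneg[OF L] .
  have Lip: "\<bar>f (y1 z) - f (y2 z)\<bar> \<le> L * \<bar>y1 z - y2 z\<bar>" if "z \<le> x" for z
    using lipschitz_onD[OF L, of "y1 z" "y2 z"] M1[OF that] M2[OF that]
    by (simp add: dist_real_def abs_le_iff) linarith
  define z where "z x = y1 x - y2 x" for x
  define z' where "z' x = y1' x - y2' x" for x
  define D where "D x = f (y1 x) - f (y2 x)" for x
  have dz: "(z has_real_derivative z' s) (at s)" if "s \<le> x" for s
    unfolding z_def z'_def
    by (intro DERIV_diff log_sol_deriv[OF s1] log_sol_deriv[OF s2] less_exp_minus_downward[OF x that])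
  have dz': "(z' has_real_derivative (- z' s - exp (k * s) * D s)) (at s)" if "s \<le> x" for s
    unfolding z'_def D_def
    by (rule derivative_eq_intros log_sol_deriv2[OF s1] log_sol_deriv2[OF s2] less_exp_minus_downward[OF x that])+
       (simp add: algebra_simps)
  \<comment> \<open>\<open>k + 2\<close> is the coefficient of the damping term in
    \<open>Q'\<close>, and \<open>2 * (1 + L)\<close> bounds that of the mixed term; Young's
    inequality turns them into this constant.\<close>
  define C where "C = (1 + L)\<^sup>2 / (k + 2)"
  \<comment> \<open>Integrating factor for Q' \<le> C exp (k x) Q; it tends to 1 at -
    \<infinity>.\<close>
  define W where "W x = exp (- (C / k) * exp (k * x))" for x :: real
  define Q where "Q x = (z x)\<^sup>2 + exp (- (k * x)) * (z' x)\<^sup>2" for x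
  define Q' where "Q' x = 2 * z x * z' x - (k + 2) * exp (- (k * x)) * (z' x)\<^sup>2 - 2 * z' x * D x" for x
  have dQ: "(Q has_real_derivative Q' s) (at s)" if "s \<le> x" for s
  proof -
    have *: "exp (- (k * s)) * exp (k * s) = 1" by (simp flip: exp_add)
    show ?thesis
      unfolding Q_def Q'_def
      by (rule derivative_eq_intros dz dz' that refl)+
         (use * in \<open>simp add: algebra_simps power2_eq_square\<close>)
  qed
  have dW: "(W has_real_derivative (- C * exp (k * s) * W s)) (at s)" for s
    unfolding W_def using k by (auto intro!: derivative_eq_intros simp: field_simps)
  have Q'_le: "Q' s \<le> C * exp (k * s) * Q s" if "s \<le> x" for s
  proof -
    define e where "e = exp (k * s)"
    have e: "e > 0" "exp (- (k * s)) = 1 / e" unfolding e_def by (auto simp: exp_minus field_simps)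
    have "\<bar>D s\<bar> \<le> L * \<bar>z s\<bar>" unfolding D_def z_def by (rule Lip[OF that])
    then have "\<bar>z' s\<bar> * \<bar>D s\<bar> \<le> \<bar>z' s\<bar> * (L * \<bar>z s\<bar>)" by (intro mult_left_mono) auto
    moreover have "- (z' s * D s) \<le> \<bar>z' s\<bar> * \<bar>D s\<bar>" by (metis abs_ge_minus_self abs_mult)
    moreover have "z s * z' s \<le> \<bar>z' s\<bar> * \<bar>z s\<bar>" by (metis abs_ge_self abs_mult mult.commute)
    moreover have "Q' s = 2 * (z s * z' s) - (k + 2) / e * (z' s)\<^sup>2 - 2 * (z' s * D s)"
      unfolding Q'_def e by simp
    ultimately have "Q' s \<le> 2 * (1 + L) * (\<bar>z' s\<bar> * \<bar>z s\<bar>) - (k + 2) / e * (z' s)\<^sup>2"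
      by (simp add: algebra_simps)
    also have "\<dots> \<le> C * e * (z s)\<^sup>2"
      using young_inequality_weighted[of "k + 2" e "1 + L" "\<bar>z' s\<bar>" "\<bar>z s\<bar>"] k e(1)
      by (simp add: C_def)
    also have "\<dots> \<le> C * e * Q s" unfolding Q_def using k e(1)
      by (intro mult_left_mono) (auto simp: C_def)
    finally show ?thesis unfolding e_def .
  qed
  have "Q x * W x \<le> 0"
  proof (rule deriv_nonpos_le_limit_at_bot[where P = "\<lambda>x. Q x * W x"
        and P' = "\<lambda>s. Q' s * W s + (- C * exp (k * s) * W s) * Q s"])
    show "((\<lambda>x. Q x * W x) has_real_derivative (Q' s * W s + (- C * exp (k * s) * W s) * Q s)) (at s)"
      if "s \<le> x" for s by (rule DERIV_mult[OF dQ[OF that] dW])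
    show "Q' s * W s + (- C * exp (k * s) * W s) * Q s \<le> 0" if "s \<le> x" for s
      using mult_right_mono[OF Q'_le[OF that], of "W s"] by (simp add: W_def algebra_simps)
    have W1: "(W \<longlongrightarrow> exp (- (C / k) * 0)) at_bot"
      unfolding W_def by (intro tendsto_intros exp_mult_tendsto_0_at_bot k)
    obtain C1 X1 where 1: "\<And>x. x \<le> X1 \<Longrightarrow> \<bar>y1' x\<bar> \<le> C1 * exp (k * x)"
      using log_sol_deriv_bound[OF s1 cf k] by blast
    obtain C2 X2 where 2: "\<And>x. x \<le> X2 \<Longrightarrow> \<bar>y2' x\<bar> \<le> C2 * exp (k * x)"
      using log_sol_deriv_bound[OF s2 cf k] by blast
    have b: "\<bar>z' s\<bar> \<le> (C1 + C2) * exp (k * s)" if "s \<le> min X1 X2" for s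
      using 1[of s] 2[of s] that by (simp add: z'_def algebra_simps)
    \<comment> \<open>The rate in the derivative bound matters here: squared, it beats the growth of
      \<open>exp (- (k * s))\<close> towards the centre.\<close>
    have b2: "exp (- (k * s)) * (z' s)\<^sup>2 \<le> (C1 + C2)\<^sup>2 * exp (k * s)" if "s \<le> min X1 X2" for s
    proof -
      have "(z' s)\<^sup>2 \<le> ((C1 + C2) * exp (k * s))\<^sup>2"
        using power_mono[OF b[OF that], of 2] by simp
      then have "exp (- (k * s)) * (z' s)\<^sup>2 \<le> exp (- (k * s)) * ((C1 + C2) * exp (k * s))\<^sup>2"
        by (intro mult_left_mono) auto
      also have "\<dots> = (C1 + C2)\<^sup>2 * exp (k * s)" 
        by (simp add: power2_eq_square exp_minus field_simps)
      finally show ?thesis .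
    qed
    have "((\<lambda>s. exp (- (k * s)) * (z' s)\<^sup>2) \<longlongrightarrow> 0) at_bot"
    proof (rule Lim_null_comparison)
      show "\<forall>\<^sub>F s in at_bot. norm (exp (- (k * s)) * (z' s)\<^sup>2) \<le> (C1 + C2)\<^sup>2 * exp (k * s)"
        using eventually_le_at_bot[of "min X1 X2"] by eventually_elim (use b2 in \<open>simp del: min.bounded_iff\<close>)
      show "((\<lambda>s. (C1 + C2)\<^sup>2 * exp (k * s)) \<longlongrightarrow> 0) at_bot"
        using tendsto_mult_left[OF exp_mult_tendsto_0_at_bot[OF k]] by force
    qed
    moreover have "(z \<longlongrightarrow> \<beta> - \<beta>) at_bot"
      unfolding z_def by (intro tendsto_diff log_sol_tendsto[OF s1] log_sol_tendsto[OF s2])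
    ultimately have "(Q \<longlongrightarrow> 0\<^sup>2 + 0) at_bot"
      unfolding Q_def by (intro tendsto_add tendsto_power) auto
    from tendsto_mult[OF this W1] show "((\<lambda>x. Q x * W x) \<longlongrightarrow> 0) at_bot" by simp
  qed
  then have "Q x \<le> 0" by (simp add: W_def mult_le_0_iff)
  moreover have "exp (- (k * x)) * (z' x)\<^sup>2 \<ge> 0" by simp
  ultimately have "(z x)\<^sup>2 \<le> 0" unfolding Q_def by linarith
  then show ?thesis by (simp add: z_def)
qed

section \<open>Existence\<close>

text \<open>
  With \<open>s = exp (k x)\<close> and \<open>\<kappa> = 1 / k\<close> the problem becomes the Volterra equation
  \<open>Y = \<beta> - \<kappa> volterra \<kappa> (F \<circ> Y)\<close> on \<open>[0, \<infinity>)\<close>.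
\<close>

definition volterra :: "real \<Rightarrow> (real \<Rightarrow> real) \<Rightarrow> real \<Rightarrow> real" where
  "volterra \<kappa> h s = integral {0..s} (\<lambda>\<xi>. (1 - (\<xi> / s) powr \<kappa>) * h \<xi>)"

lemma continuous_on_volterra_kernel:
  fixes \<kappa> s :: real and h :: "real \<Rightarrow> real"
  assumes "\<kappa> > 0" "s \<ge> 0" "continuous_on UNIV h"
  shows "continuous_on {0..s} (\<lambda>\<xi>. (1 - (\<xi> / s) powr \<kappa>) * h \<xi>)"
proof -
  have "continuous_on {0..s} (\<lambda>\<xi>. (inverse s * \<xi>) powr \<kappa>)"
    using assms by (intro continuous_on_powr' continuous_intros) auto
  then show ?thesis
    by (auto intro!: continuous_intros continuous_on_subset[OF assms(3)] simp: divide_inverse mult.commute)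
qed

lemma volterra_kernel_bounds:
  fixes \<kappa> s \<xi> :: real
  assumes "\<kappa> > 0" "\<xi> \<in> {0..s}"
  shows "0 \<le> 1 - (\<xi> / s) powr \<kappa>" "1 - (\<xi> / s) powr \<kappa> \<le> 1"
proof -
  have "\<xi> / s \<le> 1" using assms by (auto simp: divide_le_eq_1)
  then show "0 \<le> 1 - (\<xi> / s) powr \<kappa>" using assms by (simp add: powr_le1)
qed simp

lemma volterra_abs_le:
  assumes \<kappa>: "\<kappa> > 0" and s: "s \<ge> 0" and h: "continuous_on UNIV h" 
    and g: "continuous_on {0..s} g" and hg: "\<And>\<xi>. \<xi> \<in> {0..s} \<Longrightarrow> \<bar>h \<xi>\<bar> \<le> g \<xi>"
  shows "\<bar>volterra \<kappa> h s\<bar> \<le> integral {0..s} g"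
proof -
  have "norm ((1 - (\<xi> / s) powr \<kappa>) * h \<xi>) \<le> g \<xi>" if "\<xi> \<in> {0..s}" for \<xi>
    using mult_mono[OF volterra_kernel_bounds(2)[OF \<kappa> that] hg[OF that]]
      volterra_kernel_bounds(1)[OF \<kappa> that] by (simp add: abs_mult)
  then have "norm (integral {0..s} (\<lambda>\<xi>. (1 - (\<xi> / s) powr \<kappa>) * h \<xi>)) \<le> integral {0..s} g"
    by (intro integral_norm_bound_integral integrable_continuous_real
        continuous_on_volterra_kernel \<kappa> s h g)
  then show ?thesis unfolding volterra_def by simp
qed

lemma volterra_abs_le_linear:
  assumes "\<kappa> > 0" "s \<ge> 0" "continuous_on UNIV h" "\<And>\<xi>. \<bar>h \<xi>\<bar> \<le> B"
  shows "\<bar>volterra \<kappa> h s\<bar> \<le> B * s"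
  using volterra_abs_le[OF assms(1-3), of "\<lambda>_. B"] assms by (simp add: mult.commute)

lemma volterra_diff:
  assumes \<kappa>: "\<kappa> > 0" and s: "s \<ge> 0" and h: "continuous_on UNIV h" and g: "continuous_on UNIV g"
  shows "volterra \<kappa> h s - volterra \<kappa> g s = volterra \<kappa> (\<lambda>\<xi>. h \<xi> - g \<xi>) s"
proof -
  have "volterra \<kappa> h s - volterra \<kappa> g s =
     integral {0..s} (\<lambda>\<xi>. (1 - (\<xi> / s) powr \<kappa>) * h \<xi> - (1 - (\<xi> / s) powr \<kappa>) * g \<xi>)"
    unfolding volterra_def
    by (rule integral_diff[symmetric])
       (intro integrable_continuous_real continuous_on_volterra_kernel assms)+
  then show ?thesis unfolding volterra_def by (simp add: right_diff_distrib)
qed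

lemma integral_from_0_has_real_derivative:
  assumes "continuous_on {0..} g" "s > 0"
  shows "((\<lambda>s. integral {0..s} g) has_real_derivative g s) (at s)"
proof -
  have "((\<lambda>s. integral {0..s} g) has_real_derivative g s) (at s within {0..s + 1})"
    by (rule integral_has_real_derivative) (use assms in \<open>auto intro: continuous_on_subset\<close>)
  then show ?thesis using assms(2) by (simp add: at_within_Icc_at)
qed

text \<open>The kernel vanishes on the diagonal, so no boundary term survives. Writing the operator
  as the integral of h minus \<open>t powr (- \<kappa>)\<close> times a moment of h makes the
  product rule applicable.\<close>

lemma volterra_has_real_derivative:
  assumes \<kappa>: "\<kappa> > 0" and s: "s > 0" and h: "continuous_on UNIV h"
  shows "(volterra \<kappa> h has_real_derivative
     \<kappa> * s powr (- \<kappa> - 1) * integral {0..s} (\<lambda>\<xi>. \<xi> powr \<kappa> * h \<xi>)) (at s)"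
proof -
  define g where "g \<xi> = \<xi> powr \<kappa> * h \<xi>" for \<xi>
  have h0: "continuous_on {0..} h" using h continuous_on_subset by blast
  have g: "continuous_on {0..} g"
    unfolding g_def using \<kappa> by (auto intro!: continuous_intros continuous_on_powr' h0)
  have eq: "volterra \<kappa> h t = integral {0..t} h - t powr (- \<kappa>) * integral {0..t} g" if "t > 0" for t
  proof -
    have "volterra \<kappa> h t = integral {0..t} (\<lambda>\<xi>. h \<xi> - t powr (- \<kappa>) * g \<xi>)"
      unfolding volterra_def g_def
      by (rule integral_cong) (use that in \<open>auto simp: powr_divide powr_minus field_simps\<close>)
    also have "\<dots> = integral {0..t} h - integral {0..t} (\<lambda>\<xi>. t powr (- \<kappa>) * g \<xi>)"
      by (intro integral_diff integrable_continuous_real)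
         (auto intro!: continuous_intros continuous_on_subset[OF g] continuous_on_subset[OF h0])
    finally show ?thesis by simp
  qed
  have "((\<lambda>t. integral {0..t} h - t powr (- \<kappa>) * integral {0..t} g) has_real_derivative
      (h s - (- \<kappa> * s powr (- \<kappa> - 1) * integral {0..s} g + g s * s powr (- \<kappa>)))) (at s)"
    by (intro DERIV_diff DERIV_mult integral_from_0_has_real_derivative h0 g s
        has_real_derivative_powr)
  moreover have "g s * s powr (- \<kappa>) = h s"
    unfolding g_def using s by (simp add: powr_minus field_simps)
  ultimately have "((\<lambda>t. integral {0..t} h - t powr (- \<kappa>) * integral {0..t} g) has_real_derivative
      (\<kappa> * s powr (- \<kappa> - 1) * integral {0..s} g)) (at s)" by simp
  then have "(volterra \<kappa> h has_real_derivative (\<kappa> * s powr (- \<kappa> - 1) * integral {0..s} g)) (at s)"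
    by (rule has_field_derivative_transform_within_open[where S = "{0<..}"]) (use s eq in auto)
  then show ?thesis unfolding g_def .
qed

lemma continuous_on_volterra:
  assumes \<kappa>: "\<kappa> > 0" and h: "continuous_on UNIV h" and B: "\<And>\<xi>. \<bar>h \<xi>\<bar> \<le> B"
  shows "continuous_on {0..} (volterra \<kappa> h)"
proof (clarsimp simp: continuous_on_eq_continuous_within)
  fix s :: real assume "s \<ge> 0"
  show "continuous (at s within {0..}) (volterra \<kappa> h)"
  proof (cases "s = 0")
    case True
    have "(volterra \<kappa> h \<longlongrightarrow> 0) (at 0 within {0..})"
    proof (rule Lim_null_comparison)
      show "\<forall>\<^sub>F s in at 0 within {0..}. norm (volterra \<kappa> h s) \<le> B * s"
        by (auto simp: eventually_at_filter intro!: always_eventually volterra_abs_le_linear[OF \<kappa> _ h B])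
      have "((\<lambda>s. B * s) \<longlongrightarrow> B * 0) (at 0 within {0..})" by (intro tendsto_intros)
      then show "((\<lambda>s. B * s) \<longlongrightarrow> 0) (at 0 within {0..})" by simp
    qed
    moreover have "volterra \<kappa> h 0 = 0" unfolding volterra_def by simp
    ultimately show ?thesis using True by (simp add: continuous_within)
  next
    case False
    with \<open>s \<ge> 0\<close> have "s > 0" by simp
    then have "isCont (volterra \<kappa> h) s"
      by (rule DERIV_isCont[OF volterra_has_real_derivative[OF \<kappa> _ h]])
    then show ?thesis by (rule continuous_at_imp_continuous_at_within)
  qed
qed

lemma integral_exp_mult:
  fixes c M s :: real
  assumes "c > 0" "s \<ge> 0"
  shows "integral {0..s} (\<lambda>\<xi>. M * exp (c * \<xi>)) = M / c * (exp (c * s) - 1)"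
proof (rule integral_unique)
  have "((\<lambda>\<xi>. M * exp (c * \<xi>)) has_integral (M / c * exp (c * s) - M / c * exp (c * 0))) {0..s}"
  proof (rule fundamental_theorem_of_calculus)
    fix \<xi> :: real
    have "((\<lambda>\<xi>. M / c * exp (c * \<xi>)) has_real_derivative (M * exp (c * \<xi>))) (at \<xi> within {0..s})"
      using assms by (auto intro!: derivative_eq_intros)
    then show "((\<lambda>\<xi>. M / c * exp (c * \<xi>)) has_vector_derivative (M * exp (c * \<xi>))) (at \<xi> within {0..s})"
      by (simp add: has_real_derivative_iff_has_vector_derivative)
  qed (use assms in simp)
  then show "((\<lambda>\<xi>. M * exp (c * \<xi>)) has_integral (M / c * (exp (c * s) - 1))) {0..s}"
    by (simp only: right_diff_distrib mult_zero_right exp_zero mult_1_right)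
qed

text \<open>
  Banach's theorem for \<open>u s = exp (- c s) Y s\<close>: the exponential weight makes the map a contraction on the
  whole half-line.
\<close>

lemma volterra_equation_solution:
  assumes \<kappa>: "\<kappa> > 0" and L: "L-lipschitz_on UNIV F" and B: "\<And>v. \<bar>F v\<bar> \<le> B"
  obtains Y where "continuous_on UNIV Y" "\<And>s. s \<ge> 0 \<Longrightarrow> Y s = \<beta> - \<kappa> * volterra \<kappa> (\<lambda>\<xi>. F (Y \<xi>)) s"
proof -
  have L0: "L \<ge> 0" using L lipschitz_on_nonneg by blast
  have B0: "B \<ge> 0" using B[of 0] by linarith
  \<comment> \<open>Large enough that the contraction factor \<kappa> L / c is at most 1 / 2; the
    added 1 keeps c positive if L = 0.\<close>
  define c where "c = 2 * \<kappa> * L + 1"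
  have c: "c > 0" unfolding c_def using \<kappa> L0 by (simp add: add_nonneg_pos)
  have F: "continuous_on S F" for S using L lipschitz_on_continuous_on continuous_on_subset by blast
  define G where "G u \<xi> = F (exp (c * \<xi>) * apply_bcontfun u \<xi>)" for u \<xi>
  have G: "continuous_on UNIV (G u)" for u
    unfolding G_def by (intro continuous_intros continuous_on_compose2[OF F[of UNIV]]) auto
  have GB: "\<bar>G u \<xi>\<bar> \<le> B" for u \<xi> unfolding G_def by (rule B)
  define \<phi> where "\<phi> u s = exp (- c * s) * (\<beta> - \<kappa> * volterra \<kappa> (G u) s)" for u s
  \<comment> \<open>Bounded continuous functions live on the whole line here, so the half-line map
    is extended to the left by its value at 0.\<close>
  have bc: "(\<lambda>\<sigma>. \<phi> u (max 0 \<sigma>)) \<in> bcontfun" for u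
  proof (rule bcontfun_normI)
    have "continuous_on {0..} (\<phi> u)"
      unfolding \<phi>_def by (intro continuous_intros continuous_on_volterra[OF \<kappa> G GB])
    then show "continuous_on UNIV (\<lambda>\<sigma>. \<phi> u (max 0 \<sigma>))"
      by (rule continuous_on_compose2) (auto intro!: continuous_intros)
    fix \<sigma> :: real
    define s where "s = max 0 \<sigma>"
    have s: "s \<ge> 0" unfolding s_def by simp
    \<comment> \<open>The weight beats the linear growth of the Volterra operator, because s exp (-
      c s) \<le> 1 / c.\<close>
    have "c * s \<le> exp (c * s)" using exp_ge_add_one_self[of "c * s"] by linarith
    then have "exp (- c * s) * s \<le> 1 / c" using c by (simp add: exp_minus field_simps)
    then have 1: "(exp (- c * s) * s) * (\<kappa> * B) \<le> (1 / c) * (\<kappa> * B)"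
      using \<kappa> B0 by (intro mult_right_mono) auto
    have 2: "exp (- c * s) * \<bar>\<beta>\<bar> \<le> 1 * \<bar>\<beta>\<bar>"
      using c s by (intro mult_right_mono) auto
    have "\<bar>\<beta> - \<kappa> * volterra \<kappa> (G u) s\<bar> \<le> \<bar>\<beta>\<bar> + \<kappa> * \<bar>volterra \<kappa> (G u) s\<bar>"
      using abs_triangle_ineq4[of \<beta> "\<kappa> * volterra \<kappa> (G u) s"] \<kappa> by (simp add: abs_mult)
    also have "\<dots> \<le> \<bar>\<beta>\<bar> + \<kappa> * (B * s)"
      using volterra_abs_le_linear[OF \<kappa> s G GB] \<kappa> by simp
    finally have "\<bar>\<phi> u s\<bar> \<le> exp (- c * s) * (\<bar>\<beta>\<bar> + \<kappa> * (B * s))"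
      unfolding \<phi>_def abs_mult by (simp add: mult_left_mono)
    also have "\<dots> = exp (- c * s) * \<bar>\<beta>\<bar> + (exp (- c * s) * s) * (\<kappa> * B)" by (simp add: algebra_simps)
    finally show "norm (\<phi> u (max 0 \<sigma>)) \<le> \<bar>\<beta>\<bar> + (1 / c) * (\<kappa> * B)"
      using 1 2 unfolding s_def by simp
  qed
  define \<Phi> where "\<Phi> u = Bcontfun (\<lambda>\<sigma>. \<phi> u (max 0 \<sigma>))" for u
  have \<Phi>: "apply_bcontfun (\<Phi> u) \<sigma> = \<phi> u (max 0 \<sigma>)" for u \<sigma>
    unfolding \<Phi>_def by (simp add: Bcontfun_inverse[OF bc])
  have "dist (\<Phi> u) (\<Phi> v) \<le> 1 / 2 * dist u v" for u v
  proof (rule dist_bound)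
    fix \<sigma> :: real
    define s where "s = max 0 \<sigma>"
    have s: "s \<ge> 0" unfolding s_def by simp
    define d where "d = dist u v"
    have "\<bar>G u \<xi> - G v \<xi>\<bar> \<le> L * d * exp (c * \<xi>)" for \<xi>
    proof -
      have "\<bar>G u \<xi> - G v \<xi>\<bar> \<le> L * dist (exp (c * \<xi>) * apply_bcontfun u \<xi>) (exp (c * \<xi>) * apply_bcontfun v \<xi>)"
        unfolding G_def using lipschitz_onD[OF L] by (simp add: dist_real_def)
      also have "\<dots> = L * (exp (c * \<xi>) * dist (apply_bcontfun u \<xi>) (apply_bcontfun v \<xi>))"
        by (simp add: dist_real_def abs_mult flip: right_diff_distrib)
      also have "\<dots> \<le> L * (exp (c * \<xi>) * d)"
        unfolding d_def by (intro mult_left_mono dist_bounded L0) auto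
      finally show ?thesis by (simp add: mult_ac)
    qed
    then have "\<bar>volterra \<kappa> (\<lambda>\<xi>. G u \<xi> - G v \<xi>) s\<bar> \<le> integral {0..s} (\<lambda>\<xi>. L * d * exp (c * \<xi>))"
      by (intro volterra_abs_le \<kappa> s continuous_intros G)
    also have "\<dots> \<le> L * d / c * exp (c * s)"
      unfolding integral_exp_mult[OF c s] using L0 c by (intro mult_left_mono) (auto simp: d_def)
    finally have v: "\<bar>volterra \<kappa> (G u) s - volterra \<kappa> (G v) s\<bar> \<le> L * d / c * exp (c * s)"
      unfolding volterra_diff[OF \<kappa> s G G] .
    have "\<phi> u s - \<phi> v s = - (exp (- c * s) * \<kappa> * (volterra \<kappa> (G u) s - volterra \<kappa> (G v) s))"
      unfolding \<phi>_def by (simp add: algebra_simps)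
    then have "\<bar>\<phi> u s - \<phi> v s\<bar> = exp (- c * s) * \<kappa> * \<bar>volterra \<kappa> (G u) s - volterra \<kappa> (G v) s\<bar>"
      using \<kappa> by (simp add: abs_mult)
    also have "\<dots> \<le> exp (- c * s) * \<kappa> * (L * d / c * exp (c * s))"
      using \<kappa> by (intro mult_left_mono v) auto
    also have "\<dots> = (\<kappa> * L / c) * d" by (simp add: exp_minus field_simps)
    also have "\<dots> \<le> (1 / 2) * d"
      using c by (intro mult_right_mono) (auto simp: c_def d_def field_simps)
    finally show "dist (apply_bcontfun (\<Phi> u) \<sigma>) (apply_bcontfun (\<Phi> v) \<sigma>) \<le> 1 / 2 * dist u v"
      unfolding \<Phi> d_def s_def dist_real_def .
  qed
  then have "\<exists>!u. \<Phi> u = u"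
    by (intro banach_fix_type[of "1 / 2"]) auto
  then obtain u where u: "\<Phi> u = u" by blast
  show ?thesis
  proof (rule that)
    show "continuous_on UNIV (\<lambda>s. exp (c * s) * apply_bcontfun u s)"
      by (intro continuous_intros) auto
    fix s :: real assume s: "s \<ge> 0"
    have "apply_bcontfun u s = \<phi> u s" using \<Phi>[of u s] s u by simp
    then show "exp (c * s) * apply_bcontfun u s =
        \<beta> - \<kappa> * volterra \<kappa> (\<lambda>\<xi>. F (exp (c * \<xi>) * apply_bcontfun u \<xi>)) s"
      unfolding \<phi>_def G_def by (simp add: exp_minus field_simps)
  qed
qed

lemma log_sol_exists:
  assumes k: "k > 0" and L: "L-lipschitz_on UNIV F" and B: "\<And>v. \<bar>F v\<bar> \<le> B"
  shows "\<exists>y y'. log_sol k F \<beta> 0 y y'"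
proof -
  define \<kappa> where "\<kappa> = 1 / k"
  have \<kappa>: "\<kappa> > 0" "k * \<kappa> = 1" unfolding \<kappa>_def using k by auto
  obtain Y where Y: "continuous_on UNIV Y"
    and eq: "\<And>s. s \<ge> 0 \<Longrightarrow> Y s = \<beta> - \<kappa> * volterra \<kappa> (\<lambda>\<xi>. F (Y \<xi>)) s"
    using volterra_equation_solution[OF \<kappa>(1) L B] by blast
  define h where "h \<xi> = F (Y \<xi>)" for \<xi>
  have h: "continuous_on UNIV h"
    unfolding h_def by (rule continuous_on_compose2[OF lipschitz_on_continuous_on[OF L] Y]) simp
  define J where "J s = integral {0..s} (\<lambda>\<xi>. \<xi> powr \<kappa> * h \<xi>)" for s
  have dJ: "(J has_real_derivative (s powr \<kappa> * h s)) (at s)" if "s > 0" for s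
    unfolding J_def using \<kappa> that
    by (intro integral_from_0_has_real_derivative)
       (auto intro!: continuous_intros continuous_on_powr' continuous_on_subset[OF h])
  have dY: "(Y has_real_derivative (- \<kappa> * (\<kappa> * s powr (- \<kappa> - 1) * J s))) (at s)" if "s > 0" for s
  proof (rule has_field_derivative_transform_within_open[where S = "{0<..}"])
    show "((\<lambda>s. \<beta> - \<kappa> * volterra \<kappa> h s) has_real_derivative (- \<kappa> * (\<kappa> * s powr (- \<kappa> - 1) * J s))) (at s)"
      unfolding J_def by (rule derivative_eq_intros volterra_has_real_derivative[OF \<kappa>(1) that h] refl)+ simp
  qed (use that eq in \<open>auto simp: h_def[abs_def]\<close>)
  define y where "y x = Y (exp (k * x))" for x
  \<comment> \<open>Read off from the integrated equation: the momentum \<open>exp x * y' x\<close>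
    is - \<kappa> times the moment \<open>J\<close> at s = exp (k x).\<close>
  define y' where "y' x = - \<kappa> * exp (- x) * J (exp (k * x))" for x
  have pw: "exp (k * x) powr \<kappa> = exp x" for x
    using \<kappa> by (simp add: powr_def mult_ac)
  have "log_sol k F \<beta> 0 y y'"
    unfolding log_sol_def
  proof (intro conjI allI impI)
    have "((\<lambda>x. Y (exp (k * x))) \<longlongrightarrow> Y 0) at_bot"
      using Y by (intro isCont_tendsto_compose[OF _ exp_mult_tendsto_0_at_bot[OF k]])
        (simp add: continuous_on_eq_continuous_at)
    moreover have "Y 0 = \<beta>" using eq[of 0] by (simp add: volterra_def)
    ultimately show "(y \<longlongrightarrow> \<beta>) at_bot" unfolding y_def by simp
    fix x :: real
    have e: "((\<lambda>x. exp (k * x)) has_real_derivative (exp (k * x) * k)) (at x)"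
      by (auto intro!: derivative_eq_intros)
    have "(y has_real_derivative (- \<kappa> * (\<kappa> * exp (k * x) powr (- \<kappa> - 1) * J (exp (k * x))) * (exp (k * x) * k))) (at x)"
      unfolding y_def by (rule DERIV_chain2[OF dY e]) simp
    moreover have "- \<kappa> * (\<kappa> * exp (k * x) powr (- \<kappa> - 1) * J (exp (k * x))) * (exp (k * x) * k) = y' x"
    proof -
      have "exp (k * x) powr (- \<kappa> - 1) = exp (- x) * exp (- (k * x))"
      proof -
        have "(- \<kappa> - 1) * (k * x) = - (k * \<kappa>) * x - k * x" by (simp add: algebra_simps)
        then show ?thesis unfolding \<kappa>(2) by (simp add: powr_def flip: exp_add)
      qed
      then have "- \<kappa> * (\<kappa> * exp (k * x) powr (- \<kappa> - 1) * J (exp (k * x))) * (exp (k * x) * k)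
          = - \<kappa> * exp (- x) * J (exp (k * x)) * (k * \<kappa>) * (exp (- (k * x)) * exp (k * x))"
        by simp
      also have "exp (- (k * x)) * exp (k * x) = 1" by (simp flip: exp_add)
      finally show ?thesis unfolding y'_def \<kappa>(2) by simp
    qed
    ultimately show "(y has_real_derivative y' x) (at x)" by simp
    have "((\<lambda>x. exp (- x)) has_real_derivative (- exp (- x))) (at x)"
      by (auto intro!: derivative_eq_intros)
    from DERIV_cmult[OF DERIV_mult[OF this DERIV_chain2[OF dJ e]], of "- \<kappa>"]
    have "(y' has_real_derivative (- \<kappa> * (exp (- x) * (exp (k * x) powr \<kappa> * h (exp (k * x)) * (exp (k * x) * k))
          + (- exp (- x)) * J (exp (k * x))))) (at x)"
      unfolding y'_def by (simp add: mult_ac add.commute)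
    moreover have "- \<kappa> * (exp (- x) * (exp (k * x) powr \<kappa> * h (exp (k * x)) * (exp (k * x) * k))
          + (- exp (- x)) * J (exp (k * x))) = - y' x - exp (k * x) * F (y x)"
    proof -
      have "- \<kappa> * (exp (- x) * (exp x * h (exp (k * x)) * (exp (k * x) * k)) + (- exp (- x)) * J (exp (k * x)))
         = - (k * \<kappa>) * (exp (- x) * exp x) * exp (k * x) * h (exp (k * x)) - y' x"
        unfolding y'_def by (simp add: algebra_simps)
      also have "exp (- x) * exp x = 1" by (simp flip: exp_add)
      finally show ?thesis unfolding pw \<kappa>(2) y_def h_def by simp
    qed
    ultimately show "(y' has_real_derivative (- y' x - exp (k * x) * F (y x))) (at x)" by simp
  qed
  then show ?thesis by blast
qed

section \<open>Radial solutions\<close>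

lemma V_eq: "V k r = 1 / (r\<^sup>2 * (1 - ln r) powr (2 + k))" if "r > 0"
  using that by (simp add: V_def ln_div)

lemma one_minus_ln_pos: "0 < 1 - ln r" if "0 < r" "r < R" "R \<le> exp 1" for r R :: real
  using that ln_less_cancel_iff[of r "exp 1"] by (simp del: ln_less_cancel_iff)

text \<open>With explicit derivatives at hand, the equation itself shows that the second derivative
  is continuous, as \<open>C2_on\<close> demands.\<close>

lemma radial_solutionI:
  assumes R: "0 < R" "R \<le> exp 1" and v: "continuous_on {0..<R} v" "v 0 = \<beta>"
    and dv: "\<And>r. 0 < r \<Longrightarrow> r < R \<Longrightarrow> (v has_real_derivative dv r) (at r)"
    and ddv: "\<And>r. 0 < r \<Longrightarrow> r < R \<Longrightarrow> (dv has_real_derivative (- (V k r * f (v r)) - dv r / r)) (at r)"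
    and f: "\<And>x. isCont f x"
  shows "radial_solution k f \<beta> R v"
proof -
  define ddv where "ddv r = - (V k r * f (v r)) - dv r / r" for r
  have 1: "deriv v r = dv r" if "0 < r" "r < R" for r
    using dv[OF that] by (rule DERIV_imp_deriv)
  have d2: "(deriv v has_real_derivative ddv r) (at r)" if "0 < r" "r < R" for r
    unfolding ddv_def
    by (rule has_field_derivative_transform_within_open[OF ddv[OF that], where S = "{0<..<R}"])
       (use that 1 in auto)
  then have 2: "deriv (deriv v) r = ddv r" if "0 < r" "r < R" for r
    using that by (blast intro: DERIV_imp_deriv)
  have "continuous_on {0<..<R} ddv"
  proof -
    have "continuous_on {0<..<R} (\<lambda>r. 1 / (r\<^sup>2 * (1 - ln r) powr (2 + k)))"
      using R one_minus_ln_pos[OF _ _ R(2)] by (intro continuous_intros) force+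
    then have "continuous_on {0<..<R} (V k)"
      by (rule continuous_on_cong[THEN iffD1, rotated 2]) (auto simp: V_eq)
    moreover have "continuous_on {0<..<R} v"
      using v(1) by (rule continuous_on_subset) auto
    moreover have "continuous_on {0<..<R} dv"
      by (rule DERIV_continuous_on[where D = ddv]) (auto intro: DERIV_subset[OF ddv] simp: ddv_def)
    moreover have "continuous_on UNIV f"
      using f by (simp add: continuous_on_eq_continuous_at)
    ultimately show ?thesis
      unfolding ddv_def by (intro continuous_intros) (auto intro: continuous_on_compose2)
  qed
  then have "continuous_on {0<..<R} (deriv (deriv v))"
    by (rule continuous_on_cong[THEN iffD1, rotated 2]) (auto simp: 2)
  moreover have "v field_differentiable at r \<and> deriv v field_differentiable at r"
    if "r \<in> {0<..<R}" for r
    using dv[of r] d2[of r] that by (auto simp: field_differentiable_def)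
  ultimately show ?thesis
    unfolding radial_solution_def C2_on_def using R v 1 2
    by (auto simp: ddv_def)
qed

lemma radial_solution_restrict:
  assumes "radial_solution k f \<beta> R v" "0 < S" "S \<le> R"
  shows "radial_solution k f \<beta> S v"
  using assms unfolding radial_solution_def C2_on_def
  by (auto intro: continuous_on_subset)

lemma radial_solution_deriv:
  assumes "radial_solution k f \<beta> R v" "0 < r" "r < R"
  shows "(v has_real_derivative deriv v r) (at r)"
    "(deriv v has_real_derivative (- (V k r * f (v r)) - deriv v r / r)) (at r)"
proof -
  have r: "r \<in> {0<..<R}" using assms by auto
  then show "(v has_real_derivative deriv v r) (at r)"
    using assms(1) unfolding radial_solution_def C2_on_def
    by (meson DERIV_deriv_iff_field_differentiable)
  have "(deriv v has_real_derivative deriv (deriv v) r) (at r)"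
    using r assms(1) unfolding radial_solution_def C2_on_def
    by (meson DERIV_deriv_iff_field_differentiable)
  moreover have "- (deriv (deriv v) r + deriv v r / r) = V k r * f (v r)"
    using r assms(1) unfolding radial_solution_def by blast
  then have "deriv (deriv v) r = - (V k r * f (v r)) - deriv v r / r" by linarith
  ultimately show "(deriv v has_real_derivative (- (V k r * f (v r)) - deriv v r / r)) (at r)" by simp
qed

section \<open>Passage between the radius and the logarithmic coordinate\<close>

definition radius :: "real \<Rightarrow> real" where
  "radius x = exp (1 - exp (- x))"

definition log_coord :: "real \<Rightarrow> real" where
  "log_coord r = - ln (1 - ln r)"

lemma radius_pos: "radius x > 0" and radius_less_e: "radius x < exp 1"
  unfolding radius_def by simp_all

lemma log_coord_radius: "log_coord (radius x) = x"
  unfolding log_coord_def radius_def by simp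

lemma radius_log_coord: "0 < r \<Longrightarrow> r < exp 1 \<Longrightarrow> radius (log_coord r) = r"
  using one_minus_ln_pos[of r "exp 1"] unfolding log_coord_def radius_def by simp

lemma radius_less_iff: "R > 0 \<Longrightarrow> radius x < R \<longleftrightarrow> 1 - ln R < exp (- x)"
  unfolding radius_def by (subst ln_less_cancel_iff[symmetric]) auto

lemma radius_less_radius_iff: "radius x < radius z \<longleftrightarrow> x < z"
  unfolding radius_def by simp

lemma radius_tendsto_0: "(radius \<longlongrightarrow> 0) at_bot"
proof -
  have 1: "filterlim (\<lambda>x::real. exp (- x)) at_top at_bot"
    by (rule filterlim_compose[OF exp_at_top]) (rule filterlim_uminus_at_top_at_bot)
  have "((\<lambda>x. exp 1 * inverse (exp (exp (- x)))) \<longlongrightarrow> exp 1 * (0::real)) at_bot"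
    by (intro tendsto_mult tendsto_const tendsto_inverse_0_at_top filterlim_compose[OF exp_at_top 1])
  then show ?thesis unfolding radius_def by (simp add: exp_diff divide_inverse)
qed

text \<open>With t = exp (- x) = 1 - ln r one has dr / dx = r t. The second derivative of
  \<open>radius\<close> is r t^2 - r t: its first part cancels the term v' / r, its second part
  becomes the damping. The weight turns into a pure exponential, (r t)^2 V = t powr (- k) = exp (k
  x).\<close>

lemma radial_solution_imp_log_sol:
  assumes sol: "radial_solution k f \<beta> R v"
  shows "log_sol k f \<beta> (1 - ln R) (\<lambda>x. v (radius x)) (\<lambda>x. deriv v (radius x) * (radius x * exp (- x)))"
  unfolding log_sol_def
proof (intro conjI allI impI)
  have R: "0 < R" "R \<le> exp 1" and v: "continuous_on {0..<R} v" "v 0 = \<beta>"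
    using sol unfolding radial_solution_def by auto
  have "(v \<longlongrightarrow> v 0) (at 0 within {0..<R})"
    using v(1) R unfolding continuous_on_def by auto
  moreover have "filterlim radius (at 0 within {0..<R}) at_bot"
    unfolding filterlim_at
  proof
    show "\<forall>\<^sub>F x in at_bot. radius x \<in> {0..<R} \<and> radius x \<noteq> 0"
      using order_tendstoD(2)[OF radius_tendsto_0 R(1)]
      by eventually_elim (use radius_pos in \<open>auto simp: less_imp_le\<close>, metis less_irrefl radius_pos)
  qed (rule radius_tendsto_0)
  ultimately show "((\<lambda>x. v (radius x)) \<longlongrightarrow> \<beta>) at_bot"
    unfolding v(2) by (rule filterlim_compose)
  fix x assume "1 - ln R < exp (- x)"
  then have r: "0 < radius x" "radius x < R" using R radius_pos radius_less_iff by auto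
  have dr: "(radius has_real_derivative (radius x * exp (- x))) (at x)"
    unfolding radius_def by (auto intro!: derivative_eq_intros)
  show "((\<lambda>x. v (radius x)) has_real_derivative deriv v (radius x) * (radius x * exp (- x))) (at x)"
    by (rule DERIV_chain2[OF radial_solution_deriv(1)[OF sol r] dr])
  define a where "a = deriv v (radius x)"
  define F where "F = f (v (radius x))"
  define r where "r = radius x"
  define t where "t = exp (- x)"
  have "((\<lambda>x. exp (- x)) has_real_derivative (- exp (- x))) (at x)"
    by (auto intro!: derivative_eq_intros)
  from DERIV_mult[OF DERIV_chain2[OF radial_solution_deriv(2)[OF sol r] dr] DERIV_mult[OF dr this]]
  have "((\<lambda>x. deriv v (radius x) * (radius x * exp (- x))) has_real_derivative
     (- (V k r * F) - a / r) * (r * t) * (r * t) + (r * t * t + - t * r) * a) (at x)"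
    unfolding a_def F_def r_def t_def .
  moreover have "(- (V k r * F) - a / r) * (r * t) * (r * t) + (r * t * t + - t * r) * a
      = - (a * (r * t)) - exp (k * x) * F"
  proof -
    have "r > 0" "t > 0" unfolding r_def t_def by (simp_all add: radius_pos)
    have "V k r = 1 / (r\<^sup>2 * t powr (2 + k))"
      using V_eq[OF \<open>r > 0\<close>] unfolding r_def t_def radius_def by simp
    also have "t powr (2 + k) = t\<^sup>2 * exp (- (k * x))"
      unfolding t_def by (simp add: powr_def power2_eq_square algebra_simps flip: exp_add)
    finally have "V k r * (r * t) * (r * t) = exp (k * x)"
      using \<open>r > 0\<close> \<open>t > 0\<close> by (simp add: power2_eq_square exp_minus field_simps)
    moreover have "(V k r * F) * (r * t) * (r * t) = (V k r * (r * t) * (r * t)) * F"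
      by (simp only: mult_ac)
    ultimately have "(V k r * F) * (r * t) * (r * t) = exp (k * x) * F" by simp
    moreover have "a / r * (r * t) * (r * t) = a * r * t * t" using \<open>r > 0\<close> by simp
    ultimately show ?thesis by (simp only: left_diff_distrib minus_mult_left[symmetric]) (simp add: algebra_simps)
  qed
  ultimately show "((\<lambda>x. deriv v (radius x) * (radius x * exp (- x))) has_real_derivative
        - (deriv v (radius x) * (radius x * exp (- x))) - exp (k * x) * f (v (radius x))) (at x)"
    unfolding a_def F_def r_def t_def by simp
qed

text \<open>The centre has no logarithmic coordinate, so its value is supplied separately.\<close>

definition radial_of :: "real \<Rightarrow> (real \<Rightarrow> real) \<Rightarrow> real \<Rightarrow> real" where
  "radial_of \<beta> y r = (if r \<le> 0 then \<beta> else y (log_coord r))"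

lemma radial_of_0: "radial_of \<beta> y 0 = \<beta>"
  and radial_of_radius: "radial_of \<beta> y (radius x) = y x"
  using radius_pos[of x] by (auto simp: radial_of_def log_coord_radius)

lemma log_coord_at_bot: "filterlim log_coord at_bot (at_right 0)"
proof -
  have "filterlim (\<lambda>r::real. 1 + - ln r) at_top (at_right 0)"
    by (intro filterlim_tendsto_add_at_top[OF tendsto_const])
       (use ln_at_0 in \<open>simp add: filterlim_uminus_at_top\<close>)
  then have "filterlim (\<lambda>r::real. ln (1 - ln r)) at_top (at_right 0)"
    using filterlim_compose[OF ln_at_top] by auto
  then show ?thesis unfolding log_coord_def by (simp add: filterlim_uminus_at_bot)
qed

text \<open>The same computation backwards; continuity at the centre is the limit of y at -
  \<infinity>.\<close>

lemma log_sol_imp_radial_solution: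
  assumes sol: "log_sol k f \<beta> (1 - ln R) y y'" and R: "0 < R" "R \<le> exp 1" and f: "\<And>x. isCont f x"
  shows "radial_solution k f \<beta> R (radial_of \<beta> y)"
proof -
  define dv where "dv r = y' (log_coord r) * (1 / (r * (1 - ln r)))" for r
  have dom: "1 - ln R < exp (- log_coord r)" if "0 < r" "r < R" for r
    using that R one_minus_ln_pos[OF that R(2)] by (simp add: log_coord_def)
  have dl: "(log_coord has_real_derivative (1 / (r * (1 - ln r)))) (at r)" if "0 < r" "r < R" for r
    unfolding log_coord_def using that one_minus_ln_pos[OF that R(2)]
    by (auto intro!: derivative_eq_intros simp: field_simps)
  have eq: "radial_of \<beta> y r = y (log_coord r)" if "0 < r" for r
    using that by (simp add: radial_of_def)
  have dv: "(radial_of \<beta> y has_real_derivative dv r) (at r)" if "0 < r" "r < R" for r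
  proof (rule has_field_derivative_transform_within_open[where S = "{0<..}"])
    show "((\<lambda>r. y (log_coord r)) has_real_derivative dv r) (at r)"
      unfolding dv_def by (rule DERIV_chain2[OF log_sol_deriv[OF sol dom[OF that]] dl[OF that]])
  qed (use that eq in auto)
  have ddv: "(dv has_real_derivative - (V k r * f (radial_of \<beta> y r)) - dv r / r) (at r)"
    if "0 < r" "r < R" for r
  proof -
    define t where "t = 1 - ln r"
    define x where "x = log_coord r"
    have t: "t > 0" "ln r = 1 - t" unfolding t_def using one_minus_ln_pos[OF that R(2)] by simp_all
    have "((\<lambda>r. 1 / (r * (1 - ln r))) has_real_derivative (- (t - 1) / (r * t)\<^sup>2)) (at r)"
      using that t by (auto intro!: derivative_eq_intros simp: power2_eq_square)
    from DERIV_mult[OF DERIV_chain2[OF log_sol_deriv2[OF sol dom[OF that]] dl[OF that]] this]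
    have "(dv has_real_derivative ((- y' x - exp (k * x) * f (y x)) * (1 / (r * t)) * (1 / (r * t))
        + (- (t - 1) / (r * t)\<^sup>2) * y' x)) (at r)"
      unfolding dv_def x_def t_def .
    moreover have "(- y' x - exp (k * x) * f (y x)) * (1 / (r * t)) * (1 / (r * t))
        + (- (t - 1) / (r * t)\<^sup>2) * y' x = - (V k r * f (radial_of \<beta> y r)) - dv r / r"
    proof -
      have "exp (k * x) = t powr (- k)"
        unfolding x_def log_coord_def using t(1) by (simp add: powr_def t_def)
      then have "exp (k * x) * (1 / (r * t)) * (1 / (r * t)) = 1 / (r\<^sup>2 * (t powr (2 + k)))"
        using t that by (simp add: powr_minus powr_add power2_eq_square field_simps)
      also have "\<dots> = V k r" using V_eq[OF that(1)] by (simp add: t_def)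
      finally have "exp (k * x) * (1 / (r * t)) * (1 / (r * t)) = V k r" .
      moreover have "exp (k * x) * f (y x) * (1 / (r * t)) * (1 / (r * t)) =
          exp (k * x) * (1 / (r * t)) * (1 / (r * t)) * f (y x)" by (simp only: mult_ac)
      ultimately have "exp (k * x) * f (y x) * (1 / (r * t)) * (1 / (r * t)) = V k r * f (y x)" by simp
      moreover have "- y' x * (1 / (r * t)) * (1 / (r * t)) + (- (t - 1) / (r * t)\<^sup>2) * y' x = - dv r / r"
        unfolding dv_def x_def[symmetric] t_def[symmetric] using t that
        by (simp add: power2_eq_square field_simps)
      ultimately show ?thesis unfolding eq[OF that(1)] x_def[symmetric]
        by (simp only: left_diff_distrib)
    qed
    ultimately show ?thesis by simp
  qed
  have "continuous_on {0..<R} (radial_of \<beta> y)"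
  proof (clarsimp simp: continuous_on_eq_continuous_within)
    fix r assume r: "0 \<le> r" "r < R"
    show "continuous (at r within {0..<R}) (radial_of \<beta> y)"
    proof (cases "r = 0")
      case True
      have "((\<lambda>r. y (log_coord r)) \<longlongrightarrow> \<beta>) (at_right 0)"
        by (rule filterlim_compose[OF log_sol_tendsto[OF sol] log_coord_at_bot])
      then have "(radial_of \<beta> y \<longlongrightarrow> \<beta>) (at_right 0)"
        by (rule Lim_transform_eventually)
           (auto simp: eventually_at_filter eq intro!: always_eventually)
      then have "(radial_of \<beta> y \<longlongrightarrow> \<beta>) (at 0 within {0..<R})"
      proof (rule tendsto_mono[rotated])
        show "at 0 within {0..<R} \<le> at_right 0"
          by (auto simp: le_filter_def eventually_at_filter elim!: eventually_mono)
      qed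
      then show ?thesis using True by (simp add: continuous_within radial_of_0)
    next
      case False
      then have "isCont (radial_of \<beta> y) r" using dv[of r] r by (intro DERIV_isCont) auto
      then show ?thesis by (rule continuous_at_imp_continuous_at_within)
    qed
  qed
  then show ?thesis by (rule radial_solutionI[OF R _ radial_of_0 dv ddv f])
qed

section \<open>Uniqueness and maximal solutions on balls\<close>

lemma radial_solution_unique:
  assumes v: "radial_solution k f \<beta> R v" and w: "radial_solution k f \<beta> R w"
    and f: "loc_lip f" and k: "k > 0" and r: "r \<in> {0..<R}"
  shows "v r = w r"
proof (cases "r = 0")
  case True
  then show ?thesis using v w unfolding radial_solution_def by simp
next
  case False
  have R: "0 < R" "R \<le> exp 1" using v unfolding radial_solution_def by auto
  have rr: "radius (log_coord r) = r" using False r R by (intro radius_log_coord) auto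
  have "1 - ln R < exp (- log_coord r)" using radius_less_iff[OF R(1), of "log_coord r"] rr r by simp
  from log_sol_unique[OF radial_solution_imp_log_sol[OF v] radial_solution_imp_log_sol[OF w] f k this]
  show ?thesis unfolding rr .
qed

text \<open>By uniqueness any two solutions agree on the smaller ball, so all of them glue to a
  solution on the ball whose radius is the supremum of the admissible radii. An extension would have
  an admissible radius above that supremum.\<close>

lemma maximal_radial_solution_exists:
  assumes ex: "radial_solution k f \<beta> R0 v0" and f: "loc_lip f" and k: "k > 0"
  shows "\<exists>R v. maximal_radial_solution k f \<beta> R v"
proof -
  define A where "A = {R. \<exists>v. radial_solution k f \<beta> R v}"
  have A0: "R0 \<in> A" and Ae: "\<And>R. R \<in> A \<Longrightarrow> 0 < R \<and> R \<le> exp 1"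
    using ex unfolding A_def radial_solution_def by auto
  have bdd: "bdd_above A" by (rule bdd_aboveI[of _ "exp 1"]) (use Ae in blast)
  define R where "R = Sup A"
  have R: "R0 \<le> R" "R \<le> exp 1" and RA: "\<And>S. S \<in> A \<Longrightarrow> S \<le> R"
    unfolding R_def using cSup_upper[OF _ bdd] cSup_least[of A "exp 1"] A0 Ae by auto
  have R0: "0 < R" using Ae[OF A0] R by simp
  have "\<exists>S w. r < S \<and> radial_solution k f \<beta> S w" if "r < R" for r
    using less_cSupD[of A r] that A0 unfolding R_def A_def by blast
  then obtain S w where Sw: "\<And>r. r < R \<Longrightarrow> r < S r" "\<And>r. r < R \<Longrightarrow> radial_solution k f \<beta> (S r) (w r)"
    by metis
  \<comment> \<open>\<open>w r\<close> lives on a ball of radius \<open>S r\<close> larger than r,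
    so it may be evaluated at r; by uniqueness \<open>v\<close> agrees with \<open>w r\<close> on
    that whole ball.\<close>
  define v where "v r = w r r" for r
  have vw: "v q = w r q" if "r < R" "q \<in> {0..<S r}" for r q
  proof -
    have "S r \<le> R" using Sw(2)[OF that(1)] RA unfolding A_def by blast
    then have q: "q < R" using that by simp
    define m where "m = min (S q) (S r)"
    have m: "q < m" "0 < m" using Sw(1)[OF q] that by (auto simp: m_def)
    show ?thesis unfolding v_def
      by (rule radial_solution_unique[OF radial_solution_restrict[OF Sw(2)[OF q] m(2)]
            radial_solution_restrict[OF Sw(2)[OF that(1)] m(2)] f k])
         (use m that in \<open>auto simp: m_def\<close>)
  qed
  have dw: "(v has_real_derivative deriv (w r) q) (at q)"
    if "r < R" "0 < q" "q < S r" for r q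
    by (rule has_field_derivative_transform_within_open[OF radial_solution_deriv(1)[OF Sw(2)[OF that(1)] that(2,3)],
          where S = "{0<..<S r}"])
       (use that vw[OF that(1)] in auto)
  have dv: "deriv v q = deriv (w r) q" if "r < R" "0 < q" "q < S r" for r q
    using dw[OF that] by (rule DERIV_imp_deriv)
  have "radial_solution k f \<beta> R v"
  proof (rule radial_solutionI[OF R0 R(2), where dv = "deriv v"])
    show "continuous_on {0..<R} v"
    proof (clarsimp simp: continuous_on_eq_continuous_within)
      fix r assume r: "0 \<le> r" "r < R"
      have c: "continuous_on {0..<S r} v"
        by (rule continuous_on_cong[THEN iffD1, rotated 2])
           (use vw[OF r(2)] Sw(2)[OF r(2)] in \<open>auto simp: radial_solution_def\<close>)
      have "at r within {0..<R} = at r within {0..<S r}"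
      proof (rule at_within_nhd[where S = "{..<S r}"])
        show "{0..<R} \<inter> {..<S r} - {r} = {0..<S r} \<inter> {..<S r} - {r}"
          using Sw(2)[OF r(2)] RA unfolding A_def by fastforce
      qed (use Sw(1)[OF r(2)] in auto)
      then show "continuous (at r within {0..<R}) v"
        using c r Sw(1)[OF r(2)] by (simp add: continuous_on_eq_continuous_within)
    qed
    show "v 0 = \<beta>" using Sw(2)[OF R0] unfolding v_def radial_solution_def by simp
    show "isCont f x" for x by (rule loc_lip_isCont[OF f])
    fix r assume r: "0 < r" "r < R"
    note Sr = Sw(1)[OF r(2)]
    show "(v has_real_derivative deriv v r) (at r)"
      using dw[OF r(2,1) Sr] dv[OF r(2,1) Sr] by simp
    have "(deriv v has_real_derivative (- (V k r * f (w r r)) - deriv (w r) r / r)) (at r)"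
      by (rule has_field_derivative_transform_within_open[OF radial_solution_deriv(2)[OF Sw(2)[OF r(2)] r(1) Sr],
          where S = "{0<..<S r}"])
         (use dv[OF r(2)] r Sr in auto)
    then show "(deriv v has_real_derivative (- (V k r * f (v r)) - deriv v r / r)) (at r)"
      using dv[OF r(2,1) Sr] vw[OF r(2), of r] r Sr by simp
  qed
  moreover have "\<not> (\<exists>S w. R < S \<and> radial_solution k f \<beta> S w \<and> (\<forall>r\<in>{0..<R}. w r = v r))"
  proof
    assume "\<exists>S w. R < S \<and> radial_solution k f \<beta> S w \<and> (\<forall>r\<in>{0..<R}. w r = v r)"
    then obtain S w where "R < S" "radial_solution k f \<beta> S w" by blast
    moreover from this have "S \<le> R" by (intro RA) (auto simp: A_def)
    ultimately show False by simp
  qed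
  ultimately show ?thesis unfolding maximal_radial_solution_def by blast
qed

section \<open>Ordering, crossing and convergence\<close>

text \<open>Convexity, by the mean value theorem. The lower bound will feed oscillation, the upper
  one ordering and the Lipschitz estimate.\<close>

lemma powr_tangent_bounds:
  fixes a b p :: real
  assumes "0 \<le> a" "a \<le> b" "p \<ge> 1"
  shows "p * a powr (p - 1) * (b - a) \<le> b powr p - a powr p"
    and "b powr p - a powr p \<le> p * b powr (p - 1) * (b - a)"
proof -
  have "p * a powr (p - 1) * (b - a) \<le> b powr p - a powr p \<and>
    b powr p - a powr p \<le> p * b powr (p - 1) * (b - a)"
  proof (cases "a = b")
    case False
    then have ab: "a < b" using assms by simp
    have d: "((\<lambda>x. x powr p) has_real_derivative p * z powr (p - 1)) (at z)" if "a < z" for z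
      using that assms by (intro has_real_derivative_powr) simp
    have "\<exists>l z. a < z \<and> z < b \<and> ((\<lambda>x. x powr p) has_real_derivative l) (at z) \<and>
        b powr p - a powr p = (b - a) * l"
    proof (rule MVT[OF ab])
      show "continuous_on {a..b} (\<lambda>x. x powr p)"
        using assms by (intro continuous_on_powr' continuous_intros) auto
      show "(\<lambda>x. x powr p) differentiable at z" if "a < z" for z
        using d[OF that] real_differentiable_def by blast
    qed
    then obtain l z where z: "a < z" "z < b" "((\<lambda>x. x powr p) has_real_derivative l) (at z)"
      "b powr p - a powr p = (b - a) * l" by blast
    have l: "l = p * z powr (p - 1)" using DERIV_unique[OF z(3) d[OF z(1)]] .
    have "a powr (p - 1) \<le> z powr (p - 1)" "z powr (p - 1) \<le> b powr (p - 1)"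
      using z assms by (auto intro!: powr_mono2)
    then have "p * a powr (p - 1) \<le> l" "l \<le> p * b powr (p - 1)"
      unfolding l using assms by auto
    then show ?thesis unfolding z(4) using ab by (simp add: mult.commute mult_left_mono)
  qed simp
  then show "p * a powr (p - 1) * (b - a) \<le> b powr p - a powr p"
    and "b powr p - a powr p \<le> p * b powr (p - 1) * (b - a)" by auto
qed

lemma exp_tangent_bounds:
  fixes a b :: real
  shows "exp a * (b - a) \<le> exp b - exp a" "exp b - exp a \<le> exp b * (b - a)"
proof -
  have "exp a * (1 + (b - a)) \<le> exp a * exp (b - a)"
    by (intro mult_left_mono exp_ge_add_one_self) simp
  then show "exp a * (b - a) \<le> exp b - exp a" by (simp add: algebra_simps flip: exp_add)
  have "exp b * (1 + (a - b)) \<le> exp b * exp (a - b)"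
    by (intro mult_left_mono exp_ge_add_one_self) simp
  then show "exp b - exp a \<le> exp b * (b - a)" by (simp add: algebra_simps flip: exp_add)
qed

lemma exp_lipschitz: "exp (max a b) * \<bar>a - b\<bar> \<ge> \<bar>exp a - exp b\<bar>" for a b :: real
  using exp_tangent_bounds(2)[of b a] exp_tangent_bounds(2)[of a b]
  by (cases "a \<le> b") (auto simp: max_def abs_if algebra_simps)

lemma loc_lip_exp: "loc_lip exp"
  unfolding loc_lip_def
proof (intro allI exI lipschitz_onI)
  fix M a b :: real assume "a \<in> {- M..M}" "b \<in> {- M..M}"
  then have "exp (max a b) * \<bar>a - b\<bar> \<le> exp M * \<bar>a - b\<bar>"
    by (intro mult_right_mono) auto
  then show "dist (exp a) (exp b) \<le> exp M * dist a b"
    using exp_lipschitz[of a b] by (simp add: dist_real_def)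
qed simp

lemma loc_lip_f_pow:
  assumes "p \<ge> 1" shows "loc_lip (f_pow p)"
  unfolding loc_lip_def
proof (intro allI exI lipschitz_onI)
  fix M a b :: real assume ab: "a \<in> {- M..M}" "b \<in> {- M..M}"
  have *: "\<bar>\<bar>b\<bar> powr p - \<bar>a\<bar> powr p\<bar> \<le> p * \<bar>M\<bar> powr (p - 1) * \<bar>b - a\<bar>"
    if "\<bar>a\<bar> \<le> \<bar>b\<bar>" "\<bar>b\<bar> \<le> \<bar>M\<bar>" for a b
  proof -
    have "\<bar>\<bar>b\<bar> powr p - \<bar>a\<bar> powr p\<bar> = \<bar>b\<bar> powr p - \<bar>a\<bar> powr p"
      using that assms by (simp add: powr_mono2)
    also have "\<dots> \<le> p * \<bar>b\<bar> powr (p - 1) * (\<bar>b\<bar> - \<bar>a\<bar>)"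
      using that assms by (intro powr_tangent_bounds) auto
    also have "\<dots> \<le> p * \<bar>M\<bar> powr (p - 1) * \<bar>b - a\<bar>"
      using that assms by (intro mult_mono powr_mono2) auto
    finally show ?thesis .
  qed
  have ab: "\<bar>a\<bar> \<le> \<bar>M\<bar>" "\<bar>b\<bar> \<le> \<bar>M\<bar>" using ab by auto
  show "dist (f_pow p a) (f_pow p b) \<le> p * \<bar>M\<bar> powr (p - 1) * dist a b"
  proof (cases "\<bar>a\<bar> \<le> \<bar>b\<bar>")
    case True
    then show ?thesis using *[of a b] ab by (simp add: f_pow_def dist_real_def abs_minus_commute)
  next
    case False
    then show ?thesis using *[of b a] ab by (simp add: f_pow_def dist_real_def)
  qed
qed (use assms in simp)

lemma loc_lip_nonlinearities: "k > 0 \<Longrightarrow> f \<in> nonlinearities k \<Longrightarrow> loc_lip f"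
  unfolding nonlinearities_def p_s_def by (auto intro: loc_lip_exp loc_lip_f_pow)

text \<open>Freezing f outside [- M, M] makes a locally Lipschitz f bounded and globally Lipschitz,
  as the existence theorem demands.\<close>

definition truncate :: "real \<Rightarrow> (real \<Rightarrow> real) \<Rightarrow> real \<Rightarrow> real" where
  "truncate M f v = f (max (- M) (min M v))"

lemma truncate_eq: "\<bar>v\<bar> \<le> M \<Longrightarrow> truncate M f v = f v"
  unfolding truncate_def by (simp add: abs_le_iff)

lemma truncate_lipschitz_bounded:
  assumes "loc_lip f" "M > 0"
  obtains L B where "L-lipschitz_on UNIV (truncate M f)" "\<And>v. \<bar>truncate M f v\<bar> \<le> B"
proof -
  obtain L where L: "L-lipschitz_on {- M..M} f" using assms(1) unfolding loc_lip_def by blast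
  have c: "max (- M) (min M v) \<in> {- M..M}" for v using assms(2) by auto
  show ?thesis
  proof (rule that)
    show "L-lipschitz_on UNIV (truncate M f)"
    proof (rule lipschitz_onI)
      fix a b :: real
      have "dist (truncate M f a) (truncate M f b) \<le> L * dist (max (- M) (min M a)) (max (- M) (min M b))"
        unfolding truncate_def by (rule lipschitz_onD[OF L c c])
      also have "\<dots> \<le> L * dist a b"
        by (intro mult_left_mono lipschitz_on_nonneg[OF L]) (auto simp: dist_real_def max_def min_def)
      finally show "dist (truncate M f a) (truncate M f b) \<le> L * dist a b" .
    qed (rule lipschitz_on_nonneg[OF L])
    fix v
    have "\<bar>truncate M f v - f 0\<bar> \<le> L * \<bar>max (- M) (min M v)\<bar>"
      unfolding truncate_def using lipschitz_onD[OF L c, of 0 v] assms(2) by (simp add: dist_real_def)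
    also have "\<dots> \<le> L * M"
      by (intro mult_left_mono lipschitz_on_nonneg[OF L]) (use assms(2) in auto)
    finally show "\<bar>truncate M f v\<bar> \<le> \<bar>f 0\<bar> + L * M" by linarith
  qed
qed

text \<open>The way back from a truncated nonlinearity F to f, on the part of the line where the
  solution stays in the region of agreement. A larger \<open>T'\<close> means a shorter
  part.\<close>

lemma log_sol_transfer:
  assumes "log_sol k F \<beta> T y y'" "T \<le> T'" "\<And>x. T' < exp (- x) \<Longrightarrow> F (y x) = f (y x)"
  shows "log_sol k f \<beta> T' y y'"
  unfolding log_sol_def
proof (intro conjI allI impI)
  fix x assume x: "T' < exp (- x)"
  with assms(2) have "T < exp (- x)" by simp
  then show "(y has_real_derivative y' x) (at x)"
    "(y' has_real_derivative - y' x - exp (k * x) * f (y x)) (at x)"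
    unfolding assms(3)[OF x, symmetric] by (rule log_sol_deriv[OF assms(1)] log_sol_deriv2[OF assms(1)])+
qed (rule log_sol_tendsto[OF assms(1)])

section \<open>Monotonicity for nonnegative nonlinearities\<close>

lemma log_sol_deriv_nonpos:
  assumes sol: "log_sol k f \<beta> T y y'" and f: "isCont f \<beta>" "\<And>v. f v \<ge> 0" and k: "k > 0"
    and x: "T < exp (- x)"
  shows "y' x \<le> 0"
proof -
  have "exp x * y' x \<le> 0"
    by (rule deriv_nonpos_le_limit_at_bot[where P = "\<lambda>x. exp x * y' x",
          OF log_sol_momentum_tendsto_0[OF sol f(1) k] log_sol_momentum_deriv[OF sol less_exp_minus_downward[OF x]]])
       (use f in auto)
  then show ?thesis by (simp add: mult_le_0_iff)
qed

text \<open>f (y z) > 0 is known only near the centre. It makes the momentum negative there, and the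
  momentum never increases afterwards.\<close>

lemma log_sol_deriv_neg:
  assumes sol: "log_sol k f \<beta> T y y'" and f: "isCont f \<beta>" "\<And>v. f v \<ge> 0" "f \<beta> > 0" and k: "k > 0"
    and x: "T < exp (- x)"
  shows "y' x < 0"
proof -
  have "((\<lambda>z. f (y z)) \<longlongrightarrow> f \<beta>) at_bot"
    by (rule isCont_tendsto_compose[OF f(1) log_sol_tendsto[OF sol]])
  from order_tendstoD(1)[OF this f(3)] obtain X where X: "\<And>z. z \<le> X \<Longrightarrow> f (y z) > 0"
    by (auto simp: eventually_at_bot_linorder)
  define z where "z = min x X"
  note dP = log_sol_momentum_deriv[OF sol less_exp_minus_downward[OF x]]
  have "exp z * y' z < 0"
    by (rule deriv_neg_less_limit_at_bot[where P = "\<lambda>x. exp x * y' x",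
          OF log_sol_momentum_tendsto_0[OF sol f(1) k] dP])
       (use X in \<open>auto simp: z_def\<close>)
  moreover have "exp x * y' x \<le> exp z * y' z"
  proof (rule DERIV_nonpos_imp_nonincreasing[where f = "\<lambda>x. exp x * y' x"])
    show "\<exists>d. ((\<lambda>x. exp x * y' x) has_real_derivative d) (at s) \<and> d \<le> 0" if "s \<le> x" for s
      using dP[OF that] f(2)[of "y s"] by (intro exI conjI) auto
  qed (simp add: z_def)
  ultimately have "exp x * y' x < 0" by simp
  then show ?thesis by (simp add: mult_less_0_iff)
qed

lemma log_sol_antimono:
  assumes sol: "log_sol k f \<beta> T y y'" and f: "isCont f \<beta>" "\<And>v. f v \<ge> 0" and k: "k > 0"
    and x: "T < exp (- x)" and zx: "z \<le> x"
  shows "y x \<le> y z"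
  using zx
proof (rule DERIV_nonpos_imp_nonincreasing)
  show "\<exists>d. (y has_real_derivative d) (at s) \<and> d \<le> 0" if "s \<le> x" for s
    using log_sol_deriv[OF sol less_exp_minus_downward[OF x that]]
      log_sol_deriv_nonpos[OF sol f k less_exp_minus_downward[OF x that]] by blast
qed

lemma log_sol_le:
  assumes sol: "log_sol k f \<beta> T y y'" and f: "isCont f \<beta>" "\<And>v. f v \<ge> 0" and k: "k > 0"
    and x: "T < exp (- x)"
  shows "y x \<le> \<beta>"
  using log_sol_tendsto[OF sol]
  by (rule deriv_nonpos_le_limit_at_bot)
     (blast intro: log_sol_deriv[OF sol] log_sol_deriv_nonpos[OF sol f k] less_exp_minus_downward[OF x])+

text \<open>No condition at the centre is imposed, so that the singular solutions, which are
  unbounded there, qualify as well.\<close>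

definition log_eq_sol :: "real \<Rightarrow> (real \<Rightarrow> real) \<Rightarrow> (real \<Rightarrow> real) \<Rightarrow> (real \<Rightarrow> real) \<Rightarrow> bool" where
  "log_eq_sol k f y y' \<longleftrightarrow> (\<forall>x. (y has_real_derivative y' x) (at x) \<and>
        (y' has_real_derivative (- y' x - exp (k * x) * f (y x))) (at x))"

lemma log_sol_imp_log_eq_sol: "log_sol k f \<beta> 0 y y' \<Longrightarrow> log_eq_sol k f y y'"
  unfolding log_sol_def log_eq_sol_def by auto

section \<open>Ordering and oscillation of two solutions\<close>

lemma first_nonpos_at:
  fixes d :: "real \<Rightarrow> real"
  assumes cont: "\<And>x. isCont d x" and ev: "\<forall>\<^sub>F x in at_bot. d x > 0" and "d x0 \<le> 0"
  obtains x1 where "d x1 \<le> 0" "\<And>z. z < x1 \<Longrightarrow> d z > 0"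
proof -
  define A where "A = {x. d x \<le> 0}"
  obtain X where X: "\<And>x. x \<le> X \<Longrightarrow> d x > 0" using ev by (auto simp: eventually_at_bot_linorder)
  have "closed A" unfolding A_def
    using cont by (intro closed_Collect_le continuous_at_imp_continuous_on) auto
  moreover have bdd: "bdd_below A"
  proof (rule bdd_belowI[of _ X])
    fix z assume "z \<in> A"
    then show "X \<le> z" using X[of z] by (cases "z \<le> X") (auto simp: A_def)
  qed
  ultimately have "Inf A \<in> A" using assms(3) by (intro closed_contains_Inf) (auto simp: A_def)
  moreover have "d z > 0" if "z < Inf A" for z
    using cInf_lower[OF _ bdd, of z] that by (force simp: A_def)
  ultimately show ?thesis using that unfolding A_def by blast
qed

text \<open>
  The rescaled difference \<open>exp (x / 2) (y2 - y1)\<close> is convex as long as it is positive.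
\<close>

lemma log_eq_sol_order:
  assumes s1: "log_eq_sol k f y1 y1'" and s2: "log_eq_sol k f y2 y2'"
    and ev: "\<forall>\<^sub>F x in at_bot. y1 x < y2 x"
    and lim: "((\<lambda>x. exp (x / 2) * (y2 x - y1 x)) \<longlongrightarrow> 0) at_bot"
    and lim': "((\<lambda>x. exp (x / 2) * (y2' x - y1' x)) \<longlongrightarrow> 0) at_bot"
    and tan: "\<And>x. y1 x < y2 x \<Longrightarrow> exp (k * x) * (f (y2 x) - f (y1 x)) \<le> (y2 x - y1 x) / 4"
  shows "y1 x < y2 x"
proof (rule ccontr)
  define d where "d x = y2 x - y1 x" for x
  define d' where "d' x = y2' x - y1' x" for x
  define q where "q x = exp (k * x) * (f (y2 x) - f (y1 x))" for x
  have dd: "(d has_real_derivative d' x) (at x)" for x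
    unfolding d_def d'_def using s1 s2 unfolding log_eq_sol_def by (blast intro: DERIV_diff)
  have dd': "(d' has_real_derivative (- d' x - q x)) (at x)" for x
  proof -
    have "(d' has_real_derivative ((- y2' x - exp (k * x) * f (y2 x)) - (- y1' x - exp (k * x) * f (y1 x)))) (at x)"
      unfolding d'_def[abs_def] using s1 s2 unfolding log_eq_sol_def by (blast intro: DERIV_diff)
    then show ?thesis unfolding q_def d'_def by (simp add: algebra_simps)
  qed
  assume "\<not> y1 x < y2 x"
  then have "d x \<le> 0" unfolding d_def by simp
  moreover have "\<forall>\<^sub>F x in at_bot. d x > 0" using ev unfolding d_def by eventually_elim simp
  ultimately obtain x1 where x1: "d x1 \<le> 0" "\<And>z. z < x1 \<Longrightarrow> d z > 0"
    using first_nonpos_at[of d x] DERIV_isCont[OF dd] by metis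
  \<comment> \<open>The factor removes the first-order term: u'' = exp (x / 2) (d / 4 - q). This is
    where the threshold 1 / 4 comes from.\<close>
  define u where "u x = exp (x / 2) * d x" for x
  define u' where "u' x = exp (x / 2) * d' x + 1 / 2 * (exp (x / 2) * d x)" for x
  have e: "((\<lambda>x. exp (x / 2)) has_real_derivative (exp (x / 2) / 2)) (at x)" for x :: real
    by (auto intro!: derivative_eq_intros)
  have du: "(u has_real_derivative u' x) (at x)" for x
    using DERIV_mult[OF e dd, of x] unfolding u_def[abs_def] u'_def by (simp add: algebra_simps)
  have du': "(u' has_real_derivative (exp (x / 2) * (d x / 4 - q x))) (at x)" for x
  proof -
    have "(u' has_real_derivative (exp (x / 2) / 2 * d' x + (- d' x - q x) * exp (x / 2)
        + 1 / 2 * (exp (x / 2) / 2 * d x + d' x * exp (x / 2)))) (at x)"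
      unfolding u'_def[abs_def] by (intro DERIV_add DERIV_cmult DERIV_mult e dd dd')
    then show ?thesis by (simp add: algebra_simps)
  qed
  have lim_u': "(u' \<longlongrightarrow> 0) at_bot"
    using tendsto_add[OF lim' tendsto_mult_left[OF lim, of "1 / 2"]]
    unfolding u'_def[abs_def] d_def d'_def by simp
  \<comment> \<open>u' vanishes at - \<infinity> and does not decrease up to x1, so u cannot come
    down from a positive to a nonpositive value.\<close>
  have u'_nonneg: "u' z \<ge> 0" if "z < x1" for z
  proof (rule deriv_nonneg_ge_limit_at_bot[OF lim_u', where P' = "\<lambda>x. exp (x / 2) * (d x / 4 - q x)"])
    show "(u' has_real_derivative (exp (s / 2) * (d s / 4 - q s))) (at s)" for s by (rule du')
    fix s assume "s \<le> z"
    then have "d s > 0" using x1(2) that by simp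
    then have "q s \<le> d s / 4" using tan[of s] unfolding d_def q_def by simp
    then show "exp (s / 2) * (d s / 4 - q s) \<ge> 0" by simp
  qed
  have "u (x1 - 1) \<le> u x1"
  proof (rule DERIV_nonneg_imp_increasing_open[where f = u])
    show "\<exists>y. (u has_real_derivative y) (at z) \<and> y \<ge> 0" if "z < x1" for z
      using du u'_nonneg[OF that] by blast
    show "continuous_on {x1 - 1..x1} u"
      using DERIV_isCont[OF du] by (auto intro: continuous_at_imp_continuous_on)
  qed simp
  moreover have "u (x1 - 1) > 0" unfolding u_def using x1(2)[of "x1 - 1"] by simp
  moreover have "u x1 \<le> 0" unfolding u_def using x1(1) by (simp add: mult_le_0_iff)
  ultimately show False by simp
qed

text \<open>
  Sturm comparison of \<open>exp (x / 2) d\<close> with \<open>sin (\<omega> (x - X))\<close>, where \<open>\<omega>\<^sup>2 = c - 1 / 4\<close>.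
\<close>

lemma no_eventually_positive_oscillator:
  fixes d d' q :: "real \<Rightarrow> real"
  assumes dd: "\<And>x. (d has_real_derivative d' x) (at x)"
    and dd': "\<And>x. (d' has_real_derivative (- d' x - q x)) (at x)"
    and pos: "\<And>x. x \<ge> X \<Longrightarrow> d x > 0" and q: "\<And>x. x \<ge> X \<Longrightarrow> q x \<ge> c * d x" and c: "c > 1 / 4"
  shows False
proof -
  define \<omega> where "\<omega> = sqrt (c - 1 / 4)"
  have \<omega>: "\<omega> > 0" "\<omega> * \<omega> = c - 1 / 4" unfolding \<omega>_def using c by auto
  \<comment> \<open>The Wronskian of \<open>exp (x / 2) * d x\<close> and the sine. It cannot
    increase over the half-period from X to X + pi / \<omega>, yet it is negative at the left end
    and positive at the right end.\<close>
  define W where "W x = exp (x / 2) * (d' x + d x / 2) * sin (\<omega> * (x - X))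
      - exp (x / 2) * d x * (\<omega> * cos (\<omega> * (x - X)))" for x
  have dW: "(W has_real_derivative (exp (x / 2) * (c * d x - q x) * sin (\<omega> * (x - X)))) (at x)" for x
  proof -
    have "(W has_real_derivative (exp (x / 2) * (d x / 4 - q x + (\<omega> * \<omega>) * d x) * sin (\<omega> * (x - X)))) (at x)"
      unfolding W_def[abs_def]
      by (rule derivative_eq_intros dd dd' refl | simp)+ (simp add: algebra_simps)
    then show ?thesis unfolding \<omega>(2) by (simp add: algebra_simps)
  qed
  define Z where "Z = X + pi / \<omega>"
  have XZ: "X \<le> Z" unfolding Z_def using \<omega> by simp
  have "W Z \<le> W X"
  proof (rule DERIV_nonpos_imp_nonincreasing[OF XZ])
    fix x assume x: "X \<le> x" "x \<le> Z"
    have "\<omega> * (x - X) \<le> \<omega> * (pi / \<omega>)" using x \<omega> by (intro mult_left_mono) (auto simp: Z_def)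
    then have "sin (\<omega> * (x - X)) \<ge> 0" using x \<omega> by (intro sin_ge_zero) auto
    then have "exp (x / 2) * (c * d x - q x) * sin (\<omega> * (x - X)) \<le> 0"
      using q[OF x(1)] by (intro mult_nonpos_nonneg mult_nonneg_nonpos) auto
    then show "\<exists>y. (W has_real_derivative y) (at x) \<and> y \<le> 0" using dW by blast
  qed
  moreover have "W X < 0" unfolding W_def using pos[of X] \<omega> by simp
  moreover have "W Z = exp (Z / 2) * d Z * \<omega>" unfolding W_def Z_def using \<omega> by simp
  moreover have "exp (Z / 2) * d Z * \<omega> > 0" using pos[OF XZ] \<omega> by simp
  ultimately show False by linarith
qed

text \<open>The hypothesis is the lower bound q \<ge> c d multiplied by the difference d, which
  makes it independent of which solution is the larger one.\<close>

lemma log_eq_sol_crossing: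
  assumes s1: "log_eq_sol k f y1 y1'" and s2: "log_eq_sol k f y2 y2'" and c: "c > 1 / 4"
    and ev: "\<forall>\<^sub>F x in at_top. c * (y2 x - y1 x)\<^sup>2 \<le> (y2 x - y1 x) * (exp (k * x) * (f (y2 x) - f (y1 x)))"
  shows "\<exists>x>X. y1 x = y2 x"
proof (rule ccontr)
  assume "\<not> (\<exists>x>X. y1 x = y2 x)"
  then have ne: "y2 x - y1 x \<noteq> 0" if "x > X" for x using that by force
  obtain X1 where X1: "\<And>x. x \<ge> X1 \<Longrightarrow>
      c * (y2 x - y1 x)\<^sup>2 \<le> (y2 x - y1 x) * (exp (k * x) * (f (y2 x) - f (y1 x)))"
    using ev by (auto simp: eventually_at_top_linorder)
  define Z where "Z = max X X1 + 1"
  \<comment> \<open>Normalises the sign: the difference becomes positive at \<open>Z\<close>, and it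
    stays so as long as it has no zero.\<close>
  define s where "s = sgn (y2 Z - y1 Z)"
  have Z: "Z > X" "Z \<ge> X1" unfolding Z_def by auto
  have s: "s * s = 1" "s \<noteq> 0" unfolding s_def using ne[OF Z(1)] by (auto simp: sgn_if)
  define d where "d x = s * (y2 x - y1 x)" for x
  define d' where "d' x = s * (y2' x - y1' x)" for x
  define q where "q x = s * (exp (k * x) * (f (y2 x) - f (y1 x)))" for x
  have dd: "(d has_real_derivative d' x) (at x)" for x
    unfolding d_def d'_def using s1 s2 unfolding log_eq_sol_def by (intro DERIV_cmult DERIV_diff) auto
  have dd': "(d' has_real_derivative (- d' x - q x)) (at x)" for x
  proof -
    have "(d' has_real_derivative s * ((- y2' x - exp (k * x) * f (y2 x)) - (- y1' x - exp (k * x) * f (y1 x)))) (at x)"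
      unfolding d'_def[abs_def] using s1 s2 unfolding log_eq_sol_def by (intro DERIV_cmult DERIV_diff) auto
    then show ?thesis unfolding q_def d'_def by (simp add: algebra_simps)
  qed
  have pos: "d x > 0" if "x \<ge> Z" for x
  proof (rule ccontr)
    assume "\<not> d x > 0"
    moreover have "d Z > 0" unfolding d_def s_def using ne[OF Z(1)] by (auto simp: sgn_if)
    ultimately have "\<exists>t\<ge>Z. t \<le> x \<and> d t = 0"
      using that DERIV_isCont[OF dd] by (intro IVT2) auto
    then obtain t where "t \<ge> Z" "d t = 0" by blast
    then show False using ne[of t] Z s unfolding d_def by simp
  qed
  show False
  proof (rule no_eventually_positive_oscillator[OF dd dd' pos _ c])
    fix x assume x: "x \<ge> Z"
    have "c * (d x)\<^sup>2 = c * (s * s) * (y2 x - y1 x)\<^sup>2"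
      unfolding d_def by (simp add: power2_eq_square mult_ac)
    also have "\<dots> \<le> (s * s) * ((y2 x - y1 x) * (exp (k * x) * (f (y2 x) - f (y1 x))))"
      using X1[of x] x Z unfolding s by simp
    also have "\<dots> = d x * q x" unfolding d_def q_def by (simp only: mult_ac)
    finally have "d x * (c * d x) \<le> d x * q x" by (simp add: power2_eq_square mult_ac)
    then show "q x \<ge> c * d x" using pos[OF x] by simp
  qed
qed

section \<open>Convergence under damping\<close>

lemma barbalat:
  fixes F f g :: "real \<Rightarrow> real"
  assumes F: "\<And>x. x \<ge> X \<Longrightarrow> (F has_real_derivative f x) (at x)"
    and f: "\<And>x. x \<ge> X \<Longrightarrow> (f has_real_derivative g x) (at x)"
    and g: "\<And>x. x \<ge> X \<Longrightarrow> \<bar>g x\<bar> \<le> M"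
    and lim: "(F \<longlongrightarrow> l) at_top"
  shows "(f \<longlongrightarrow> 0) at_top"
proof (rule tendstoI)
  fix e :: real assume e: "e > 0"
  have M: "M \<ge> 0" using g[of X] by simp
  \<comment> \<open>Over a length \<delta> the function f changes by at most e / 2. If |f x| were at
    least e, then F would move by at least \<delta> e / 2, which its convergence rules out for large
    x. The added 1 covers M = 0.\<close>
  define \<delta> where "\<delta> = e / (2 * (M + 1))"
  have \<delta>: "\<delta> > 0" "M * \<delta> \<le> e / 2"
    unfolding \<delta>_def using e M by (auto simp: field_simps)
  have "((\<lambda>x. F (\<delta> + x)) \<longlongrightarrow> l) at_top"
    by (rule filterlim_compose[OF lim]) (rule filterlim_tendsto_add_at_top[OF tendsto_const filterlim_ident])
  then have "((\<lambda>x. F (\<delta> + x) - F x) \<longlongrightarrow> l - l) at_top" by (intro tendsto_diff lim)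
  then have "\<forall>\<^sub>F x in at_top. dist (F (\<delta> + x) - F x) 0 < \<delta> * (e / 2)"
    using \<delta> e by (intro tendstoD) auto
  then show "\<forall>\<^sub>F x in at_top. dist (f x) 0 < e"
    using eventually_ge_at_top[of X]
  proof eventually_elim
    case (elim x)
    have "\<exists>s>x. s < x + \<delta> \<and> F (x + \<delta>) - F x = (x + \<delta> - x) * f s"
      by (rule MVT2) (use \<delta> elim F in auto)
    then obtain s where s: "x < s" "s < x + \<delta>" "F (x + \<delta>) - F x = \<delta> * f s" by auto
    have "\<delta> * \<bar>f s\<bar> < \<delta> * (e / 2)"
      using elim(1) s(3) \<delta>(1) by (simp add: dist_real_def add.commute abs_mult)
    then have "\<bar>f s\<bar> < e / 2" using \<delta>(1) by simp
    moreover have "\<exists>t>x. t < s \<and> f s - f x = (s - x) * g t"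
      by (rule MVT2) (use s elim f in auto)
    then obtain t where t: "t > x" "f s - f x = (s - x) * g t" by blast
    have "\<bar>f s - f x\<bar> \<le> \<delta> * M"
      unfolding t(2) abs_mult using s t elim g[of t] \<delta> by (intro mult_mono) auto
    ultimately show ?case using \<delta>(2) by (simp add: dist_real_def mult.commute)
  qed
qed

lemma monotone_bounded_convergent_at_top:
  fixes E E' :: "real \<Rightarrow> real"
  assumes dE: "\<And>x. x \<ge> X \<Longrightarrow> (E has_real_derivative E' x) (at x)"
    and E': "\<And>x. x \<ge> X \<Longrightarrow> E' x \<ge> 0" and B: "\<And>x. x \<ge> X \<Longrightarrow> E x \<le> B"
  shows "\<exists>l. (E \<longlongrightarrow> l) at_top"
proof
  have bdd: "bdd_above (E ` {X..})" by (rule bdd_aboveI[of _ B]) (use B in auto)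
  have mono: "E x \<le> E z" if "X \<le> x" "x \<le> z" for x z
    using that(2) by (rule DERIV_nonneg_imp_nondecreasing) (use dE E' that in \<open>meson order_trans\<close>)
  show "(E \<longlongrightarrow> Sup (E ` {X..})) at_top"
  proof (rule increasing_tendsto)
    show "\<forall>\<^sub>F x in at_top. E x \<le> Sup (E ` {X..})"
      using eventually_ge_at_top[of X] by eventually_elim (auto intro: cSup_upper bdd)
    fix a assume "a < Sup (E ` {X..})"
    then obtain x where x: "x \<ge> X" "a < E x"
      using less_cSupD[of "E ` {X..}" a] by auto
    show "\<forall>\<^sub>F z in at_top. a < E z"
      using eventually_ge_at_top[of x] by eventually_elim (use x mono in force)
  qed
qed

text \<open>For either sign of a the energy is monotone, and being bounded it converges. Barbalat's
  lemma for \<open>E\<close> gives w1 \<rightarrow> 0; applied once more, to \<open>w1\<close>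
  itself, it gives - a w1 - q \<rightarrow> 0 and hence q \<rightarrow> 0. Both signs occur: the
  damping is negative for subcritical powers.\<close>

lemma damped_convergence:
  fixes w1 q q1 E :: "real \<Rightarrow> real"
  assumes w1: "\<And>x. x \<ge> X \<Longrightarrow> (w1 has_real_derivative (- a * w1 x - q x)) (at x)"
    and q: "\<And>x. x \<ge> X \<Longrightarrow> (q has_real_derivative q1 x) (at x)"
    and E: "\<And>x. x \<ge> X \<Longrightarrow> (E has_real_derivative (- a * (w1 x)\<^sup>2)) (at x)"
    and a: "a \<noteq> 0"
    and B: "\<And>x. x \<ge> X \<Longrightarrow> \<bar>w1 x\<bar> \<le> B" "\<And>x. x \<ge> X \<Longrightarrow> \<bar>q x\<bar> \<le> B"
      "\<And>x. x \<ge> X \<Longrightarrow> \<bar>q1 x\<bar> \<le> B" "\<And>x. x \<ge> X \<Longrightarrow> \<bar>E x\<bar> \<le> B"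
  shows "(w1 \<longlongrightarrow> 0) at_top" "(q \<longlongrightarrow> 0) at_top"
proof -
  have "\<exists>l. (E \<longlongrightarrow> l) at_top"
  proof (cases "a \<le> 0")
    case True
    then show ?thesis
      using B(4) by (intro monotone_bounded_convergent_at_top[OF E]) (auto simp: abs_le_iff mult_nonpos_nonneg)
  next
    case False
    have "\<exists>l. ((\<lambda>x. - E x) \<longlongrightarrow> l) at_top"
      by (rule monotone_bounded_convergent_at_top[OF DERIV_minus[OF E]])
         (use B(4) False in \<open>auto simp: abs_le_iff\<close>)
    then obtain l where "((\<lambda>x. - E x) \<longlongrightarrow> l) at_top" by blast
    from tendsto_minus[OF this] show ?thesis by auto
  qed
  then obtain l where l: "(E \<longlongrightarrow> l) at_top" by blast
  have B0: "B \<ge> 0" using B(1)[of X] by simp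
  have r: "\<bar>- a * w1 x - q x\<bar> \<le> \<bar>a\<bar> * B + B" if "x \<ge> X" for x
  proof -
    have "\<bar>- a * w1 x - q x\<bar> \<le> \<bar>a\<bar> * \<bar>w1 x\<bar> + \<bar>q x\<bar>"
      using abs_triangle_ineq4[of "- a * w1 x" "q x"] by (simp add: abs_mult)
    also have "\<dots> \<le> \<bar>a\<bar> * B + B" using B[OF that] by (intro add_mono mult_left_mono) auto
    finally show ?thesis .
  qed
  have "((\<lambda>x. - a * (w1 x)\<^sup>2) \<longlongrightarrow> 0) at_top"
  proof (rule barbalat[OF E _ _ l])
    fix x assume x: "x \<ge> X"
    show "((\<lambda>x. - a * (w1 x)\<^sup>2) has_real_derivative (- a * (2 * w1 x * (- a * w1 x - q x)))) (at x)"
      by (rule derivative_eq_intros w1[OF x] refl)+ (simp add: algebra_simps)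
    have "\<bar>a\<bar> * (2 * \<bar>w1 x\<bar> * \<bar>- a * w1 x - q x\<bar>) \<le> \<bar>a\<bar> * (2 * B * (\<bar>a\<bar> * B + B))"
      using B(1)[OF x] r[OF x] B0 by (intro mult_left_mono mult_mono) auto
    then show "\<bar>- a * (2 * w1 x * (- a * w1 x - q x))\<bar> \<le> \<bar>a\<bar> * (2 * B * (\<bar>a\<bar> * B + B))"
      by (simp only: abs_mult abs_minus_cancel abs_numeral)
  qed
  from tendsto_mult_left[OF this, of "- 1 / a"] have "((\<lambda>x. (w1 x)\<^sup>2) \<longlongrightarrow> 0) at_top"
    using a by simp
  from tendsto_real_sqrt[OF this] show w10: "(w1 \<longlongrightarrow> 0) at_top"
    by (simp add: tendsto_rabs_zero_iff)
  have "((\<lambda>x. - a * w1 x - q x) \<longlongrightarrow> 0) at_top"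
  proof (rule barbalat[OF w1 _ _ w10])
    fix x assume x: "x \<ge> X"
    show "((\<lambda>x. - a * w1 x - q x) has_real_derivative (- a * (- a * w1 x - q x) - q1 x)) (at x)"
      by (intro DERIV_diff DERIV_cmult w1[OF x] q[OF x])
    have "\<bar>- a * (- a * w1 x - q x) - q1 x\<bar> \<le> \<bar>a\<bar> * \<bar>- a * w1 x - q x\<bar> + \<bar>q1 x\<bar>"
      using abs_triangle_ineq4[of "- a * (- a * w1 x - q x)" "q1 x"] by (simp only: abs_mult abs_minus_cancel)
    also have "\<dots> \<le> \<bar>a\<bar> * (\<bar>a\<bar> * B + B) + B"
      using r[OF x] B(3)[OF x] by (intro add_mono mult_left_mono) auto
    finally show "\<bar>- a * (- a * w1 x - q x) - q1 x\<bar> \<le> \<bar>a\<bar> * (\<bar>a\<bar> * B + B) + B" .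
  qed
  from tendsto_diff[OF tendsto_mult_left[OF w10, of "- a"] this] show "(q \<longlongrightarrow> 0) at_top" by simp
qed

section \<open>Power nonlinearities\<close>

lemma exp_powr_mult_exp: "exp (c * x) powr s = exp (c * s * x)" for c x s :: real
  by (simp add: powr_def mult_ac)

section \<open>Scaling and the autonomous form of the power equation\<close>

locale power_nonlinearity =
  fixes k p :: real
  assumes k: "k > 0" and p_gt: "p_s k < p"
begin

text \<open>The scaling exponent: along with y, also exp (m c) y (x + c) solves the
  equation.\<close>

definition m :: real where "m = k / (p - 1)"
text \<open>A positive constant W solves the autonomous equation iff W^(p - 1) = \<mu>. Such a
  constant exists because p > p_s gives m < 1.\<close>

definition \<mu> :: real where "\<mu> = m * (1 - m)"

lemma p_gt_1: "p > 1" using k p_gt unfolding p_s_def by simp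

lemma m_mult: "m * (p - 1) = k" using p_gt_1 unfolding m_def by simp

lemma m_pos: "m > 0" using k p_gt_1 unfolding m_def by simp

lemma m_less_1: "m < 1" using p_gt p_gt_1 unfolding m_def p_s_def by (simp add: field_simps)

lemma \<mu>_pos: "\<mu> > 0" unfolding \<mu>_def using m_pos m_less_1 by simp

lemma p_c_le_iff: "p_c k \<le> p \<longleftrightarrow> m \<le> 1 / 2"
  using p_gt_1 unfolding m_def p_c_def by (simp add: field_simps)

lemma p_c_less_iff: "p_c k < p \<longleftrightarrow> m < 1 / 2"
  using p_gt_1 unfolding m_def p_c_def by (simp add: field_simps)

lemma f_pow_isCont: "isCont (f_pow p) x"
  using loc_lip_f_pow[of p] p_gt_1 by (intro loc_lip_isCont) simp

lemma f_pow_nonneg: "f_pow p x \<ge> 0" unfolding f_pow_def by simp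

text \<open>
  \<open>W = exp (m x) y\<close> turns the equation into the autonomous one \<open>W'' + (1 - 2 m) W' + q = 0\<close>, with energy
  \<open>En\<close> and derivative \<open>W1\<close>.
\<close>

definition W :: "(real \<Rightarrow> real) \<Rightarrow> real \<Rightarrow> real" where "W y x = exp (m * x) * y x"

definition W1 :: "(real \<Rightarrow> real) \<Rightarrow> (real \<Rightarrow> real) \<Rightarrow> real \<Rightarrow> real" where
  "W1 y y' x = exp (m * x) * (y' x + m * y x)"

definition q :: "(real \<Rightarrow> real) \<Rightarrow> real \<Rightarrow> real" where "q y x = W y x powr p - \<mu> * W y x"

definition En :: "(real \<Rightarrow> real) \<Rightarrow> (real \<Rightarrow> real) \<Rightarrow> real \<Rightarrow> real" where
  "En y y' x = (W1 y y' x)\<^sup>2 / 2 - \<mu> * (W y x)\<^sup>2 / 2 + W y x powr (p + 1) / (p + 1)"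

lemma W_powr:
  assumes "y x > 0"
  shows "W y x powr p = exp (m * x) * (exp (k * x) * f_pow p (y x))"
    and "W y x powr (p - 1) = exp (k * x) * y x powr (p - 1)"
proof -
  have "exp (m * x) powr p = exp (m * x) * exp (k * x)"
    unfolding exp_powr_mult_exp using m_mult by (simp add: algebra_simps flip: exp_add)
  then show "W y x powr p = exp (m * x) * (exp (k * x) * f_pow p (y x))"
    using assms unfolding W_def f_pow_def by (simp add: powr_mult)
  show "W y x powr (p - 1) = exp (k * x) * y x powr (p - 1)"
    using assms m_mult unfolding W_def by (simp add: powr_mult exp_powr_mult_exp)
qed

text \<open>The rules are pointwise, so they also serve solutions known only on a half-line.
  Positivity of y lets \<open>powr\<close> stand for the nonlinearity and be differentiated.\<close>

context
  fixes y y' :: "real \<Rightarrow> real" and x :: real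
  assumes dy: "(y has_real_derivative y' x) (at x)"
    and dy': "(y' has_real_derivative (- y' x - exp (k * x) * f_pow p (y x))) (at x)"
    and pos: "y x > 0"
begin

lemma W_pos: "W y x > 0" unfolding W_def using pos by simp

lemma W_deriv: "(W y has_real_derivative W1 y y' x) (at x)"
  unfolding W_def W1_def by (rule derivative_eq_intros dy refl)+ (simp add: algebra_simps)

lemma W1_deriv: "(W1 y y' has_real_derivative (- (1 - 2 * m) * W1 y y' x - q y x)) (at x)"
proof -
  have "(W1 y y' has_real_derivative exp (m * x) * (- y' x - exp (k * x) * f_pow p (y x) + m * y' x)
      + exp (m * x) * m * (y' x + m * y x)) (at x)"
    unfolding W1_def by (rule derivative_eq_intros dy dy' refl)+ (simp add: algebra_simps)
  moreover have "exp (m * x) * (- y' x - exp (k * x) * f_pow p (y x) + m * y' x)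
      + exp (m * x) * m * (y' x + m * y x) = - (1 - 2 * m) * W1 y y' x - q y x"
    unfolding W1_def q_def W_powr(1)[of y, OF pos] unfolding W_def \<mu>_def by (simp add: algebra_simps)
  ultimately show ?thesis by simp
qed

lemma W_powr_deriv: "((\<lambda>x. W y x powr s) has_real_derivative (s * W y x powr (s - 1) * W1 y y' x)) (at x)"
  by (rule DERIV_chain2[OF has_real_derivative_powr[OF W_pos] W_deriv])

lemma q_deriv: "(q y has_real_derivative (p * W y x powr (p - 1) * W1 y y' x - \<mu> * W1 y y' x)) (at x)"
  unfolding q_def by (intro DERIV_diff DERIV_cmult W_powr_deriv W_deriv)

lemma En_deriv: "(En y y' has_real_derivative (- (1 - 2 * m) * (W1 y y' x)\<^sup>2)) (at x)"
proof -
  have "(En y y' has_real_derivative (W1 y y' x * (- (1 - 2 * m) * W1 y y' x - q y x)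
      - \<mu> * W y x * W1 y y' x + (p + 1) * W y x powr (p + 1 - 1) * W1 y y' x / (p + 1))) (at x)"
  proof -
    have 1: "((\<lambda>x. (W1 y y' x)\<^sup>2 / 2) has_real_derivative (W1 y y' x * (- (1 - 2 * m) * W1 y y' x - q y x))) (at x)"
      using DERIV_cdivide[OF DERIV_power[OF W1_deriv, of 2], of 2] by (simp add: mult.commute)
    have 2: "((\<lambda>x. \<mu> * (W y x)\<^sup>2 / 2) has_real_derivative (\<mu> * W y x * W1 y y' x)) (at x)"
      using DERIV_cdivide[OF DERIV_cmult[OF DERIV_power[OF W_deriv, of 2], of \<mu>], of 2] by (simp add: mult_ac)
    show ?thesis
      unfolding En_def by (intro DERIV_add DERIV_diff 1 2 DERIV_cdivide W_powr_deriv)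
  qed
  moreover have "W1 y y' x * (- (1 - 2 * m) * W1 y y' x - q y x)
      - \<mu> * W y x * W1 y y' x + (p + 1) * W y x powr (p + 1 - 1) * W1 y y' x / (p + 1)
      = - (1 - 2 * m) * (W1 y y' x)\<^sup>2"
  proof -
    have "(p + 1) * W y x powr (p + 1 - 1) * W1 y y' x / (p + 1) = W y x powr p * W1 y y' x"
      using p_gt_1 by simp
    then show ?thesis unfolding q_def by (simp add: algebra_simps power2_eq_square)
  qed
  ultimately show ?thesis by simp
qed

end

section \<open>Energy near the centre and its consequences\<close>

lemma W_tendsto_0:
  assumes "log_sol k (f_pow p) \<beta> T y y'"
  shows "(W y \<longlongrightarrow> 0) at_bot" "(W1 y y' \<longlongrightarrow> 0) at_bot"
proof -
  note e = exp_mult_tendsto_0_at_bot[OF m_pos]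
  note y = log_sol_tendsto[OF assms]
  show "(W y \<longlongrightarrow> 0) at_bot" unfolding W_def using tendsto_mult[OF e y] by simp
  have "((\<lambda>x. exp (m * x) * (y' x + m * y x)) \<longlongrightarrow> 0 * (0 + m * \<beta>)) at_bot"
    by (intro tendsto_intros e y log_sol_deriv_tendsto_0[OF assms f_pow_isCont k])
  then show "(W1 y y' \<longlongrightarrow> 0) at_bot" unfolding W1_def by simp
qed

text \<open>Regular solutions leave the equilibrium 0, so the energy starts at 0, and its sign while
  y is positive is decided by the sign of the damping.\<close>

lemma En_tendsto_0:
  assumes sol: "log_sol k (f_pow p) \<beta> T y y'" and \<beta>: "\<beta> > 0"
  shows "(En y y' \<longlongrightarrow> 0) at_bot"
proof -
  have "\<forall>\<^sub>F x in at_bot. y x > 0" using order_tendstoD(1)[OF log_sol_tendsto[OF sol] \<beta>] .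
  then have ev: "\<forall>\<^sub>F x in at_bot. W y x \<ge> 0" by eventually_elim (simp add: W_def)
  then have wp: "((\<lambda>x. W y x powr (p + 1)) \<longlongrightarrow> 0 powr (p + 1)) at_bot"
    using p_gt_1 by (intro tendsto_powr' W_tendsto_0[OF sol] tendsto_const) auto
  have "((\<lambda>x. (W1 y y' x)\<^sup>2 / 2 - \<mu> * (W y x)\<^sup>2 / 2) \<longlongrightarrow> 0\<^sup>2 / 2 - \<mu> * 0\<^sup>2 / 2) at_bot"
    by (intro tendsto_intros W_tendsto_0[OF sol]) auto
  from tendsto_add[OF this tendsto_divide[OF wp tendsto_const[of "p + 1"]]] p_gt_1
  have "((\<lambda>x. (W1 y y' x)\<^sup>2 / 2 - \<mu> * (W y x)\<^sup>2 / 2 + W y x powr (p + 1) / (p + 1)) \<longlongrightarrow> 0) at_bot"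
    by simp
  then show ?thesis unfolding En_def by simp
qed

text \<open>Makes the energy strictly monotone near the centre, and hence nonzero there, whenever
  the damping is nonzero.\<close>

lemma W1_pos_near_bot:
  assumes sol: "log_sol k (f_pow p) \<beta> T y y'" and \<beta>: "\<beta> > 0"
  shows "\<forall>\<^sub>F x in at_bot. y x > 0 \<and> W1 y y' x > 0"
proof -
  have "((\<lambda>x. y' x + m * y x) \<longlongrightarrow> 0 + m * \<beta>) at_bot"
    by (intro tendsto_intros log_sol_tendsto[OF sol] log_sol_deriv_tendsto_0[OF sol f_pow_isCont k])
  then have "\<forall>\<^sub>F x in at_bot. y' x + m * y x > 0"
    by (rule order_tendstoD) (use m_pos \<beta> in simp)
  with order_tendstoD(1)[OF log_sol_tendsto[OF sol] \<beta>] show ?thesis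
    by eventually_elim (simp add: W1_def)
qed

lemma En_deriv_log_sol:
  assumes "log_sol k (f_pow p) \<beta> T y y'" "T < exp (- x)" "y x > 0"
  shows "(En y y' has_real_derivative (- (1 - 2 * m) * (W1 y y' x)\<^sup>2)) (at x)"
  by (rule En_deriv[OF log_sol_deriv[OF assms(1,2)] log_sol_deriv2[OF assms(1,2)] assms(3)])

text \<open>For p \<ge> p_c the energy starts at 0 and does not increase while y > 0. At a first
  zero of y only the kinetic term would remain, and it would be positive because y' < 0.\<close>

lemma log_sol_positive:
  assumes sol: "log_sol k (f_pow p) \<beta> T y y'" and \<beta>: "\<beta> > 0" and pc: "p \<ge> p_c k" and x: "T < exp (- x)"
  shows "y x > 0"
proof (rule ccontr)
  assume neg: "\<not> y x > 0"
  note dom = less_exp_minus_downward[OF x]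
  have f\<beta>: "f_pow p \<beta> > 0" using \<beta> by (simp add: f_pow_def)
  have y'_neg: "y' z < 0" if "z \<le> x" for z
    by (rule log_sol_deriv_neg[OF sol f_pow_isCont f_pow_nonneg f\<beta> k dom[OF that]])
  obtain X where X: "\<And>z. z \<le> X \<Longrightarrow> y z > 0"
    using order_tendstoD(1)[OF log_sol_tendsto[OF sol] \<beta>] by (auto simp: eventually_at_bot_linorder)
  have "X < x" using X[of x] neg by force
  then have "\<exists>z\<ge>X. z \<le> x \<and> y z = 0"
    using X[of X] neg DERIV_isCont[OF log_sol_deriv[OF sol dom]] by (intro IVT2) auto
  then obtain x1 where x1: "x1 \<le> x" "y x1 = 0" by blast
  have pos: "y z > 0" if "z < x1" for z
  proof -
    have "y x1 < y z"
      using that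
    proof (rule DERIV_neg_imp_decreasing)
      show "\<exists>d. (y has_real_derivative d) (at s) \<and> d < 0" if "s \<le> x1" for s
        using log_sol_deriv[OF sol dom] y'_neg x1(1) that by (meson order_trans)
    qed
    then show ?thesis using x1 by simp
  qed
  have a: "1 - 2 * m \<ge> 0" using pc p_c_le_iff by simp
  \<comment> \<open>Dropping the nonnegative power term leaves a quantity that passes to the zero x1
    by continuity.\<close>
  have le: "(W1 y y' z)\<^sup>2 - \<mu> * (W y z)\<^sup>2 \<le> 0" if z: "z < x1" for z
  proof -
    have "En y y' z \<le> 0"
    proof (rule deriv_nonpos_le_limit_at_bot[OF En_tendsto_0[OF sol \<beta>], 
          where P' = "\<lambda>x. - (1 - 2 * m) * (W1 y y' x)\<^sup>2"])
      show "(En y y' has_real_derivative - (1 - 2 * m) * (W1 y y' s)\<^sup>2) (at s)" if "s \<le> z" for s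
        by (rule En_deriv_log_sol[OF sol dom pos]) (use that z x1 in auto)
      show "- (1 - 2 * m) * (W1 y y' s)\<^sup>2 \<le> 0" for s using a by (simp add: mult_nonpos_nonneg)
    qed
    moreover have "W y z powr (p + 1) / (p + 1) \<ge> 0" using p_gt_1 by simp
    ultimately show ?thesis unfolding En_def by simp
  qed
  have c: "isCont y x1" "isCont y' x1"
    using DERIV_isCont[OF log_sol_deriv[OF sol dom[OF x1(1)]]] DERIV_isCont[OF log_sol_deriv2[OF sol dom[OF x1(1)]]] .
  have "isCont (\<lambda>z. (W1 y y' z)\<^sup>2 - \<mu> * (W y z)\<^sup>2) x1"
    unfolding W1_def W_def by (intro continuous_intros c)
  then have "((\<lambda>z. (W1 y y' z)\<^sup>2 - \<mu> * (W y z)\<^sup>2) \<longlongrightarrow> (W1 y y' x1)\<^sup>2 - \<mu> * (W y x1)\<^sup>2) (at_left x1)"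
    by (simp add: isCont_def filterlim_at_split)
  then have "(W1 y y' x1)\<^sup>2 - \<mu> * (W y x1)\<^sup>2 \<le> 0"
  proof (rule tendsto_upperbound)
    show "\<forall>\<^sub>F z in at_left x1. (W1 y y' z)\<^sup>2 - \<mu> * (W y z)\<^sup>2 \<le> 0"
      unfolding eventually_at_filter by (intro always_eventually allI impI le) simp
  qed (rule trivial_limit_at_left_real)
  then have "W1 y y' x1 = 0" unfolding W_def x1(2) by simp
  then show False unfolding W1_def x1(2) using y'_neg[OF x1(1)] by simp
qed

text \<open>
  The first bound is concavity of \<open>y\<close> in the variable \<open>exp (- x)\<close>; the second one follows from it and the
  integrated equation, as \<open>y\<close> is decreasing.
\<close>

lemma positive_solution_bounds:
  assumes sol: "log_sol k (f_pow p) \<beta> 0 y y'" and pos: "\<And>x. y x > 0"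
  shows "- y' x \<le> y x" "W y x powr (p - 1) \<le> 1 + k"
proof -
  note f = f_pow_isCont f_pow_nonneg
  have dy: "(y has_real_derivative y' x) (at x)" for x by (rule log_sol_deriv[OF sol]) simp
  have dy': "(y' has_real_derivative (- y' x - exp (k * x) * f_pow p (y x))) (at x)" for x
    by (rule log_sol_deriv2[OF sol]) simp
  show *: "- y' x \<le> y x" for x
  proof (rule ccontr)
    assume "\<not> - y' x \<le> y x"
    \<comment> \<open>y + y' is the intercept of the tangent line in the variable exp (- x). It
      never increases, so it stays at most - c; then exp z y z decreases at least like - c exp z and
      becomes negative.\<close>
    define c where "c = - (y x + y' x)"
    have c: "c > 0" unfolding c_def using \<open>\<not> - y' x \<le> y x\<close> by simp
    have dec: "y z + y' z \<le> y x + y' x" if "x \<le> z" for z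
      using that
    proof (rule DERIV_nonpos_imp_nonincreasing[where f = "\<lambda>z. y z + y' z"])
      show "\<exists>d. ((\<lambda>z. y z + y' z) has_real_derivative d) (at s) \<and> d \<le> 0" for s
        using DERIV_add[OF dy dy', of s] f_pow_nonneg[of "y s"] by (intro exI conjI) auto
    qed
    define G where "G z = exp z * y z + c * exp z" for z
    have G: "G z \<le> G x" if "x \<le> z" for z
      using that
    proof (rule DERIV_nonpos_imp_nonincreasing)
      fix s assume s: "x \<le> s"
      have "(G has_real_derivative (exp s * (y s + y' s + c))) (at s)"
        unfolding G_def by (rule derivative_eq_intros dy refl)+ (simp add: algebra_simps)
      moreover have "exp s * (y s + y' s + c) \<le> 0"
        using dec[OF s] unfolding c_def by (intro mult_nonneg_nonpos) auto
      ultimately show "\<exists>d. (G has_real_derivative d) (at s) \<and> d \<le> 0" by blast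
    qed
    have "filterlim (\<lambda>z. c * exp z) at_top at_top"
      by (rule filterlim_tendsto_pos_mult_at_top[OF tendsto_const c exp_at_top])
    then have "\<forall>\<^sub>F z in at_top. c * exp z > G x" by (simp add: filterlim_at_top_dense)
    then have "\<forall>\<^sub>F z in at_top. c * exp z > G x \<and> z \<ge> x"
      using eventually_ge_at_top[of x] by eventually_elim simp
    then obtain z where "c * exp z > G x" "z \<ge> x"
      using eventually_happens'[OF trivial_limit_at_top_linorder] by blast
    moreover have "exp z * y z > 0" using pos by simp
    ultimately show False using G[of z] unfolding G_def by linarith
  qed
  \<comment> \<open>Since y decreases, the integrated equation gives - exp x y' x \<ge> f (y x) exp
    ((1 + k) x) / (1 + k).\<close>
  define c where "c = f_pow p (y x) / (1 + k)"
  have anti: "y x \<le> y z" if "z \<le> x" for z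
    by (rule log_sol_antimono[OF sol f k _ that]) simp
  have "exp x * y' x + c * exp ((1 + k) * x) \<le> 0"
  proof (rule deriv_nonpos_le_limit_at_bot[where P = "\<lambda>x. exp x * y' x + c * exp ((1 + k) * x)"
        and P' = "\<lambda>z. exp ((1 + k) * z) * (f_pow p (y x) - f_pow p (y z))"])
    have "((\<lambda>x. exp x * y' x + c * exp ((1 + k) * x)) \<longlongrightarrow> 0 + c * 0) at_bot"
      using k by (intro tendsto_intros exp_mult_tendsto_0_at_bot log_sol_momentum_tendsto_0[OF sol f(1) k]) simp
    then show "((\<lambda>x. exp x * y' x + c * exp ((1 + k) * x)) \<longlongrightarrow> 0) at_bot" by simp
    fix z assume z: "z \<le> x"
    have "((\<lambda>x. c * exp ((1 + k) * x)) has_real_derivative (f_pow p (y x) * exp ((1 + k) * z))) (at z)"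
      using k by (auto intro!: derivative_eq_intros simp: c_def)
    from DERIV_add[OF log_sol_momentum_deriv[OF sol] this]
    show "((\<lambda>x. exp x * y' x + c * exp ((1 + k) * x)) has_real_derivative
        exp ((1 + k) * z) * (f_pow p (y x) - f_pow p (y z))) (at z)"
      by (simp add: algebra_simps)
    have "f_pow p (y x) \<le> f_pow p (y z)"
      unfolding f_pow_def using anti[OF z] pos[of x] p_gt_1 by (intro powr_mono2) auto
    then show "exp ((1 + k) * z) * (f_pow p (y x) - f_pow p (y z)) \<le> 0"
      by (intro mult_nonneg_nonpos) auto
  qed
  then have "exp x * (c * exp (k * x)) \<le> exp x * (- y' x)"
    by (simp add: algebra_simps exp_add)
  then have "c * exp (k * x) \<le> - y' x" by (simp only: mult_le_cancel_left_pos exp_gt_zero)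
  also have "\<dots> \<le> y x" by (rule *)
  finally have "c * exp (k * x) \<le> y x" .
  moreover have "f_pow p (y x) = y x powr (p - 1) * y x"
    unfolding f_pow_def using pos[of x] by (simp add: powr_diff)
  ultimately have "(y x powr (p - 1) * exp (k * x)) * y x \<le> (1 + k) * y x"
    unfolding c_def using k by (simp add: field_simps)
  then have "y x powr (p - 1) * exp (k * x) \<le> 1 + k" using pos[of x] by simp
  then show "W y x powr (p - 1) \<le> 1 + k" using W_powr(2)[of y x, OF pos] by (simp add: mult.commute)
qed

lemma abs_q_le:
  assumes W: "0 < w" "w powr (p - 1) \<le> C" "w \<le> B" "C \<ge> 0"
  shows "\<bar>w powr p - \<mu> * w\<bar> \<le> B * (C + \<mu>)" "w powr (p + 1) \<le> B\<^sup>2 * C"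
proof -
  have eq: "w powr p = w * w powr (p - 1)" "w powr (p + 1) = (w * w) * w powr (p - 1)"
    using W(1) by (simp_all add: powr_diff powr_add)
  have "w * w powr (p - 1) \<le> B * C" "\<mu> * w \<le> B * \<mu>"
    using W \<mu>_pos by (auto intro!: mult_mono)
  moreover have "\<mu> * w \<ge> 0" "w powr p \<ge> 0" "B * \<mu> \<ge> 0" "B * C \<ge> 0" using W \<mu>_pos by auto
  ultimately show "\<bar>w powr p - \<mu> * w\<bar> \<le> B * (C + \<mu>)" unfolding eq(1) by (auto simp: algebra_simps abs_if)
  show "w powr (p + 1) \<le> B\<^sup>2 * C"
    unfolding eq(2) power2_eq_square using W by (intro mult_mono) auto
qed

text \<open>Bounds on W and W1 control every quantity in \<open>damped_convergence\<close>; m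
  \<noteq> 1 / 2 says that the damping does not vanish.\<close>

lemma damped_convergence_W:
  assumes sol: "log_sol k (f_pow p) \<beta> 0 y y'" and pos: "\<And>x. y x > 0" and m: "m \<noteq> 1 / 2"
    and C: "\<And>x. W y x powr (p - 1) \<le> C" and B: "\<And>x. W y x \<le> B" and B1: "\<And>x. \<bar>W1 y y' x\<bar> \<le> B1"
  shows "(W1 y y' \<longlongrightarrow> 0) at_top" "(q y \<longlongrightarrow> 0) at_top"
proof -
  have dy: "(y has_real_derivative y' x) (at x)" for x by (rule log_sol_deriv[OF sol]) simp
  have dy': "(y' has_real_derivative (- y' x - exp (k * x) * f_pow p (y x))) (at x)" for x
    by (rule log_sol_deriv2[OF sol]) simp
  have Wp: "W y x > 0" for x unfolding W_def using pos by simp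
  have C0: "C \<ge> 0" using C[of 0] powr_ge_zero[of "W y 0" "p - 1"] by linarith
  have B0: "B \<ge> 0" using B[of 0] Wp[of 0] by linarith
  have B10: "B1 \<ge> 0" using B1[of 0] by linarith
  note Wq = abs_q_le[OF Wp C B C0]
  define D where "D = max (max B1 (B * (C + \<mu>))) (max ((p * C + \<mu>) * B1) (B1\<^sup>2 + \<mu> * B\<^sup>2 + B\<^sup>2 * C))"
  have q1: "\<bar>p * W y x powr (p - 1) * W1 y y' x - \<mu> * W1 y y' x\<bar> \<le> (p * C + \<mu>) * B1" for x
  proof -
    have "\<bar>p * W y x powr (p - 1) - \<mu>\<bar> \<le> p * C + \<mu>"
    proof -
      have "p * W y x powr (p - 1) \<le> p * C" "p * W y x powr (p - 1) \<ge> 0"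
        using C[of x] p_gt_1 by simp_all
      then show ?thesis using \<mu>_pos by linarith
    qed
    then have "\<bar>p * W y x powr (p - 1) - \<mu>\<bar> * \<bar>W1 y y' x\<bar> \<le> (p * C + \<mu>) * B1"
      using B1[of x] C0 p_gt_1 \<mu>_pos by (intro mult_mono) auto
    then show ?thesis by (simp add: left_diff_distrib flip: abs_mult)
  qed
  have E: "\<bar>En y y' x\<bar> \<le> B1\<^sup>2 + \<mu> * B\<^sup>2 + B\<^sup>2 * C" for x
  proof -
    have "(W1 y y' x)\<^sup>2 \<le> B1\<^sup>2" using power_mono[OF B1[of x], of 2] by simp
    moreover have "\<mu> * (W y x)\<^sup>2 \<le> \<mu> * B\<^sup>2"
      using power_mono[OF B[of x], of 2] Wp[of x] \<mu>_pos by simp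
    moreover have "W y x powr (p + 1) / (p + 1) \<le> W y x powr (p + 1)"
      using p_gt_1 by (simp add: divide_le_eq mult_le_cancel_left1)
    moreover have "W y x powr (p + 1) / (p + 1) \<ge> 0" "(W1 y y' x)\<^sup>2 \<ge> 0" "\<mu> * (W y x)\<^sup>2 \<ge> 0" "B\<^sup>2 * C \<ge> 0"
      using p_gt_1 \<mu>_pos C0 by auto
    ultimately show ?thesis unfolding En_def abs_le_iff using Wq(2)[of x] by linarith
  qed
  have a: "1 - 2 * m \<noteq> 0" using m by simp
  note dc = damped_convergence[where X = 0 and B = D, OF W1_deriv[OF dy dy' pos] q_deriv[OF dy dy' pos]
      En_deriv[OF dy dy' pos] a]
  show "(W1 y y' \<longlongrightarrow> 0) at_top" "(q y \<longlongrightarrow> 0) at_top"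
    by (rule dc; use B1 Wq(1) q1 E in \<open>simp add: D_def q_def le_max_iff_disj\<close>)+
qed

text \<open>For p < p_c the energy increases from 0 and so stays above a positive level. But a
  positive entire solution is bounded in the variable W, so W1 and q tend to 0, and there the energy
  has no positive limit.\<close>

lemma no_positive_entire_solution:
  assumes sol: "log_sol k (f_pow p) \<beta> 0 y y'" and \<beta>: "\<beta> > 0" and pos: "\<And>x. y x > 0" and pc: "p < p_c k"
  shows False
proof -
  have m: "m > 1 / 2" using pc p_c_le_iff by force
  note bd = positive_solution_bounds[OF sol pos]
  have Wp: "W y x > 0" for x unfolding W_def using pos by simp
  define B where "B = (1 + k) powr (1 / (p - 1))"
  have WB: "W y x \<le> B" for x
  proof -
    have "(W y x powr (p - 1)) powr (1 / (p - 1)) \<le> (1 + k) powr (1 / (p - 1))"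
      using bd(2) p_gt_1 k by (intro powr_mono2) auto
    then show ?thesis unfolding B_def using Wp[of x] p_gt_1 by (simp add: powr_powr)
  qed
  have W1B: "\<bar>W1 y y' x\<bar> \<le> B" for x
  proof -
    have "y' x \<le> 0" by (rule log_sol_deriv_nonpos[OF sol f_pow_isCont f_pow_nonneg k]) simp
    \<comment> \<open>As y' lies between - y and 0 while 0 < m < 1, the sum y' + m y is at most y in
      absolute value.\<close>
    then have "y' x + m * y x \<le> y x" "- (y' x + m * y x) \<le> y x"
      using bd(1)[of x] mult_right_mono[of m 1 "y x"] mult_nonneg_nonneg[of m "y x"]
        pos[of x] m_pos m_less_1 by linarith+
    then have "exp (m * x) * \<bar>y' x + m * y x\<bar> \<le> exp (m * x) * y x" by (intro mult_left_mono) auto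
    then have "\<bar>W1 y y' x\<bar> \<le> W y x" unfolding W1_def W_def abs_mult by simp
    then show ?thesis using WB[of x] by simp
  qed
  have w1: "(W1 y y' \<longlongrightarrow> 0) at_top" and q0: "(q y \<longlongrightarrow> 0) at_top"
    using damped_convergence_W[OF sol pos _ bd(2) WB W1B] m by auto
  obtain X where X: "\<And>x. x \<le> X \<Longrightarrow> W1 y y' x > 0"
    using W1_pos_near_bot[OF sol \<beta>] by (auto simp: eventually_at_bot_linorder)
  have dE: "(En y y' has_real_derivative (- (1 - 2 * m) * (W1 y y' x)\<^sup>2)) (at x)" for x
    by (rule En_deriv_log_sol[OF sol _ pos]) simp
  have "En y y' X > 0"
  proof (rule deriv_pos_greater_limit_at_bot[OF En_tendsto_0[OF sol \<beta>] dE])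
    show "- (1 - 2 * m) * (W1 y y' z)\<^sup>2 > 0" if "z \<le> X" for z
      using X[OF that] m by simp
  qed
  have "((\<lambda>x. (W1 y y' x)\<^sup>2 / 2 + B * \<bar>q y x\<bar> / (p + 1)) \<longlongrightarrow> 0\<^sup>2 / 2 + B * \<bar>0\<bar> / (p + 1)) at_top"
    using p_gt_1 by (intro tendsto_intros w1 q0) auto
  then have "((\<lambda>x. (W1 y y' x)\<^sup>2 / 2 + B * \<bar>q y x\<bar> / (p + 1)) \<longlongrightarrow> 0) at_top" by simp
  moreover have "\<forall>\<^sub>F x in at_top. En y y' X \<le> (W1 y y' x)\<^sup>2 / 2 + B * \<bar>q y x\<bar> / (p + 1)"
    using eventually_ge_at_top[of X]
  proof eventually_elim
    case (elim x)
    have "En y y' X \<le> En y y' x"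
      using elim by (rule DERIV_nonneg_imp_nondecreasing) (use dE m in \<open>fastforce simp: mult_nonneg_nonneg\<close>)
    \<comment> \<open>Substituting W^(p + 1) = W q + \<mu> W^2 splits the energy into terms that
      vanish in the limit and a nonpositive rest.\<close>
    also have "En y y' x = (W1 y y' x)\<^sup>2 / 2 + W y x * q y x / (p + 1) - \<mu> * (W y x)\<^sup>2 * ((p - 1) / (2 * (p + 1)))"
    proof -
      have P: "W y x powr (p + 1) = W y x * q y x + \<mu> * (W y x)\<^sup>2"
        unfolding q_def using Wp[of x] by (simp add: powr_add algebra_simps power2_eq_square)
      have c: "(p - 1) / (2 * (p + 1)) = 1 / 2 - 1 / (p + 1)"
        using p_gt_1 by (simp add: field_simps)
      show ?thesis unfolding En_def P c by (simp add: algebra_simps add_divide_distrib)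
    qed
    also have "\<dots> \<le> (W1 y y' x)\<^sup>2 / 2 + W y x * q y x / (p + 1)"
      using \<mu>_pos p_gt_1 by simp
    also have "W y x * q y x \<le> B * \<bar>q y x\<bar>"
      using order_trans[OF mult_left_mono[OF abs_ge_self, of "W y x" "q y x"] mult_right_mono[OF WB]] Wp[of x]
      by simp
    finally show ?case using p_gt_1 by (simp add: divide_right_mono)
  qed
  ultimately have "En y y' X \<le> 0" by (intro tendsto_lowerbound) auto
  then show False using \<open>En y y' X > 0\<close> by simp
qed

text \<open>The energy is nonpositive, which bounds W from above, and it eventually stays below a
  negative level, which keeps W away from 0. Then q = W (W^(p - 1) - \<mu>) can tend to 0 only if
  W^(p - 1) tends to \<mu>.\<close>

lemma supercritical_convergence:
  assumes sol: "log_sol k (f_pow p) \<beta> 0 y y'" and \<beta>: "\<beta> > 0" and pc: "p > p_c k"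
  shows "((\<lambda>x. exp (k * x) * y x powr (p - 1)) \<longlongrightarrow> \<mu>) at_top"
proof -
  have m: "m < 1 / 2" using pc p_c_less_iff by simp
  have pos: "y x > 0" for x by (rule log_sol_positive[OF sol \<beta>]) (use pc in auto)
  have Wp: "W y x > 0" for x unfolding W_def using pos by simp
  have dE: "(En y y' has_real_derivative (- (1 - 2 * m) * (W1 y y' x)\<^sup>2)) (at x)" for x
    by (rule En_deriv_log_sol[OF sol _ pos]) simp
  have E_neg: "En y y' x < 0" if "x \<le> X" "\<And>x. x \<le> X \<Longrightarrow> W1 y y' x > 0" for x X
  proof (rule deriv_neg_less_limit_at_bot[OF En_tendsto_0[OF sol \<beta>] dE])
    show "- (1 - 2 * m) * (W1 y y' z)\<^sup>2 < 0" if "z \<le> x" for z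
      using that(1) \<open>x \<le> X\<close> \<open>\<And>x. x \<le> X \<Longrightarrow> W1 y y' x > 0\<close>[of z] m by (simp add: mult_neg_pos)
  qed
  obtain X where X: "\<And>x. x \<le> X \<Longrightarrow> W1 y y' x > 0"
    using W1_pos_near_bot[OF sol \<beta>] by (auto simp: eventually_at_bot_linorder)
  have EX: "En y y' X < 0" using E_neg X by blast
  have E_dec: "En y y' z \<le> En y y' x" if "x \<le> z" for x z
    using that by (rule DERIV_nonpos_imp_nonincreasing)
      (use dE m in \<open>fastforce simp: mult_nonpos_nonneg\<close>)
  have E_le: "En y y' x \<le> 0" for x
    using E_dec[of "min x X" x] E_neg[of "min x X" X] X by force
  have Wpp: "W y x powr (p + 1) = (W y x)\<^sup>2 * W y x powr (p - 1)" for x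
    using Wp[of x] by (simp add: powr_add powr_diff power2_eq_square)
  \<comment> \<open>Nonpositive energy implies W^(p + 1) / (p + 1) \<le> \<mu> W^2 / 2.\<close>
  define C where "C = \<mu> * (p + 1) / 2"
  have C: "W y x powr (p - 1) \<le> C" for x
  proof -
    have "(W y x)\<^sup>2 * W y x powr (p - 1) / (p + 1) \<le> \<mu> * (W y x)\<^sup>2 / 2"
      using E_le[of x] zero_le_power2[of "W1 y y' x"] unfolding En_def Wpp by linarith
    then have "(W y x)\<^sup>2 * (W y x powr (p - 1)) \<le> (W y x)\<^sup>2 * C"
      unfolding C_def using p_gt_1 by (simp add: field_simps)
    then show ?thesis using Wp[of x] by simp
  qed
  define B where "B = C powr (1 / (p - 1))"
  have WB: "W y x \<le> B" for x
  proof -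
    have "(W y x powr (p - 1)) powr (1 / (p - 1)) \<le> C powr (1 / (p - 1))"
      using C p_gt_1 by (intro powr_mono2) auto
    then show ?thesis unfolding B_def using Wp[of x] p_gt_1 by (simp add: powr_powr)
  qed
  have W1_sq: "(W1 y y' x)\<^sup>2 \<le> (sqrt \<mu> * B)\<^sup>2" for x
  proof -
    have "(W1 y y' x)\<^sup>2 \<le> \<mu> * (W y x)\<^sup>2"
    proof -
      have "W y x powr (p + 1) / (p + 1) \<ge> 0" using p_gt_1 by simp
      then show ?thesis using E_le[of x] unfolding En_def by linarith
    qed
    also have "\<dots> \<le> \<mu> * B\<^sup>2"
      using WB[of x] Wp[of x] \<mu>_pos by (intro mult_left_mono power_mono) auto
    finally show ?thesis using \<mu>_pos by (simp add: power_mult_distrib)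
  qed
  have W1B: "\<bar>W1 y y' x\<bar> \<le> sqrt \<mu> * B" for x
  proof -
    have "\<bar>W1 y y' x\<bar> \<le> \<bar>sqrt \<mu> * B\<bar>" using W1_sq by (simp only: abs_le_square_iff)
    moreover have "B \<ge> 0" unfolding B_def by simp
    ultimately show ?thesis using \<mu>_pos by simp
  qed
  have q0: "(q y \<longlongrightarrow> 0) at_top"
    using damped_convergence_W[OF sol pos _ C WB W1B] m by auto
  \<comment> \<open>From \<open>X\<close> on the energy is at most \<open>En y y' X\<close> < 0, and
    only the term - \<mu> W^2 / 2 can make it negative.\<close>
  define l where "l = sqrt (- 2 * En y y' X / \<mu>)"
  have l: "l > 0" unfolding l_def using EX \<mu>_pos by (simp add: divide_neg_pos mult_pos_neg)
  have Wl: "W y x \<ge> l" if "x \<ge> X" for x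
  proof -
    have "W y x powr (p + 1) / (p + 1) \<ge> 0" using p_gt_1 by simp
    then have "- \<mu> * (W y x)\<^sup>2 / 2 \<le> En y y' X"
      using E_dec[OF that] zero_le_power2[of "W1 y y' x"] unfolding En_def[of y y' x] by linarith
    then have "- 2 * En y y' X / \<mu> \<le> (W y x)\<^sup>2" using \<mu>_pos by (simp add: field_simps)
    then have "l \<le> sqrt ((W y x)\<^sup>2)" unfolding l_def by (rule real_sqrt_le_mono)
    then show ?thesis using Wp[of x] by simp
  qed
  have "((\<lambda>x. W y x powr (p - 1) - \<mu>) \<longlongrightarrow> 0) at_top"
  proof (rule Lim_null_comparison)
    have "((\<lambda>x. \<bar>q y x\<bar> / l) \<longlongrightarrow> \<bar>0\<bar> / l) at_top" using l by (intro tendsto_intros q0) auto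
    then show "((\<lambda>x. \<bar>q y x\<bar> / l) \<longlongrightarrow> 0) at_top" by simp
    show "\<forall>\<^sub>F x in at_top. norm (W y x powr (p - 1) - \<mu>) \<le> \<bar>q y x\<bar> / l"
      using eventually_ge_at_top[of X]
    proof eventually_elim
      case (elim x)
      have "q y x = W y x * (W y x powr (p - 1) - \<mu>)"
        unfolding q_def using Wp[of x] by (simp add: powr_diff field_simps)
      then have "\<bar>q y x\<bar> = W y x * \<bar>W y x powr (p - 1) - \<mu>\<bar>" using Wp[of x] by (simp add: abs_mult)
      also have "\<dots> \<ge> l * \<bar>W y x powr (p - 1) - \<mu>\<bar>" using Wl[OF elim] by (intro mult_right_mono) auto
      finally show ?case using l by (simp add: field_simps)
    qed
  qed
  then have "((\<lambda>x. W y x powr (p - 1)) \<longlongrightarrow> \<mu>) at_top" by (simp add: LIM_zero_iff)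
  then show ?thesis using W_powr(2)[of y, OF pos] by simp
qed

lemma f_pow_tangent_bounds:
  assumes "0 < a" "a \<le> b"
  shows "p * a powr (p - 1) * (b - a) \<le> f_pow p b - f_pow p a"
    and "f_pow p b - f_pow p a \<le> p * b powr (p - 1) * (b - a)"
  using powr_tangent_bounds[of a b p] assms p_gt_1 by (auto simp: f_pow_def)

lemma supercritical_crossing:
  assumes s1: "log_sol k (f_pow p) \<beta> 0 y1 y1'" "\<beta> > 0" and s2: "log_sol k (f_pow p) \<gamma> 0 y2 y2'" "\<gamma> > 0"
    and pc: "p > p_c k" and c: "p * \<mu> > 1 / 4"
  shows "\<exists>x>X. y1 x = y2 x"
proof (rule log_eq_sol_crossing[OF log_sol_imp_log_eq_sol[OF s1(1)] log_sol_imp_log_eq_sol[OF s2(1)]])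
  \<comment> \<open>Midway between 1 / 4 and p \<mu>. For both solutions exp (k x) y^(p - 1) tends
    to \<mu>, so the weighted difference quotient of the nonlinearity eventually exceeds d.\<close>
  define d where "d = (1 / 4 + p * \<mu>) / 2"
  show "d > 1 / 4" unfolding d_def using c by simp
  have d: "d / p < \<mu>" unfolding d_def using c p_gt_1 by (simp add: field_simps)
  have pos: "y1 x > 0" "y2 x > 0" for x
    using log_sol_positive[OF s1(1,2)] log_sol_positive[OF s2(1,2)] pc by auto
  from order_tendstoD(1)[OF supercritical_convergence[OF s1 pc] d]
    order_tendstoD(1)[OF supercritical_convergence[OF s2 pc] d]
  show "\<forall>\<^sub>F x in at_top. d * (y2 x - y1 x)\<^sup>2 \<le> (y2 x - y1 x) * (exp (k * x) * (f_pow p (y2 x) - f_pow p (y1 x)))"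
  proof eventually_elim
    case (elim x)
    have *: "d * (b - a)\<^sup>2 \<le> (b - a) * (exp (k * x) * (f_pow p b - f_pow p a))"
      if "0 < a" "a \<le> b" "d / p < exp (k * x) * a powr (p - 1)" for a b
    proof -
      have "d \<le> exp (k * x) * (p * a powr (p - 1))" using that(3) p_gt_1 by (simp add: field_simps)
      then have "d * (b - a) \<le> exp (k * x) * (p * a powr (p - 1)) * (b - a)"
        using that by (intro mult_right_mono) auto
      also have "\<dots> = exp (k * x) * (p * a powr (p - 1) * (b - a))" by (simp only: mult.assoc)
      also have "\<dots> \<le> exp (k * x) * (f_pow p b - f_pow p a)"
        using f_pow_tangent_bounds(1)[OF that(1,2)] by simp
      finally have "(b - a) * (d * (b - a)) \<le> (b - a) * (exp (k * x) * (f_pow p b - f_pow p a))"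
        using that by (intro mult_left_mono) auto
      then show ?thesis by (simp add: power2_eq_square mult_ac)
    qed
    show ?case
    proof (cases "y1 x \<le> y2 x")
      case True
      then show ?thesis using *[of "y1 x" "y2 x"] pos elim by simp
    next
      case False
      then have "d * (y1 x - y2 x)\<^sup>2 \<le> (y1 x - y2 x) * (exp (k * x) * (f_pow p (y1 x) - f_pow p (y2 x)))"
        using *[of "y2 x" "y1 x"] pos elim by simp
      then show ?thesis by (simp add: power2_commute algebra_simps)
    qed
  qed
qed

text \<open>The singular solution, an explicit solution of the same equation.\<close>

definition sing :: "real \<Rightarrow> real" where "sing x = \<mu> powr (1 / (p - 1)) * exp (- m * x)"

lemma sing_pos: "sing x > 0" unfolding sing_def using \<mu>_pos by simp

lemma sing_powr: "exp (k * x) * sing x powr (p - 1) = \<mu>"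
proof -
  have "sing x powr (p - 1) = \<mu> * exp (- m * (p - 1) * x)"
    unfolding sing_def using \<mu>_pos p_gt_1 exp_powr_mult_exp[of "- m" x "p - 1"]
    by (simp add: powr_mult powr_powr)
  then show ?thesis using m_mult by (simp flip: exp_add)
qed

lemma sing_log_eq_sol: "log_eq_sol k (f_pow p) sing (\<lambda>x. - m * sing x)"
  unfolding log_eq_sol_def
proof (intro allI conjI)
  fix x
  have d: "(sing has_real_derivative (- m * sing x)) (at x)" for x
    unfolding sing_def by (auto intro!: derivative_eq_intros)
  then show "(sing has_real_derivative (- m * sing x)) (at x)" .
  have "f_pow p (sing x) = sing x powr (p - 1) * sing x"
    using sing_pos[of x] unfolding f_pow_def by (simp add: powr_diff)
  then have "exp (k * x) * f_pow p (sing x) = \<mu> * sing x" using sing_powr[of x] by simp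
  then have "- (- m * sing x) - exp (k * x) * f_pow p (sing x) = - m * (- m * sing x)"
    unfolding \<mu>_def by (simp add: algebra_simps)
  moreover have "((\<lambda>x. - m * sing x) has_real_derivative (- m * (- m * sing x))) (at x)"
    by (intro DERIV_cmult d)
  ultimately show "((\<lambda>x. - m * sing x) has_real_derivative
      - (- m * sing x) - exp (k * x) * f_pow p (sing x)) (at x)" by simp
qed

lemma half_exp_tendsto_0:
  assumes "log_sol k (f_pow p) \<beta> T y y'"
  shows "((\<lambda>x. exp (x / 2) * y x) \<longlongrightarrow> 0) at_bot" "((\<lambda>x. exp (x / 2) * y' x) \<longlongrightarrow> 0) at_bot"
  using tendsto_mult[OF exp_mult_tendsto_0_at_bot[of "1 / 2"] log_sol_tendsto[OF assms]]
    tendsto_mult[OF exp_mult_tendsto_0_at_bot[of "1 / 2"] log_sol_deriv_tendsto_0[OF assms f_pow_isCont k]]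
  by simp_all

text \<open>The comparison lemma is used twice. First it puts y2 below the singular solution, along
  which the coefficient p exp (k x) y^(p - 1) is constantly p \<mu> \<le> 1 / 4. This bounds the
  coefficient at y2, which is what comparing y1 with y2 requires.\<close>

lemma supercritical_order:
  assumes s1: "log_sol k (f_pow p) \<beta> 0 y1 y1'" "\<beta> > 0" and s2: "log_sol k (f_pow p) \<gamma> 0 y2 y2'" "\<beta> < \<gamma>"
    and pc: "p > p_c k" and c: "p * \<mu> \<le> 1 / 4"
  shows "y1 x < y2 x"
proof -
  have m: "m < 1 / 2" using pc p_c_less_iff by simp
  have \<gamma>: "\<gamma> > 0" using s1 s2 by simp
  have pos: "y1 x > 0" "y2 x > 0" for x
    using log_sol_positive[OF s1(1,2)] log_sol_positive[OF s2(1) \<gamma>] pc by auto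
  have *: "exp (k * x) * (f_pow p b - f_pow p a) \<le> (b - a) / 4"
    if ab: "0 < a" "a < b" and b: "exp (k * x) * b powr (p - 1) \<le> \<mu>" for a b x
  proof -
    have "exp (k * x) * (f_pow p b - f_pow p a) \<le> exp (k * x) * (p * b powr (p - 1) * (b - a))"
      using f_pow_tangent_bounds(2)[of a b] ab by simp
    also have "\<dots> = p * (exp (k * x) * b powr (p - 1)) * (b - a)" by (simp only: mult_ac)
    also have "\<dots> \<le> p * \<mu> * (b - a)" using b ab p_gt_1 by (intro mult_right_mono mult_left_mono) auto
    also have "\<dots> \<le> 1 / 4 * (b - a)" using c ab by (intro mult_right_mono) auto
    finally show ?thesis by simp
  qed
  have below: "y2 x < sing x" for x
  proof (rule log_eq_sol_order[OF log_sol_imp_log_eq_sol[OF s2(1)] sing_log_eq_sol])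
    have "filterlim (\<lambda>x. - m * x) at_top at_bot"
      using filterlim_tendsto_pos_mult_at_bot[OF tendsto_const m_pos filterlim_ident]
      by (simp add: filterlim_uminus_at_top)
    then have "filterlim (\<lambda>x. exp (- m * x)) at_top at_bot"
      by (rule filterlim_compose[OF exp_at_top])
    then have "filterlim (\<lambda>x. sing x) at_top at_bot"
      unfolding sing_def using \<mu>_pos
      by (intro filterlim_tendsto_pos_mult_at_top[OF tendsto_const]) auto
    then have "\<forall>\<^sub>F x in at_bot. sing x > \<gamma>" by (simp add: filterlim_at_top_dense)
    then show "\<forall>\<^sub>F x in at_bot. y2 x < sing x"
    proof eventually_elim
      case (elim x)
      have "y2 x \<le> \<gamma>" by (rule log_sol_le[OF s2(1) f_pow_isCont f_pow_nonneg k]) simp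
      with elim show ?case by simp
    qed
    \<comment> \<open>Here p > p_c enters: the singular solution behaves like exp (- m x) at the
      centre, and exp (x / 2) beats it only if m < 1 / 2.\<close>
    have "((\<lambda>x. \<mu> powr (1 / (p - 1)) * exp ((1 / 2 - m) * x)) \<longlongrightarrow> \<mu> powr (1 / (p - 1)) * 0) at_bot"
      using m by (intro tendsto_intros exp_mult_tendsto_0_at_bot) simp
    moreover have "\<mu> powr (1 / (p - 1)) * exp ((1 / 2 - m) * x) = exp (x / 2) * sing x" for x
      unfolding sing_def by (simp add: algebra_simps flip: exp_add)
    ultimately have s0: "((\<lambda>x. exp (x / 2) * sing x) \<longlongrightarrow> 0) at_bot" by simp
    show "((\<lambda>x. exp (x / 2) * (sing x - y2 x)) \<longlongrightarrow> 0) at_bot"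
      using tendsto_diff[OF s0 half_exp_tendsto_0(1)[OF s2(1)]] by (simp add: right_diff_distrib)
    show "((\<lambda>x. exp (x / 2) * (- m * sing x - y2' x)) \<longlongrightarrow> 0) at_bot"
      using tendsto_diff[OF tendsto_mult_left[OF s0, of "- m"] half_exp_tendsto_0(2)[OF s2(1)]]
      by (simp add: right_diff_distrib mult_ac)
    show "exp (k * x) * (f_pow p (sing x) - f_pow p (y2 x)) \<le> (sing x - y2 x) / 4" if "y2 x < sing x" for x
      using *[OF pos(2) that] sing_powr[of x] by simp
  qed
  show ?thesis
  proof (rule log_eq_sol_order[OF log_sol_imp_log_eq_sol[OF s1(1)] log_sol_imp_log_eq_sol[OF s2(1)]])
    have "((\<lambda>x. y2 x - y1 x) \<longlongrightarrow> \<gamma> - \<beta>) at_bot"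
      by (intro tendsto_diff log_sol_tendsto[OF s1(1)] log_sol_tendsto[OF s2(1)])
    from order_tendstoD(1)[OF this, of 0] s2(2)
    show "\<forall>\<^sub>F x in at_bot. y1 x < y2 x" by (simp add: eventually_mono)
    show "((\<lambda>x. exp (x / 2) * (y2 x - y1 x)) \<longlongrightarrow> 0) at_bot"
      using tendsto_diff[OF half_exp_tendsto_0(1)[OF s2(1)] half_exp_tendsto_0(1)[OF s1(1)]]
      by (simp add: right_diff_distrib)
    show "((\<lambda>x. exp (x / 2) * (y2' x - y1' x)) \<longlongrightarrow> 0) at_bot"
      using tendsto_diff[OF half_exp_tendsto_0(2)[OF s2(1)] half_exp_tendsto_0(2)[OF s1(1)]]
      by (simp add: right_diff_distrib)
    fix x assume lt: "y1 x < y2 x"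
    have "exp (k * x) * y2 x powr (p - 1) \<le> exp (k * x) * sing x powr (p - 1)"
      using below[of x] pos(2)[of x] p_gt_1 by (intro mult_left_mono powr_mono2) auto
    then show "exp (k * x) * (f_pow p (y2 x) - f_pow p (y1 x)) \<le> (y2 x - y1 x) / 4"
      using *[OF pos(1) lt] sing_powr[of x] by simp
  qed
qed

text \<open>Ensures that p \<ge> p_JL excludes the borderline p = p_c. After squaring, s < 1 - k
  amounts to 4 k < 1.\<close>

lemma p_c_less_p_JL: "ereal (p_c k) < p_JL k"
proof (cases "k < 1 / 4")
  case True
  define s where "s = sqrt (k * (k + 2))"
  have "s < 1 - k"
    unfolding s_def using True k by (intro real_less_lsqrt) (auto simp: power2_eq_square algebra_simps)
  moreover have "s \<ge> 0" unfolding s_def using k by simp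
  ultimately have D: "0 < 1 - k - s" "1 - k - s < 1" using k by auto
  have "2 * k * 1 < 2 * k * (1 / (1 - k - s))"
    using k D by (intro mult_strict_left_mono) auto
  then show ?thesis using True by (simp add: p_c_def p_JL_def s_def)
qed (simp add: p_JL_def)

text \<open>With a = 1 - 2 m one has 1 - 4 p \<mu> = (a - k)^2 - k (k + 2). The factor a - k + s is
  positive, so the condition becomes a \<ge> k + s, which is the formula for \<open>p_JL\<close>
  solved for m. For k \<ge> 1 / 4 it fails since k + s \<ge> 1 > a, matching the value
  \<infinity>.\<close>

lemma p_JL_le_iff:
  assumes pc: "p_c k < p"
  shows "p_JL k \<le> ereal p \<longleftrightarrow> p * \<mu> \<le> 1 / 4"
proof -
  define a where "a = 1 - 2 * m"
  define s where "s = sqrt (k * (k + 2))"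
  have a: "a > 0" "a < 1" unfolding a_def using pc p_c_less_iff m_pos by auto
  have s: "s * s = k * (k + 2)" "s > k"
  proof -
    show "s * s = k * (k + 2)" unfolding s_def using k by simp
    have "sqrt (k * k) < s" unfolding s_def using k by (intro real_sqrt_less_mono) (simp add: algebra_simps)
    then show "s > k" using k by simp
  qed
  have "p * \<mu> = (p - 1) * m * (1 - m) + m * (1 - m)" unfolding \<mu>_def by (simp add: algebra_simps)
  also have "(p - 1) * m = k" using m_mult by (simp add: mult.commute)
  finally have "1 / 4 - p * \<mu> = ((a - k) * (a - k) - s * s) / 4"
    unfolding s(1) a_def by (simp add: algebra_simps)
  also have "\<dots> = (a - k - s) * (a - k + s) / 4" by (simp add: algebra_simps)
  finally have "p * \<mu> \<le> 1 / 4 \<longleftrightarrow> 0 \<le> (a - k - s) * (a - k + s)" by linarith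
  also have "\<dots> \<longleftrightarrow> a \<ge> k + s" using a s by (auto simp: zero_le_mult_iff)
  finally have 1: "p * \<mu> \<le> 1 / 4 \<longleftrightarrow> k + s \<le> a" .
  show ?thesis
  proof (cases "k < 1 / 4")
    case True
    have "s < 1 - k"
      unfolding s_def using True k by (intro real_less_lsqrt) (auto simp: power2_eq_square algebra_simps)
    then have D: "1 - k - s > 0" by simp
    have "p_JL k \<le> ereal p \<longleftrightarrow> 1 + 2 * k / (1 - k - s) \<le> p"
      unfolding p_JL_def s_def using True by simp
    also have "\<dots> \<longleftrightarrow> 2 * k \<le> (p - 1) * (1 - k - s)"
      using D by (simp add: field_simps)
    also have "\<dots> \<longleftrightarrow> (p - 1) * (2 * m) \<le> (p - 1) * (1 - k - s)"
    proof -
      have "(p - 1) * (2 * m) = 2 * (m * (p - 1))" by (simp only: mult_ac)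
      then show ?thesis unfolding m_mult by (simp only:)
    qed
    also have "\<dots> \<longleftrightarrow> 2 * m \<le> 1 - k - s" using p_gt_1 by simp
    also have "\<dots> \<longleftrightarrow> k + s \<le> a" unfolding a_def by auto
    finally show ?thesis using 1 by simp
  next
    case False
    have "sqrt ((3 / 4)\<^sup>2) \<le> s"
      unfolding s_def
    proof (rule real_sqrt_le_mono)
      have "1 / 4 * (1 / 4 + 2) \<le> k * (k + 2)" using False by (intro mult_mono) auto
      then show "(3 / 4)\<^sup>2 \<le> k * (k + 2)" by (simp add: power2_eq_square)
    qed
    then have "3 / 4 \<le> s" by simp
    then show ?thesis using 1 a False by (simp add: p_JL_def)
  qed
qed

end

section \<open>Exponential nonlinearity and the theorem\<close>

context power_nonlinearity
begin

text \<open>The truncated solution is entire and decreases from \<beta> < M, so it solves the true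
  equation as long as it stays above - M. Either it never reaches 0, or it passes a zero while the
  truncation is still inactive.\<close>

lemma positive_or_vanishing_solution:
  assumes \<beta>: "\<beta> > 0"
  obtains y y' where "log_sol k (f_pow p) \<beta> 0 y y'" "\<And>x. y x > 0"
  | y y' x1 x2 where "x1 < x2" "y x1 = 0" "log_sol k (f_pow p) \<beta> (exp (- x2)) y y'"
proof -
  define M where "M = \<beta> + 1"
  have M: "M > 0" unfolding M_def using \<beta> by simp
  have ll: "loc_lip (f_pow p)" using loc_lip_f_pow p_gt_1 by simp
  obtain L B where LB: "L-lipschitz_on UNIV (truncate M (f_pow p))" "\<And>v. \<bar>truncate M (f_pow p) v\<bar> \<le> B"
    using truncate_lipschitz_bounded[OF ll M] by blast
  obtain y y' where sol: "log_sol k (truncate M (f_pow p)) \<beta> 0 y y'"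
    using log_sol_exists[OF k LB] by blast
  have f: "isCont (truncate M (f_pow p)) \<beta>" "\<And>v. truncate M (f_pow p) v \<ge> 0"
    using lipschitz_on_continuous_on[OF LB(1)]
    by (simp_all add: continuous_on_eq_continuous_at) (simp add: truncate_def f_pow_nonneg)
  have y_le: "y x \<le> \<beta>" for x by (rule log_sol_le[OF sol f k]) simp
  have anti: "y x \<le> y z" if "z \<le> x" for x z by (rule log_sol_antimono[OF sol f k _ that]) simp
  have cont: "isCont y x" for x by (rule DERIV_isCont[OF log_sol_deriv[OF sol]]) simp
  have eq: "truncate M (f_pow p) (y x) = f_pow p (y x)" if "- M \<le> y x" for x
    by (rule truncate_eq) (use that y_le[of x] in \<open>simp add: M_def abs_le_iff\<close>)
  show ?thesis
  proof (cases "\<forall>x. y x > 0")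
    case True
    then have "log_sol k (f_pow p) \<beta> 0 y y'"
      using M by (intro log_sol_transfer[OF sol order.refl] eq) (meson less_imp_le less_trans neg_less_0_iff_less)
    with True show ?thesis using that(1) by blast
  next
    case False
    then obtain x where x: "y x \<le> 0" by (auto simp: not_less)
    obtain X where X: "\<And>z. z \<le> X \<Longrightarrow> y z > 0"
      using order_tendstoD(1)[OF log_sol_tendsto[OF sol] \<beta>] by (auto simp: eventually_at_bot_linorder)
    have "\<not> x \<le> X" using X[of x] x by auto
    then have "\<exists>z\<ge>X. z \<le> x \<and> y z = 0"
      using X[of X] x cont by (intro IVT2) auto
    then obtain x1 where x1: "y x1 = 0" by blast
    \<comment> \<open>By continuity y stays above - M a little beyond its zero, which leaves room
      for x2 > x1.\<close>
    have "(y \<longlongrightarrow> 0) (at_right x1)"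
      using cont[of x1] x1 by (simp add: isCont_def filterlim_at_split)
    then have "\<forall>\<^sub>F z in at_right x1. y z > - M" using M by (intro order_tendstoD) auto
    then obtain b where b: "b > x1" "\<And>z. x1 < z \<Longrightarrow> z < b \<Longrightarrow> y z > - M"
      by (auto simp: eventually_at_right_field)
    define x2 where "x2 = (x1 + b) / 2"
    have x2: "x1 < x2" "y x2 > - M" unfolding x2_def using b by auto
    have "log_sol k (f_pow p) \<beta> (exp (- x2)) y y'"
    proof (rule log_sol_transfer[OF sol])
      fix z assume "exp (- x2) < exp (- z)"
      then have "y x2 \<le> y z" by (intro anti) simp
      then show "truncate M (f_pow p) (y z) = f_pow p (y z)" using x2 by (intro eq) simp
    qed simp
    then show ?thesis using that(2) x2(1) x1 by blast
  qed
qed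

end

section \<open>The exponential nonlinearity\<close>

lemma log_sol_exp_exists:
  assumes k: "k > 0"
  shows "\<exists>y y'. log_sol k exp \<beta> 0 y y'"
proof -
  \<comment> \<open>A cap from above suffices to make \<open>exp\<close> bounded and Lipschitz.
    Solutions decrease from \<beta> and never feel it, so they are entire.\<close>
  define F where "F v = exp (min v \<beta>)" for v
  have "(exp \<beta>)-lipschitz_on UNIV F"
  proof (rule lipschitz_onI)
    fix a b :: real
    have "\<bar>F a - F b\<bar> \<le> exp (max (min a \<beta>) (min b \<beta>)) * \<bar>min a \<beta> - min b \<beta>\<bar>"
      unfolding F_def by (rule exp_lipschitz)
    also have "\<dots> \<le> exp \<beta> * \<bar>a - b\<bar>"
      by (intro mult_mono) (auto simp: min_def)
    finally show "dist (F a) (F b) \<le> exp \<beta> * dist a b" by (simp add: dist_real_def)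
  qed simp
  moreover have "\<bar>F v\<bar> \<le> exp \<beta>" for v unfolding F_def by simp
  ultimately obtain y y' where sol: "log_sol k F \<beta> 0 y y'" using log_sol_exists[OF k] by blast
  have "isCont F \<beta>" unfolding F_def by (intro continuous_intros)
  then have "y x \<le> \<beta>" for x using k by (intro log_sol_le[OF sol]) (auto simp: F_def)
  then have "log_sol k exp \<beta> 0 y y'"
    by (intro log_sol_transfer[OF sol]) (auto simp: F_def min_def)
  then show ?thesis by blast
qed

text \<open>w = y + k x satisfies the autonomous equation w'' + w' + exp w - k = 0, with damping 1
  and potential exp w - k w. This potential is bounded below and grows with exp w, so the decreasing
  energy bounds both w' and r = exp w.\<close>

lemma exp_solution_convergence:
  assumes sol: "log_sol k exp \<beta> 0 y y'" and k: "k > 0"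
  shows "((\<lambda>x. exp (k * x) * exp (y x)) \<longlongrightarrow> k) at_top"
proof -
  have dy: "(y has_real_derivative y' x) (at x)" for x by (rule log_sol_deriv[OF sol]) simp
  define r where "r x = exp (k * x) * exp (y x)" for x
  have dy': "(y' has_real_derivative (- y' x - r x)) (at x)" for x
    unfolding r_def by (rule log_sol_deriv2[OF sol]) simp
  define w1 where "w1 x = y' x + k" for x
  define E where "E x = (w1 x)\<^sup>2 / 2 + r x - k * (y x + k * x)" for x
  have dr: "(r has_real_derivative (r x * w1 x)) (at x)" for x
    unfolding r_def w1_def by (rule derivative_eq_intros dy refl)+ (simp add: algebra_simps)
  have dw: "(w1 has_real_derivative (- 1 * w1 x - (r x - k))) (at x)" for x
    unfolding w1_def by (rule derivative_eq_intros dy' refl)+ simp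
  have dE: "(E has_real_derivative (- 1 * (w1 x)\<^sup>2)) (at x)" for x
  proof -
    have 1: "((\<lambda>x. (w1 x)\<^sup>2 / 2) has_real_derivative (w1 x * (- 1 * w1 x - (r x - k)))) (at x)"
      using DERIV_cdivide[OF DERIV_power[OF dw, of 2], of 2] by (simp add: mult.commute)
    have 2: "((\<lambda>x. k * (y x + k * x)) has_real_derivative (k * w1 x)) (at x)"
      unfolding w1_def by (rule derivative_eq_intros dy refl)+ simp
    have "(E has_real_derivative (w1 x * (- 1 * w1 x - (r x - k)) + r x * w1 x - k * w1 x)) (at x)"
      unfolding E_def by (intro DERIV_diff DERIV_add 1 2 dr)
    then show ?thesis by (simp add: algebra_simps power2_eq_square)
  qed
  \<comment> \<open>From ln u \<le> u - 1 at u = r / (2 k): the linear part of the potential costs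
    only half of r, and the other half remains to bound r.\<close>
  define c where "c = k - k * ln (2 * k)"
  define D where "D = 2 * (E 0 - c)"
  have E_ge: "E x \<ge> (w1 x)\<^sup>2 / 2 + r x / 2 + c" for x
  proof -
    have rp: "r x > 0" unfolding r_def by simp
    have "ln (r x / (2 * k)) \<le> r x / (2 * k) - 1" using rp k by (intro ln_le_minus_one) simp
    moreover have "ln (r x / (2 * k)) = y x + k * x - ln (2 * k)"
      using rp k by (simp add: ln_div) (simp add: r_def flip: exp_add)
    ultimately have "k * (y x + k * x) \<le> k * (r x / (2 * k) - 1 + ln (2 * k))"
      using k by (intro mult_left_mono) auto
    also have "\<dots> = r x / 2 - c" unfolding c_def using k by (simp add: field_simps)
    finally show ?thesis unfolding E_def by simp
  qed
  have E_le: "E x \<le> E 0" if "x \<ge> 0" for x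
    using that by (rule DERIV_nonpos_imp_nonincreasing) (use dE in \<open>force\<close>)
  have bd: "(w1 x)\<^sup>2 + r x \<le> D" if "x \<ge> 0" for x
    using E_le[OF that] E_ge[of x] unfolding D_def by simp
  have rp: "r x > 0" for x unfolding r_def by simp
  have D0: "D \<ge> 0" using bd[of 0] rp[of 0] zero_le_power2[of "w1 0"] by linarith
  have w1B: "\<bar>w1 x\<bar> \<le> 1 + D" if "x \<ge> 0" for x
  proof -
    have "0 \<le> (\<bar>w1 x\<bar> - 1)\<^sup>2" by simp
    then have "2 * \<bar>w1 x\<bar> \<le> 1 + (w1 x)\<^sup>2" by (simp add: power2_diff)
    then show ?thesis using bd[OF that] rp[of x] abs_ge_zero[of "w1 x"] by linarith
  qed
  define B where "B = (1 + D) + (D + k) + D * (1 + D) + (\<bar>E 0\<bar> + \<bar>c\<bar>)"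
  have nn: "D + k \<ge> 0" "D * (1 + D) \<ge> 0" using D0 k by auto
  have "((\<lambda>x. r x - k) \<longlongrightarrow> 0) at_top"
  proof (rule damped_convergence(2)[where X = 0 and a = 1 and B = B, OF dw _ dE])
    show "((\<lambda>x. r x - k) has_real_derivative (r x * w1 x)) (at x)" for x
      using DERIV_diff[OF dr DERIV_const] by simp
    fix x :: real assume x: "x \<ge> 0"
    have r: "r x \<le> D" using bd[OF x] zero_le_power2[of "w1 x"] by linarith
    show "\<bar>w1 x\<bar> \<le> B" using w1B[OF x] nn unfolding B_def by linarith
    show "\<bar>r x - k\<bar> \<le> B" using r rp[of x] nn D0 k unfolding B_def by linarith
    have "\<bar>r x * w1 x\<bar> \<le> D * (1 + D)"
      unfolding abs_mult using r rp[of x] w1B[OF x] D0 by (intro mult_mono) auto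
    then show "\<bar>r x * w1 x\<bar> \<le> B" using nn D0 unfolding B_def by linarith
    show "\<bar>E x\<bar> \<le> B"
      using E_le[OF x] E_ge[of x] rp[of x] zero_le_power2[of "w1 x"] nn D0 unfolding B_def by linarith
  qed simp
  then have "(r \<longlongrightarrow> k) at_top" by (simp add: LIM_zero_iff)
  then show ?thesis unfolding r_def[abs_def] .
qed

lemma exp_solution_crossing:
  assumes s1: "log_sol k exp \<beta> 0 y1 y1'" and s2: "log_sol k exp \<gamma> 0 y2 y2'" and k: "k > 1 / 4"
  shows "\<exists>x>X. y1 x = y2 x"
proof (rule log_eq_sol_crossing[OF log_sol_imp_log_eq_sol[OF s1] log_sol_imp_log_eq_sol[OF s2]])
  \<comment> \<open>Midway between 1 / 4 and k, the limit of the linearised coefficient exp (k x)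
    exp y.\<close>
  define d where "d = (1 / 4 + k) / 2"
  show "d > 1 / 4" unfolding d_def using k by simp
  have d: "d < k" unfolding d_def using k by simp
  have k0: "k > 0" using k by simp
  from order_tendstoD(1)[OF exp_solution_convergence[OF s1 k0] d]
    order_tendstoD(1)[OF exp_solution_convergence[OF s2 k0] d]
  show "\<forall>\<^sub>F x in at_top. d * (y2 x - y1 x)\<^sup>2 \<le> (y2 x - y1 x) * (exp (k * x) * (exp (y2 x) - exp (y1 x)))"
  proof eventually_elim
    case (elim x)
    have *: "d * (b - a)\<^sup>2 \<le> (b - a) * (exp (k * x) * (exp b - exp a))"
      if "a \<le> b" "d < exp (k * x) * exp a" for a b
    proof -
      have "d * (b - a) \<le> exp (k * x) * exp a * (b - a)" using that by (intro mult_right_mono) auto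
      also have "\<dots> = exp (k * x) * (exp a * (b - a))" by (simp only: mult.assoc)
      also have "\<dots> \<le> exp (k * x) * (exp b - exp a)" by (intro mult_left_mono exp_tangent_bounds) simp
      finally have "(b - a) * (d * (b - a)) \<le> (b - a) * (exp (k * x) * (exp b - exp a))"
        using that by (intro mult_left_mono) auto
      then show ?thesis by (simp add: power2_eq_square mult_ac)
    qed
    show ?case
    proof (cases "y1 x \<le> y2 x")
      case True
      then show ?thesis using *[of "y1 x" "y2 x"] elim by simp
    next
      case False
      then have "d * (y1 x - y2 x)\<^sup>2 \<le> (y1 x - y2 x) * (exp (k * x) * (exp (y1 x) - exp (y2 x)))"
        using *[of "y2 x" "y1 x"] elim by simp
      then show ?thesis by (simp add: power2_commute algebra_simps)
    qed
  qed
qed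

lemma exp_solution_order:
  assumes s1: "log_sol k exp \<beta> 0 y1 y1'" and s2: "log_sol k exp \<gamma> 0 y2 y2'" and "\<beta> < \<gamma>"
    and k: "k > 0" "k \<le> 1 / 4"
  shows "y1 x < y2 x"
proof -
  have e: "((\<lambda>x::real. exp (x / 2)) \<longlongrightarrow> 0) at_bot"
    using exp_mult_tendsto_0_at_bot[of "1 / 2"] by simp
  have half: "((\<lambda>x. exp (x / 2) * y x) \<longlongrightarrow> 0) at_bot" "((\<lambda>x. exp (x / 2) * y' x) \<longlongrightarrow> 0) at_bot"
    if "log_sol k exp \<alpha> 0 y y'" for \<alpha> y y'
    using tendsto_mult[OF e log_sol_tendsto[OF that]]
      tendsto_mult[OF e log_sol_deriv_tendsto_0[OF that isCont_exp k(1)]] by simp_all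
  have *: "exp (k * x) * (exp b - exp a) \<le> (b - a) / 4"
    if "a < b" and b: "exp (k * x) * exp b \<le> k" for a b x :: real
  proof -
    have "exp (k * x) * (exp b - exp a) \<le> exp (k * x) * (exp b * (b - a))"
      by (intro mult_left_mono exp_tangent_bounds) simp
    also have "\<dots> = (exp (k * x) * exp b) * (b - a)" by (simp only: mult.assoc)
    also have "\<dots> \<le> 1 / 4 * (b - a)" using b that k by (intro mult_right_mono) auto
    finally show ?thesis by simp
  qed
  \<comment> \<open>The singular solution: it is affine, and along it the coefficient exp (k x) exp
    s is constantly k.\<close>
  define s where "s x = ln k - k * x" for x
  have s: "exp (k * x) * exp (s x) = k" for x
    unfolding s_def using k by (simp add: exp_diff)
  have ds: "(s has_real_derivative (- k)) (at x)" for x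
    unfolding s_def by (auto intro!: derivative_eq_intros)
  have s_sol: "log_eq_sol k exp s (\<lambda>x. - k)"
    unfolding log_eq_sol_def using ds s by simp
  have below: "y2 x < s x" for x
  proof (rule log_eq_sol_order[OF log_sol_imp_log_eq_sol[OF s2] s_sol])
    have "filterlim (\<lambda>x. ln k + - (k * x)) at_top at_bot"
      by (intro filterlim_tendsto_add_at_top[OF tendsto_const])
         (use filterlim_tendsto_pos_mult_at_bot[OF tendsto_const k(1) filterlim_ident]
           in \<open>simp add: filterlim_uminus_at_top\<close>)
    then have "\<forall>\<^sub>F x in at_bot. s x > \<gamma>" unfolding s_def by (simp add: filterlim_at_top_dense)
    then show "\<forall>\<^sub>F x in at_bot. y2 x < s x"
    proof eventually_elim
      case (elim x)
      have "y2 x \<le> \<gamma>" by (rule log_sol_le[OF s2 isCont_exp _ k(1)]) simp_all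
      with elim show ?case by simp
    qed
    have "((\<lambda>x. ln k * exp (x / 2) - k * (exp (1 / 2 * x) * x)) \<longlongrightarrow> ln k * 0 - k * 0) at_bot"
      by (intro tendsto_intros e exp_mult_linear_tendsto_0_at_bot) simp
    then have s0: "((\<lambda>x. exp (x / 2) * s x) \<longlongrightarrow> 0) at_bot"
      unfolding s_def by (simp add: algebra_simps)
    show "((\<lambda>x. exp (x / 2) * (s x - y2 x)) \<longlongrightarrow> 0) at_bot"
      using tendsto_diff[OF s0 half(1)[OF s2]] by (simp add: right_diff_distrib)
    show "((\<lambda>x. exp (x / 2) * (- k - y2' x)) \<longlongrightarrow> 0) at_bot"
      using tendsto_diff[OF tendsto_mult_left[OF e, of "- k"] half(2)[OF s2]]
      by (simp add: algebra_simps)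
    show "exp (k * x) * (exp (s x) - exp (y2 x)) \<le> (s x - y2 x) / 4" if "y2 x < s x" for x
      using *[OF that, of x] s[of x] by simp
  qed
  show ?thesis
  proof (rule log_eq_sol_order[OF log_sol_imp_log_eq_sol[OF s1] log_sol_imp_log_eq_sol[OF s2]])
    have "((\<lambda>x. y2 x - y1 x) \<longlongrightarrow> \<gamma> - \<beta>) at_bot"
      by (intro tendsto_diff log_sol_tendsto[OF s1] log_sol_tendsto[OF s2])
    from order_tendstoD(1)[OF this, of 0] \<open>\<beta> < \<gamma>\<close>
    show "\<forall>\<^sub>F x in at_bot. y1 x < y2 x" by (simp add: eventually_mono)
    show "((\<lambda>x. exp (x / 2) * (y2 x - y1 x)) \<longlongrightarrow> 0) at_bot"
      using tendsto_diff[OF half(1)[OF s2] half(1)[OF s1]] by (simp add: right_diff_distrib)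
    show "((\<lambda>x. exp (x / 2) * (y2' x - y1' x)) \<longlongrightarrow> 0) at_bot"
      using tendsto_diff[OF half(2)[OF s2] half(2)[OF s1]] by (simp add: right_diff_distrib)
    fix x assume lt: "y1 x < y2 x"
    have "exp (k * x) * exp (y2 x) \<le> exp (k * x) * exp (s x)"
      using below[of x] by (intro mult_left_mono) auto
    then show "exp (k * x) * (exp (y2 x) - exp (y1 x)) \<le> (y2 x - y1 x) / 4"
      using *[OF lt] s[of x] by simp
  qed
qed

text \<open>Near the centre |y| is below |\<beta>| + 1 by continuity, so the truncation at that
  level is inactive there.\<close>

lemma radial_solution_exists_locally:
  assumes f: "loc_lip f" and k: "k > 0"
  shows "\<exists>R v. radial_solution k f \<beta> R v"
proof -
  define M where "M = \<bar>\<beta>\<bar> + 1"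
  have M: "M > 0" unfolding M_def by simp
  obtain L B where LB: "L-lipschitz_on UNIV (truncate M f)" "\<And>v. \<bar>truncate M f v\<bar> \<le> B"
    using truncate_lipschitz_bounded[OF f M] by blast
  obtain y y' where sol: "log_sol k (truncate M f) \<beta> 0 y y'"
    using log_sol_exists[OF k LB] by blast
  have "((\<lambda>x. \<bar>y x\<bar>) \<longlongrightarrow> \<bar>\<beta>\<bar>) at_bot" by (intro tendsto_intros log_sol_tendsto[OF sol])
  then have "\<forall>\<^sub>F x in at_bot. \<bar>y x\<bar> < M" by (rule order_tendstoD) (simp add: M_def)
  then obtain X where X: "\<And>x. x \<le> X \<Longrightarrow> \<bar>y x\<bar> < M" by (auto simp: eventually_at_bot_linorder)
  have "log_sol k f \<beta> (1 - ln (radius X)) y y'"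
    by (rule log_sol_transfer[OF sol])
       (use X in \<open>auto simp: radius_def intro!: truncate_eq less_imp_le\<close>)
  from log_sol_imp_radial_solution[OF this radius_pos less_imp_le[OF radius_less_e] loc_lip_isCont[OF f]]
  show ?thesis by blast
qed

section \<open>Transfer to the ball and conclusion\<close>

lemma radial_solution_of_log_sol_entire:
  "log_sol k f \<beta> 0 y y' \<Longrightarrow> loc_lip f \<Longrightarrow> radial_solution k f \<beta> (exp 1) (radial_of \<beta> y)"
  by (rule log_sol_imp_radial_solution[OF _ _ _ loc_lip_isCont]) simp_all

lemma log_sol_of_radial_solution_entire:
  assumes "radial_solution k f \<beta> (exp 1) v"
  obtains y' where "log_sol k f \<beta> 0 (\<lambda>x. v (radius x)) y'"
  using radial_solution_imp_log_sol[OF assms] by simp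

text \<open>Crossings at arbitrarily large x are intersections accumulating at the boundary r =
  e.\<close>

lemma intersect_infinitely_oftenI:
  assumes "\<And>X. \<exists>x>X. v (radius x) = w (radius x)"
  shows "intersect_infinitely_often v w"
proof -
  define A where "A = {x. v (radius x) = w (radius x)}"
  have "infinite A"
  proof
    assume fin: "finite A"
    obtain x where x: "x > Max A" "x \<in> A" using assms[of "Max A"] unfolding A_def by blast
    then show False using Max_ge[OF fin x(2)] by simp
  qed
  moreover have "inj_on radius A" by (rule inj_on_inverseI[of _ log_coord]) (rule log_coord_radius)
  ultimately have "infinite (radius ` A)" by (simp add: finite_image_iff)
  moreover have "radius ` A \<subseteq> {r. 0 < r \<and> r < exp 1 \<and> v r = w r}"
    unfolding A_def using radius_pos radius_less_e by auto
  ultimately show ?thesis unfolding intersect_infinitely_often_def using infinite_super by blast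
qed

lemma all_radii_less_e:
  assumes "P 0" "\<And>x. P (radius x)" "r \<in> {0..<exp 1}"
  shows "P r"
  using assms(1) assms(2)[of "log_coord r"] radius_log_coord[of r] assms(3) by (cases "r = 0") auto

text \<open>Positive entire solutions are excluded, so there is a solution on some ball of radius S
  with a zero inside. If S exceeded R, it would extend v against maximality; hence S \<le> R, and
  uniqueness hands the zero over to v.\<close>

lemma (in power_nonlinearity) maximal_subcritical_vanishes:
  assumes "p < p_c k" "\<beta> > 0" and max: "maximal_radial_solution k (f_pow p) \<beta> R v"
  shows "\<exists>r\<in>{0<..<R}. v r = 0"
proof -
  have ll: "loc_lip (f_pow p)" using loc_lip_f_pow p_gt_1 by simp
  have v: "radial_solution k (f_pow p) \<beta> R v" using max unfolding maximal_radial_solution_def by simp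
  then have R: "0 < R" unfolding radial_solution_def by simp
  show ?thesis
    using \<open>\<beta> > 0\<close>
  proof (cases rule: positive_or_vanishing_solution)
    case (1 y y')
    then show ?thesis using no_positive_entire_solution \<open>\<beta> > 0\<close> \<open>p < p_c k\<close> by blast
  next
    case (2 y y' x1 x2)
    define S where "S = radius x2"
    have "log_sol k (f_pow p) \<beta> (1 - ln S) y y'" using 2 unfolding S_def radius_def by simp
    from log_sol_imp_radial_solution[OF this]
    have w: "radial_solution k (f_pow p) \<beta> S (radial_of \<beta> y)"
      using radius_pos[of x2] radius_less_e[of x2] f_pow_isCont by (simp add: S_def)
    have S: "0 < S" unfolding S_def by (rule radius_pos)
    have "S \<le> R"
    proof (rule ccontr)
      assume "\<not> S \<le> R"
      then have "R < S" by simp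
      moreover have "\<forall>r\<in>{0..<R}. radial_of \<beta> y r = v r"
        using radial_solution_unique[OF radial_solution_restrict[OF w R] v ll k] \<open>R < S\<close> by simp
      ultimately show False using max w unfolding maximal_radial_solution_def by blast
    qed
    have r: "radius x1 \<in> {0<..<S}"
      using 2 radius_pos by (simp add: S_def radius_less_radius_iff)
    then have "v (radius x1) = radial_of \<beta> y (radius x1)"
      by (intro radial_solution_unique[OF radial_solution_restrict[OF v S \<open>S \<le> R\<close>] w ll k]) auto
    then have "v (radius x1) = 0" using 2 by (simp add: radial_of_radius)
    then show ?thesis using r \<open>S \<le> R\<close> by force
  qed
qed

text \<open>The vanishing alternative of the dichotomy contradicts positivity.\<close>

lemma (in power_nonlinearity) supercritical_exists:
  assumes "p \<ge> p_c k" "\<beta> > 0"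
  shows "\<exists>v. radial_solution k (f_pow p) \<beta> (exp 1) v"
  using \<open>\<beta> > 0\<close>
proof (cases rule: positive_or_vanishing_solution)
  case (1 y y')
  then show ?thesis using radial_solution_of_log_sol_entire loc_lip_f_pow p_gt_1 less_imp_le by blast
next
  case (2 y y' x1 x2)
  then have "y x1 > 0" using assms by (intro log_sol_positive) auto
  with 2 show ?thesis by simp
qed

theorem theorem1p7:
  fixes k :: real
  assumes "k > 0"
  shows
    "(\<forall>f\<in>nonlinearities k. \<forall>\<beta>.
        (\<exists>R v. maximal_radial_solution k f \<beta> R v) \<and>
        (\<forall>R v w. radial_solution k f \<beta> R v \<and> radial_solution k f \<beta> R w \<longrightarrow>
           (\<forall>r\<in>{0..<R}. v r = w r)))
     \<and>
     (\<forall>\<beta>. \<exists>v. radial_solution k exp \<beta> (exp 1) v)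
     \<and>
     (\<forall>\<beta> \<gamma> v w. \<beta> < \<gamma> \<and> radial_solution k exp \<beta> (exp 1) v \<and> radial_solution k exp \<gamma> (exp 1) w \<longrightarrow>
        (k \<le> 1/4 \<longrightarrow> (\<forall>r\<in>{0..<exp 1}. v r < w r)) \<and>
        (k > 1/4 \<longrightarrow> intersect_infinitely_often v w))
     \<and>
     (\<forall>p \<beta> R v. p_s k < p \<and> p < p_c k \<and> \<beta> > 0 \<and> maximal_radial_solution k (f_pow p) \<beta> R v \<longrightarrow>
        (\<exists>r\<in>{0<..<R}. v r = 0))
     \<and>
     (\<forall>p \<beta>. p \<ge> p_c k \<and> \<beta> > 0 \<longrightarrow>
        (\<exists>v. radial_solution k (f_pow p) \<beta> (exp 1) v) \<and>
        (\<forall>v. radial_solution k (f_pow p) \<beta> (exp 1) v \<longrightarrow> (\<forall>r\<in>{0..<exp 1}. v r > 0)))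
     \<and>
     (\<forall>p \<beta> \<gamma> v w. p \<ge> p_c k \<and> 0 < \<beta> \<and> \<beta> < \<gamma> \<and>
        radial_solution k (f_pow p) \<beta> (exp 1) v \<and> radial_solution k (f_pow p) \<gamma> (exp 1) w \<longrightarrow>
        (ereal p \<ge> p_JL k \<longrightarrow> (\<forall>r\<in>{0..<exp 1}. v r < w r)) \<and>
        (p_c k < p \<and> ereal p < p_JL k \<longrightarrow> intersect_infinitely_often v w))"
proof (intro conjI)
  note k = \<open>k > 0\<close>
  \<comment> \<open>p_c - p_s = k > 0, so every p \<ge> p_c is admissible.\<close>
  have pnl: "power_nonlinearity k p" if "p \<ge> p_c k" for p
    using that k unfolding power_nonlinearity_def p_c_def p_s_def by simp
  have v0: "v 0 = \<beta>" if "radial_solution k f \<beta> R v" for f \<beta> R v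
    using that unfolding radial_solution_def by simp
  show "\<forall>f\<in>nonlinearities k. \<forall>\<beta>. (\<exists>R v. maximal_radial_solution k f \<beta> R v) \<and>
      (\<forall>R v w. radial_solution k f \<beta> R v \<and> radial_solution k f \<beta> R w \<longrightarrow> (\<forall>r\<in>{0..<R}. v r = w r))"
  proof (intro ballI allI conjI impI)
    fix f \<beta> assume "f \<in> nonlinearities k"
    then have f: "loc_lip f" by (rule loc_lip_nonlinearities[OF k])
    then show "\<exists>R v. maximal_radial_solution k f \<beta> R v"
      using radial_solution_exists_locally[OF f k] maximal_radial_solution_exists[OF _ f k] by metis
    show "v r = w r" if "radial_solution k f \<beta> R v \<and> radial_solution k f \<beta> R w" "r \<in> {0..<R}" for R v w r
      using radial_solution_unique[OF _ _ f k that(2)] that(1) by blast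
  qed
  show "\<forall>\<beta>. \<exists>v. radial_solution k exp \<beta> (exp 1) v"
    using log_sol_exp_exists[OF k] radial_solution_of_log_sol_entire[OF _ loc_lip_exp] by metis
  show "\<forall>\<beta> \<gamma> v w. \<beta> < \<gamma> \<and> radial_solution k exp \<beta> (exp 1) v \<and> radial_solution k exp \<gamma> (exp 1) w \<longrightarrow>
        (k \<le> 1/4 \<longrightarrow> (\<forall>r\<in>{0..<exp 1}. v r < w r)) \<and> (k > 1/4 \<longrightarrow> intersect_infinitely_often v w)"
  proof (intro allI impI)
    fix \<beta> \<gamma> v w
    assume a: "\<beta> < \<gamma> \<and> radial_solution k exp \<beta> (exp 1) v \<and> radial_solution k exp \<gamma> (exp 1) w"
    obtain y1' where s1: "log_sol k exp \<beta> 0 (\<lambda>x. v (radius x)) y1'"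
      using a log_sol_of_radial_solution_entire by blast
    obtain y2' where s2: "log_sol k exp \<gamma> 0 (\<lambda>x. w (radius x)) y2'"
      using a log_sol_of_radial_solution_entire by blast
    have "v r < w r" if "k \<le> 1/4" "r \<in> {0..<exp 1}" for r
      using exp_solution_order[OF s1 s2 _ k that(1)] a v0[of exp \<beta> "exp 1" v] v0[of exp \<gamma> "exp 1" w]
      by (intro all_radii_less_e[of "\<lambda>r. v r < w r", OF _ _ that(2)]) auto
    moreover have "intersect_infinitely_often v w" if "k > 1/4"
      using exp_solution_crossing[OF s1 s2 that] by (rule intersect_infinitely_oftenI)
    ultimately show "(k \<le> 1/4 \<longrightarrow> (\<forall>r\<in>{0..<exp 1}. v r < w r)) \<and> (k > 1/4 \<longrightarrow> intersect_infinitely_often v w)"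
      by blast
  qed
  show "\<forall>p \<beta> R v. p_s k < p \<and> p < p_c k \<and> \<beta> > 0 \<and> maximal_radial_solution k (f_pow p) \<beta> R v \<longrightarrow>
        (\<exists>r\<in>{0<..<R}. v r = 0)"
    using power_nonlinearity.maximal_subcritical_vanishes k unfolding power_nonlinearity_def by blast
  show "\<forall>p \<beta>. p \<ge> p_c k \<and> \<beta> > 0 \<longrightarrow>
        (\<exists>v. radial_solution k (f_pow p) \<beta> (exp 1) v) \<and>
        (\<forall>v. radial_solution k (f_pow p) \<beta> (exp 1) v \<longrightarrow> (\<forall>r\<in>{0..<exp 1}. v r > 0))"
  proof (intro allI impI conjI ballI)
    fix p \<beta> :: real assume a: "p \<ge> p_c k \<and> \<beta> > 0"
    interpret power_nonlinearity k p using pnl a by blast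
    show "\<exists>v. radial_solution k (f_pow p) \<beta> (exp 1) v" using supercritical_exists a by blast
    fix v r assume v: "radial_solution k (f_pow p) \<beta> (exp 1) v" and r: "r \<in> {0..<exp 1 :: real}"
    obtain y' where s: "log_sol k (f_pow p) \<beta> 0 (\<lambda>x. v (radius x)) y'"
      using v log_sol_of_radial_solution_entire by blast
    show "v r > 0"
      using log_sol_positive[OF s] a v0[OF v]
      by (intro all_radii_less_e[of "\<lambda>r. v r > 0", OF _ _ r]) auto
  qed
  show "\<forall>p \<beta> \<gamma> v w. p \<ge> p_c k \<and> 0 < \<beta> \<and> \<beta> < \<gamma> \<and>
        radial_solution k (f_pow p) \<beta> (exp 1) v \<and> radial_solution k (f_pow p) \<gamma> (exp 1) w \<longrightarrow>
        (ereal p \<ge> p_JL k \<longrightarrow> (\<forall>r\<in>{0..<exp 1}. v r < w r)) \<and>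
        (p_c k < p \<and> ereal p < p_JL k \<longrightarrow> intersect_infinitely_often v w)"
  proof (intro allI impI)
    fix p \<beta> \<gamma> v w
    assume a: "p \<ge> p_c k \<and> 0 < \<beta> \<and> \<beta> < \<gamma> \<and>
        radial_solution k (f_pow p) \<beta> (exp 1) v \<and> radial_solution k (f_pow p) \<gamma> (exp 1) w"
    then interpret power_nonlinearity k p using pnl by blast
    have \<beta>\<gamma>: "\<beta> > 0" "\<gamma> > 0" "\<beta> < \<gamma>" using a by auto
    obtain y1' where s1: "log_sol k (f_pow p) \<beta> 0 (\<lambda>x. v (radius x)) y1'"
      using a log_sol_of_radial_solution_entire by blast
    obtain y2' where s2: "log_sol k (f_pow p) \<gamma> 0 (\<lambda>x. w (radius x)) y2'"
      using a log_sol_of_radial_solution_entire by blast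
    have "v r < w r" if JL: "p_JL k \<le> ereal p" and r: "r \<in> {0..<exp 1}" for r
    proof -
      \<comment> \<open>The borderline p = p_c is excluded first: both \<open>p_JL_le_iff\<close>
        and \<open>supercritical_order\<close> presume p > p_c.\<close>
      have pc: "p_c k < p" using p_c_less_p_JL JL by (meson less_ereal.simps(1) less_le_trans)
      have "p * \<mu> \<le> 1 / 4" using p_JL_le_iff[OF pc] JL by simp
      from supercritical_order[OF s1 \<beta>\<gamma>(1) s2 \<beta>\<gamma>(3) pc this]
      show ?thesis using a v0[of "f_pow p" \<beta> "exp 1" v] v0[of "f_pow p" \<gamma> "exp 1" w]
        by (intro all_radii_less_e[of "\<lambda>r. v r < w r", OF _ _ r]) auto
    qed
    moreover have "intersect_infinitely_often v w" if "p_c k < p" "ereal p < p_JL k"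
    proof -
      have "p * \<mu> > 1 / 4" using p_JL_le_iff[OF that(1)] that(2) by (simp add: not_le[symmetric])
      from supercritical_crossing[OF s1 \<beta>\<gamma>(1) s2 \<beta>\<gamma>(2) that(1) this]
      show ?thesis by (rule intersect_infinitely_oftenI)
    qed
    ultimately show "(ereal p \<ge> p_JL k \<longrightarrow> (\<forall>r\<in>{0..<exp 1}. v r < w r)) \<and>
        (p_c k < p \<and> ereal p < p_JL k \<longrightarrow> intersect_infinitely_often v w)" by blast
  qed
qed

end
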